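(* Let $G$ be a $3$-dimensional unimodular Lie group equipped with a left invariant statistical structure $(g,\nabla)$ such that $\nabla\neq\nabla^g$, where $\nabla^g$ is the Levi-Civita connection of $g$. If $(G,g,\nabla)$ is conjugate symmetric, then $G$ is locally isomorphic to the special unitary group $\mathrm{SU}_2$, the Euclidean motion group $\mathrm{E}_2=\mathrm{SO}_2\ltimes\mathbb{R}^2$, or $\mathbb{R}^3$.
   Context: A left invariant statistical structure $(g,\nabla)$ on a Lie group $G$ consists of a left invariant Riemannian metric $g$ and a left invariant torsion free linear connection $\nabla$ such that $\nabla g$, $(X,Y,Z)\mapsto(\nabla_Xg)(Y,Z)$, is totally symmetric. The dual (conjugate) connection $\nabla^*$ of $\nabla$ with respect to $g$ is defined by $X\,g(Y,Z)=g(\nabla_XY,Z)+g(Y,\nabla^*_XZ)$. A statistical manifold $(M,g,\nabla)$ is conjugate symmetric if the curvature tensors $R$ of $\nabla$ and $R^*$ of $\nabla^*$ coincide: $R=R^*$. Two Lie groups are locally isomorphic if their Lie algebras are isomorphic. *)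

theory Defs
  imports "HOL-Analysis.Analysis" "HOL-Algebra.Group"
begin

section \<open>Smooth maps between Euclidean spaces\<close>

text \<open>Both notions are meant for open sets \<open>S\<close>: derivatives are full (not one-sided) derivatives.\<close>

primrec Ck_on :: "nat \<Rightarrow> ('a::real_normed_vector \<Rightarrow> 'b::real_normed_vector) \<Rightarrow> 'a set \<Rightarrow> bool" where
  "Ck_on 0 f S \<longleftrightarrow> continuous_on S f"
| "Ck_on (Suc k) f S \<longleftrightarrow>
     (\<forall>x\<in>S. f differentiable (at x)) \<and> (\<forall>v. Ck_on k (\<lambda>x. frechet_derivative f (at x) v) S)"

definition smooth_on :: "'a::real_normed_vector set \<Rightarrow> ('a \<Rightarrow> 'b::real_normed_vector) \<Rightarrow> bool" where
  "smooth_on S f \<longleftrightarrow> (\<forall>k. Ck_on k f S)"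

section \<open>Lie groups\<close>

text \<open>A chart is a pair \<open>(U, \<phi>)\<close>; the values of \<open>\<phi>\<close> outside \<open>U\<close> are irrelevant, and
  the inverse of the chart is \<open>inv_into U \<phi>\<close>. The dimension of the group is the dimension of the
  model space \<open>'e\<close>.\<close>

record ('a, 'e) smooth_group = "'a monoid" +
  gtop :: "'a topology"
  charts :: "('a set \<times> ('a \<Rightarrow> 'e)) set"

locale lie_group = group L for L :: "('a, 'e::euclidean_space) smooth_group" (structure) +
  assumes topspace_gtop: "topspace (gtop L) = carrier L"
    and Hausdorff: "Hausdorff_space (gtop L)"
    and second_countable: "second_countable (gtop L)"
    and chart: "\<And>U \<phi>. (U, \<phi>) \<in> charts L \<Longrightarrow>
          openin (gtop L) U \<and> open (\<phi> ` U) \<and>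
          homeomorphic_map (subtopology (gtop L) U) (top_of_set (\<phi> ` U)) \<phi>"
    and charts_cover: "\<Union> (fst ` charts L) = carrier L"
    and charts_compatible: "\<And>U \<phi> V \<psi>. (U, \<phi>) \<in> charts L \<Longrightarrow> (V, \<psi>) \<in> charts L \<Longrightarrow>
          smooth_on (\<phi> ` (U \<inter> V)) (\<lambda>x. \<psi> (inv_into U \<phi> x))"
    and continuous_mult:
          "continuous_map (prod_topology (gtop L) (gtop L)) (gtop L) (\<lambda>(p, q). p \<otimes> q)"
    and smooth_mult: "\<And>U \<phi> V \<psi> W \<theta>. (U, \<phi>) \<in> charts L \<Longrightarrow> (V, \<psi>) \<in> charts L \<Longrightarrow> (W, \<theta>) \<in> charts L \<Longrightarrow>
          smooth_on {(x, y). x \<in> \<phi> ` U \<and> y \<in> \<psi> ` V \<and> inv_into U \<phi> x \<otimes> inv_into V \<psi> y \<in> W}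
            (\<lambda>(x, y). \<theta> (inv_into U \<phi> x \<otimes> inv_into V \<psi> y))"
    and continuous_inverse: "continuous_map (gtop L) (gtop L) (\<lambda>p. inv p)"
    and smooth_inverse: "\<And>U \<phi> W \<theta>. (U, \<phi>) \<in> charts L \<Longrightarrow> (W, \<theta>) \<in> charts L \<Longrightarrow>
          smooth_on {x \<in> \<phi> ` U. inv (inv_into U \<phi> x) \<in> W} (\<lambda>x. \<theta> (inv (inv_into U \<phi> x)))"

text \<open>Unimodular: a left Haar measure is also right invariant. (Regularity of a Haar measure is
  automatic here, since the group is locally compact and second countable.)\<close>

definition left_haar_measure :: "('a, 'e) smooth_group \<Rightarrow> 'a measure \<Rightarrow> bool" where
  "left_haar_measure L \<mu> \<longleftrightarrow>
     space \<mu> = carrier L \<and>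
     sets \<mu> = sigma_sets (carrier L) {U. openin (gtop L) U} \<and>
     (\<forall>K. compactin (gtop L) K \<longrightarrow> emeasure \<mu> K < \<infinity>) \<and>
     (\<forall>U. openin (gtop L) U \<and> U \<noteq> {} \<longrightarrow> 0 < emeasure \<mu> U) \<and>
     (\<forall>a\<in>carrier L. \<forall>A\<in>sets \<mu>. emeasure \<mu> ((\<lambda>p. a \<otimes>\<^bsub>L\<^esub> p) ` A) = emeasure \<mu> A)"

definition unimodular :: "('a, 'e) smooth_group \<Rightarrow> bool" where
  "unimodular L \<longleftrightarrow> (\<exists>\<mu>. left_haar_measure L \<mu> \<and>
     (\<forall>a\<in>carrier L. \<forall>A\<in>sets \<mu>. emeasure \<mu> ((\<lambda>p. p \<otimes>\<^bsub>L\<^esub> a) ` A) = emeasure \<mu> A))"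

section \<open>Functions, vector fields and the Lie algebra\<close>

text \<open>So that equality of functions on the group is equality in HOL, smooth functions are normalised
  to be \<open>0\<close> outside the carrier. For the same reason a vector field, i.e. a derivation of the algebra
  of smooth functions, is normalised to be \<open>0\<close> on all other functions.\<close>

definition smooth_functions :: "('a, 'e::euclidean_space) smooth_group \<Rightarrow> ('a \<Rightarrow> real) set" where
  "smooth_functions L = {f. (\<forall>p. p \<notin> carrier L \<longrightarrow> f p = 0) \<and>
     (\<forall>(U, \<phi>)\<in>charts L. smooth_on (\<phi> ` U) (\<lambda>x. f (inv_into U \<phi> x)))}"

type_synonym 'a operator = "('a \<Rightarrow> real) \<Rightarrow> ('a \<Rightarrow> real)"

definition vector_fields :: "('a, 'e::euclidean_space) smooth_group \<Rightarrow> 'a operator set" where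
  "vector_fields L = {X.
     (\<forall>f\<in>smooth_functions L. X f \<in> smooth_functions L) \<and>
     (\<forall>f. f \<notin> smooth_functions L \<longrightarrow> X f = (\<lambda>p. 0)) \<and>
     (\<forall>f\<in>smooth_functions L. \<forall>h\<in>smooth_functions L.
        X (\<lambda>p. f p + h p) = (\<lambda>p. X f p + X h p) \<and>
        X (\<lambda>p. f p * h p) = (\<lambda>p. f p * X h p + h p * X f p)) \<and>
     (\<forall>c. \<forall>f\<in>smooth_functions L. X (\<lambda>p. c * f p) = (\<lambda>p. c * X f p))}"

definition vf_add :: "'a operator \<Rightarrow> 'a operator \<Rightarrow> 'a operator" where
  "vf_add X Y = (\<lambda>f p. X f p + Y f p)"

definition vf_mult :: "('a \<Rightarrow> real) \<Rightarrow> 'a operator \<Rightarrow> 'a operator" where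
  "vf_mult h X = (\<lambda>f p. h p * X f p)"

definition lie_bracket :: "'a operator \<Rightarrow> 'a operator \<Rightarrow> 'a operator" where
  "lie_bracket X Y = (\<lambda>f p. X (Y f) p - Y (X f) p)"

text \<open>\<open>translate L a f\<close> is \<open>f\<close> composed with the left translation by \<open>a\<close>, extended to the whole
  type by the identity outside the carrier, and \<open>push L a X\<close> is the pushforward of the vector field
  \<open>X\<close> along this translation.\<close>

definition translate :: "('a, 'e) smooth_group \<Rightarrow> 'a \<Rightarrow> 'a operator" where
  "translate L a f = (\<lambda>p. if p \<in> carrier L then f (a \<otimes>\<^bsub>L\<^esub> p) else f p)"

definition push :: "('a, 'e) smooth_group \<Rightarrow> 'a \<Rightarrow> 'a operator \<Rightarrow> 'a operator" where
  "push L a X = (\<lambda>f. translate L (inv\<^bsub>L\<^esub> a) (X (translate L a f)))"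

definition lie_algebra :: "('a, 'e::euclidean_space) smooth_group \<Rightarrow> 'a operator set" where
  "lie_algebra L = {X \<in> vector_fields L. \<forall>a\<in>carrier L. push L a X = X}"

text \<open>Two Lie groups are locally isomorphic if their Lie algebras are isomorphic.\<close>

definition locally_isomorphic ::
    "('a, 'd::euclidean_space) smooth_group \<Rightarrow> ('b, 'e::euclidean_space) smooth_group \<Rightarrow> bool" where
  "locally_isomorphic L M \<longleftrightarrow> (\<exists>\<Phi>. bij_betw \<Phi> (lie_algebra L) (lie_algebra M) \<and>
     (\<forall>X\<in>lie_algebra L. \<forall>Y\<in>lie_algebra L.
        \<Phi> (vf_add X Y) = vf_add (\<Phi> X) (\<Phi> Y) \<and>
        \<Phi> (lie_bracket X Y) = lie_bracket (\<Phi> X) (\<Phi> Y)) \<and>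
     (\<forall>c. \<forall>X\<in>lie_algebra L. \<Phi> (vf_mult (\<lambda>_. c) X) = vf_mult (\<lambda>_. c) (\<Phi> X)))"

section \<open>Metrics and connections\<close>

text \<open>Tensor fields are given as multilinear maps over the ring of smooth functions. Metrics and
  connections matter only on \<open>vector_fields L\<close>. A vector field \<open>X\<close> vanishes at \<open>p\<close> iff \<open>X f p = 0\<close>
  for all \<open>f\<close>.\<close>

type_synonym 'a metric_field = "'a operator \<Rightarrow> 'a operator \<Rightarrow> ('a \<Rightarrow> real)"
type_synonym 'a connection = "'a operator \<Rightarrow> 'a operator \<Rightarrow> 'a operator"

definition riemannian_metric :: "('a, 'e::euclidean_space) smooth_group \<Rightarrow> 'a metric_field \<Rightarrow> bool" where
  "riemannian_metric L g \<longleftrightarrow>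
     (\<forall>X\<in>vector_fields L. \<forall>Y\<in>vector_fields L. g X Y \<in> smooth_functions L \<and> g X Y = g Y X) \<and>
     (\<forall>X\<in>vector_fields L. \<forall>Y\<in>vector_fields L. \<forall>Z\<in>vector_fields L.
        g (vf_add X Y) Z = (\<lambda>p. g X Z p + g Y Z p)) \<and>
     (\<forall>h\<in>smooth_functions L. \<forall>X\<in>vector_fields L. \<forall>Y\<in>vector_fields L.
        g (vf_mult h X) Y = (\<lambda>p. h p * g X Y p)) \<and>
     (\<forall>X\<in>vector_fields L. \<forall>p\<in>carrier L.
        0 \<le> g X X p \<and> (g X X p = 0 \<longrightarrow> (\<forall>f. X f p = 0)))"

definition linear_connection :: "('a, 'e::euclidean_space) smooth_group \<Rightarrow> 'a connection \<Rightarrow> bool" where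
  "linear_connection L D \<longleftrightarrow>
     (\<forall>X\<in>vector_fields L. \<forall>Y\<in>vector_fields L. D X Y \<in> vector_fields L) \<and>
     (\<forall>X\<in>vector_fields L. \<forall>Y\<in>vector_fields L. \<forall>Z\<in>vector_fields L.
        D (vf_add X Y) Z = vf_add (D X Z) (D Y Z) \<and>
        D X (vf_add Y Z) = vf_add (D X Y) (D X Z)) \<and>
     (\<forall>h\<in>smooth_functions L. \<forall>X\<in>vector_fields L. \<forall>Y\<in>vector_fields L.
        D (vf_mult h X) Y = vf_mult h (D X Y) \<and>
        D X (vf_mult h Y) = vf_add (vf_mult (X h) Y) (vf_mult h (D X Y)))"

definition torsion_free :: "('a, 'e::euclidean_space) smooth_group \<Rightarrow> 'a connection \<Rightarrow> bool" where
  "torsion_free L D \<longleftrightarrow> (\<forall>X\<in>vector_fields L. \<forall>Y\<in>vector_fields L.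
     (\<lambda>f p. D X Y f p - D Y X f p) = lie_bracket X Y)"

text \<open>\<open>cov_metric D g X Y Z\<close> is \<open>(D\<^sub>X g)(Y, Z)\<close>.\<close>

definition cov_metric ::
    "'a connection \<Rightarrow> 'a metric_field \<Rightarrow> 'a operator \<Rightarrow> 'a operator \<Rightarrow> 'a operator \<Rightarrow> ('a \<Rightarrow> real)" where
  "cov_metric D g X Y Z = (\<lambda>p. X (g Y Z) p - g (D X Y) Z p - g Y (D X Z) p)"

definition curvature :: "'a connection \<Rightarrow> 'a operator \<Rightarrow> 'a operator \<Rightarrow> 'a operator \<Rightarrow> 'a operator" where
  "curvature D X Y Z =
     (\<lambda>f p. D X (D Y Z) f p - D Y (D X Z) f p - D (lie_bracket X Y) Z f p)"

definition left_invariant_metric :: "('a, 'e::euclidean_space) smooth_group \<Rightarrow> 'a metric_field \<Rightarrow> bool" where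
  "left_invariant_metric L g \<longleftrightarrow> (\<forall>a\<in>carrier L. \<forall>X\<in>vector_fields L. \<forall>Y\<in>vector_fields L.
     translate L a (g (push L a X) (push L a Y)) = g X Y)"

definition left_invariant_connection :: "('a, 'e::euclidean_space) smooth_group \<Rightarrow> 'a connection \<Rightarrow> bool" where
  "left_invariant_connection L D \<longleftrightarrow> (\<forall>a\<in>carrier L. \<forall>X\<in>vector_fields L. \<forall>Y\<in>vector_fields L.
     D (push L a X) (push L a Y) = push L a (D X Y))"

definition levi_civita :: "('a, 'e::euclidean_space) smooth_group \<Rightarrow> 'a metric_field \<Rightarrow> 'a connection \<Rightarrow> bool" where
  "levi_civita L g D \<longleftrightarrow> linear_connection L D \<and> torsion_free L D \<and>
     (\<forall>X\<in>vector_fields L. \<forall>Y\<in>vector_fields L. \<forall>Z\<in>vector_fields L. cov_metric D g X Y Z = (\<lambda>p. 0))"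

text \<open>The two equations below generate all permutations of \<open>X, Y, Z\<close>.\<close>

definition left_invariant_statistical_structure ::
    "('a, 'e::euclidean_space) smooth_group \<Rightarrow> 'a metric_field \<Rightarrow> 'a connection \<Rightarrow> bool" where
  "left_invariant_statistical_structure L g D \<longleftrightarrow>
     riemannian_metric L g \<and> left_invariant_metric L g \<and>
     linear_connection L D \<and> left_invariant_connection L D \<and> torsion_free L D \<and>
     (\<forall>X\<in>vector_fields L. \<forall>Y\<in>vector_fields L. \<forall>Z\<in>vector_fields L.
        cov_metric D g X Y Z = cov_metric D g Y X Z \<and>
        cov_metric D g X Y Z = cov_metric D g X Z Y)"

definition dual_connection ::
    "('a, 'e::euclidean_space) smooth_group \<Rightarrow> 'a metric_field \<Rightarrow> 'a connection \<Rightarrow> 'a connection \<Rightarrow> bool" where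
  "dual_connection L g D D' \<longleftrightarrow> linear_connection L D' \<and>
     (\<forall>X\<in>vector_fields L. \<forall>Y\<in>vector_fields L. \<forall>Z\<in>vector_fields L.
        X (g Y Z) = (\<lambda>p. g (D X Y) Z p + g Y (D' X Z) p))"

definition conjugate_symmetric ::
    "('a, 'e::euclidean_space) smooth_group \<Rightarrow> 'a metric_field \<Rightarrow> 'a connection \<Rightarrow> bool" where
  "conjugate_symmetric L g D \<longleftrightarrow> (\<exists>D'. dual_connection L g D D' \<and>
     (\<forall>X\<in>vector_fields L. \<forall>Y\<in>vector_fields L. \<forall>Z\<in>vector_fields L.
        curvature D X Y Z = curvature D' X Y Z))"

section \<open>The groups \<open>SU\<^sub>2\<close>, \<open>E\<^sub>2\<close> and \<open>\<real>\<^sup>3\<close>\<close>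

text \<open>A group whose carrier is an embedded submanifold of a Euclidean space, with the subspace
  topology and the atlas of all charts of that submanifold: \<open>\<phi>\<close> is locally the restriction of a
  smooth map of the ambient space, and its inverse is smooth as a map into the ambient space.\<close>

definition embedded_group :: "'a::euclidean_space monoid \<Rightarrow> ('a, 'e::euclidean_space) smooth_group" where
  "embedded_group H = \<lparr>carrier = carrier H, mult = mult H, one = one H,
     gtop = top_of_set (carrier H),
     charts = {(U, \<phi>). openin (top_of_set (carrier H)) U \<and> open (\<phi> ` U) \<and> inj_on \<phi> U \<and>
       smooth_on (\<phi> ` U) (inv_into U \<phi>) \<and>
       (\<forall>p\<in>U. \<exists>W F. open W \<and> p \<in> W \<and> smooth_on W F \<and> (\<forall>q\<in>U \<inter> W. F q = \<phi> q))}\<rparr>"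

definition SU2 :: "(complex^2^2, real^3) smooth_group" where
  "SU2 = embedded_group
     \<lparr>carrier = {A. A ** (\<chi> i j. cnj (A $ j $ i)) = mat 1 \<and> det A = 1}, mult = (**), one = mat 1\<rparr>"

definition E2 :: "((real^2^2) \<times> (real^2), real^3) smooth_group" where
  "E2 = embedded_group
     \<lparr>carrier = {(A, v). orthogonal_matrix A \<and> det A = 1},
      mult = (\<lambda>(A, v) (B, w). (A ** B, v + A *v w)), one = (mat 1, 0)\<rparr>"

definition R3 :: "(real^3, real^3) smooth_group" where
  "R3 = embedded_group \<lparr>carrier = UNIV, mult = (+), one = 0\<rparr>"

end

theory Submission
  imports Defs
begin

text \<open>Write \<open>\<nabla>\<close> for the given connection, \<open>C = \<nabla>g\<close> for its cubic form and \<open>\<nabla>\<^sup>g\<close> for the Levi-Civita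
  connection. Then \<open>\<nabla> = \<nabla>\<^sup>g - C / 2\<close> and \<open>\<nabla>\<^sup>* = \<nabla>\<^sup>g + C / 2\<close>, where \<open>C\<close> is read as a bilinear map by means of
  \<open>g\<close>. The terms quadratic in \<open>C\<close> cancel in \<open>R - R\<^sup>*\<close>, and conjugate symmetry says that \<open>\<nabla>\<^sup>gC\<close> is totally
  symmetric. For left invariant structures this is a system of linear equations for the ten
  coefficients of \<open>C\<close>, and \<open>\<nabla> \<noteq> \<nabla>\<^sup>g\<close> says that it has a nonzero solution.

  In Milnor's frame of a three-dimensional unimodular Lie algebra, which is orthonormal with
  \<open>[w 2, w 3] = l1 w 1\<close> and cyclically (\<open>milnor_frame\<close>), the system decouples. One equation for each \<open>i\<close>
  reads \<open>l\<^sub>i C 1 2 3 = 0\<close>, and the others split into three systems for \<open>(C i i i, C i j j, C i k k)\<close>. A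
  nonzero solution forces all \<open>l\<^sub>i\<close> to have the same sign, or one of them to vanish and the other two to
  be equal (\<open>cubic_form_cases\<close>, \<open>statistical_lie_algebra_classification\<close>). These are the Lie algebras of
  \<open>SU\<^sub>2\<close>, \<open>E\<^sub>2\<close> and \<open>\<real>\<^sup>3\<close>; those of \<open>SL\<^sub>2\<close>, of the motions of the Minkowski plane and of the Heisenberg group are
  excluded.

  To reach the Lie algebra one needs the left invariant fields of a Lie group given by an atlas. A
  derivation of the smooth functions is, at each point, a combination of partial derivatives: smooth
  functions are local by cutoff functions (\<open>cutoff_exists\<close>, \<open>extend_from_chart\<close>), and Hadamard's lemma
  does the rest (\<open>hadamard\<close>, \<open>point_derivation_expand\<close>). It follows that the left invariant fields form a
  global frame indexed by the model space (\<open>vector_field_expand\<close>), so that metric, connections and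
  curvatures are determined by their constant coefficients in this frame.

  That the Haar measure is invariant on both sides enters through the vanishing of the trace of the
  adjoint representation (\<open>trace_bracket_zero\<close>). Derivatives of compactly supported functions along left
  and right invariant fields have integral zero; integration by parts then shows that a right
  invariant field has divergence zero in the left invariant frame, and at the unit this divergence is
  the trace.

  Finally, a group embedded in a Euclidean space is a Lie group once it has a chart at the unit, and its
  bracket is the commutator (\<open>lie_group_L\<close>, \<open>bracket_eq\<close>); this yields the structure constants of the three
  models.\<close>

section \<open>Calculus of smooth maps\<close>

lemma Ck_on_cong:
  assumes "open S" "\<And>x. x \<in> S \<Longrightarrow> f x = g x" "Ck_on k f S"
  shows "Ck_on k g S"
  using assms
proof (induction k arbitrary: f g)
  case 0
  then show ?case using continuous_on_cong[of S S f g] by auto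
next
  case (Suc k)
  have der: "(g has_derivative frechet_derivative f (at x)) (at x)" if x: "x \<in> S" for x
  proof -
    have "(f has_derivative frechet_derivative f (at x)) (at x)"
      using Suc.prems x by (simp add: frechet_derivative_works)
    then show ?thesis
      using has_derivative_transform_within_open[OF _ \<open>open S\<close> x, of f _ UNIV g] Suc.prems by auto
  qed
  then have eq: "frechet_derivative f (at x) = frechet_derivative g (at x)" if "x \<in> S" for x
    using that frechet_derivative_at by blast
  show ?case
    using der Suc.IH[OF Suc.prems(1), of "\<lambda>x. frechet_derivative f (at x) _"] Suc.prems(3) eq
    by (fastforce simp: differentiable_def)
qed

lemma Ck_on_SucI:
  assumes "open S" "\<And>x. x \<in> S \<Longrightarrow> (f has_derivative f' x) (at x)"
    and "\<And>v. Ck_on k (\<lambda>x. f' x v) S"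
  shows "Ck_on (Suc k) f S"
proof -
  have "f' x = frechet_derivative f (at x)" if "x \<in> S" for x
    using assms(2)[OF that] frechet_derivative_at by blast
  then show ?thesis
    using assms Ck_on_cong[OF assms(1) _ assms(3)] by (auto simp: differentiable_def)
qed

lemma Ck_on_SucD:
  assumes "Ck_on (Suc k) f S"
  shows "x \<in> S \<Longrightarrow> (f has_derivative frechet_derivative f (at x)) (at x)"
    and "Ck_on k (\<lambda>x. frechet_derivative f (at x) v) S"
  using assms by (auto simp: frechet_derivative_works)

lemma Ck_on_subset: "Ck_on k f S \<Longrightarrow> T \<subseteq> S \<Longrightarrow> Ck_on k f T"
  by (induction k arbitrary: f) (auto intro: continuous_on_subset)

lemma Ck_on_local:
  assumes "\<And>x. x \<in> S \<Longrightarrow> \<exists>T. open T \<and> x \<in> T \<and> Ck_on k f T"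
  shows "Ck_on k f S"
  using assms
proof (induction k arbitrary: f)
  case 0
  have "continuous (at x) f" if "x \<in> S" for x
    using 0[OF that] by (auto simp: continuous_on_eq_continuous_at)
  then show ?case by (simp add: continuous_at_imp_continuous_on)
next
  case (Suc k)
  have "f differentiable (at x)" if "x \<in> S" for x
    using Suc.prems[OF that] by auto
  moreover have "Ck_on k (\<lambda>x. frechet_derivative f (at x) v) S" for v
    by (rule Suc.IH) (use Suc.prems in fastforce)
  ultimately show ?case by simp
qed

lemma Ck_on_Suc_imp: "Ck_on (Suc k) f S \<Longrightarrow> Ck_on k f S"
proof (induction k arbitrary: f)
  case (Suc k)
  have "Ck_on k (\<lambda>x. frechet_derivative f (at x) v) S" for v
    using Suc.IH[of "\<lambda>x. frechet_derivative f (at x) v"] Suc.prems by simp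
  then show ?case using Suc.prems by simp
qed (simp add: differentiable_imp_continuous_on differentiable_on_def differentiable_at_withinI)

lemma smooth_on_imp_Ck_on: "smooth_on S f \<Longrightarrow> Ck_on k f S"
  by (simp add: smooth_on_def)

lemma smooth_on_cong:
  "open S \<Longrightarrow> (\<And>x. x \<in> S \<Longrightarrow> f x = g x) \<Longrightarrow> smooth_on S f \<Longrightarrow> smooth_on S g"
  unfolding smooth_on_def using Ck_on_cong by blast

lemma smooth_on_subset: "smooth_on S f \<Longrightarrow> T \<subseteq> S \<Longrightarrow> smooth_on T f"
  unfolding smooth_on_def using Ck_on_subset by blast

lemma smooth_on_local:
  "(\<And>x. x \<in> S \<Longrightarrow> \<exists>T. open T \<and> x \<in> T \<and> smooth_on T f) \<Longrightarrow> smooth_on S f"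
  unfolding smooth_on_def by (meson Ck_on_local)

lemma smooth_on_has_derivative:
  "smooth_on S f \<Longrightarrow> x \<in> S \<Longrightarrow> (f has_derivative frechet_derivative f (at x)) (at x)"
  using Ck_on_SucD(1) smooth_on_imp_Ck_on by blast

lemma smooth_on_differentiable: "smooth_on S f \<Longrightarrow> x \<in> S \<Longrightarrow> f differentiable (at x)"
  using smooth_on_has_derivative differentiable_def by blast

lemma smooth_on_derivative: "smooth_on S f \<Longrightarrow> smooth_on S (\<lambda>x. frechet_derivative f (at x) v)"
  unfolding smooth_on_def using Ck_on_SucD(2)[of _ f S v] by blast

lemma smooth_on_continuous_on: "smooth_on S f \<Longrightarrow> continuous_on S f"
  using smooth_on_imp_Ck_on[of S f 0] by simp

lemma Ck_on_const: "Ck_on k (\<lambda>x. c) S"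
  by (induction k arbitrary: c) auto

lemma smooth_on_const: "smooth_on S (\<lambda>x. c)"
  by (simp add: smooth_on_def Ck_on_const)

lemma smooth_on_bounded_linear:
  assumes "bounded_linear f" shows "smooth_on S f"
proof -
  have d: "(f has_derivative f) (at x)" for x
    using assms bounded_linear_imp_has_derivative by blast
  then have "Ck_on k f UNIV" for k
  proof (cases k)
    case (Suc j)
    then show ?thesis using Ck_on_SucI[of UNIV f "\<lambda>_. f" j] d Ck_on_const by auto
  qed (use assms linear_continuous_on in auto)
  then show ?thesis unfolding smooth_on_def by (meson Ck_on_subset subset_UNIV)
qed

lemma smooth_on_ident: "smooth_on S (\<lambda>x. x)"
  by (rule smooth_on_bounded_linear) (rule bounded_linear_ident)

lemma Ck_on_add:
  "open S \<Longrightarrow> Ck_on k f S \<Longrightarrow> Ck_on k g S \<Longrightarrow> Ck_on k (\<lambda>x. f x + g x) S"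
proof (induction k arbitrary: f g)
  case 0
  then show ?case by (auto intro: continuous_on_add)
next
  case (Suc k)
  show ?case
    by (rule Ck_on_SucI[OF Suc.prems(1) has_derivative_add[OF Ck_on_SucD(1)[OF Suc.prems(2)]
            Ck_on_SucD(1)[OF Suc.prems(3)]]]) (use Suc in auto)
qed

lemma (in bounded_bilinear) Ck_on:
  "open S \<Longrightarrow> Ck_on k f S \<Longrightarrow> Ck_on k g S \<Longrightarrow> Ck_on k (\<lambda>x. prod (f x) (g x)) S"
proof (induction k arbitrary: f g)
  case 0
  then show ?case by (auto intro: continuous_on)
next
  case (Suc k)
  have "Ck_on k f S" "Ck_on k g S"
    using Suc.prems Ck_on_Suc_imp by auto
  then show ?case
    by (intro Ck_on_SucI[OF Suc.prems(1) FDERIV[OF Ck_on_SucD(1)[OF Suc.prems(2)]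
            Ck_on_SucD(1)[OF Suc.prems(3)]]]) (use Suc in \<open>auto intro!: Ck_on_add\<close>)
qed

lemma (in bounded_bilinear) smooth_on:
  "open S \<Longrightarrow> smooth_on S f \<Longrightarrow> smooth_on S g \<Longrightarrow> smooth_on S (\<lambda>x. prod (f x) (g x))"
  unfolding smooth_on_def using Ck_on by blast

lemma smooth_on_add:
  "open S \<Longrightarrow> smooth_on S f \<Longrightarrow> smooth_on S g \<Longrightarrow> smooth_on S (\<lambda>x. f x + g x)"
  unfolding smooth_on_def using Ck_on_add by blast

lemmas smooth_on_mult = bounded_bilinear.smooth_on[OF bounded_bilinear_mult]
lemmas smooth_on_scaleR = bounded_bilinear.smooth_on[OF bounded_bilinear_scaleR]
lemmas smooth_on_inner = bounded_bilinear.smooth_on[OF bounded_bilinear_inner]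

lemma Ck_on_sum:
  "open S \<Longrightarrow> (\<And>i. i \<in> I \<Longrightarrow> Ck_on k (f i) S) \<Longrightarrow> Ck_on k (\<lambda>x. \<Sum>i\<in>I. f i x) S"
  by (induction I rule: infinite_finite_induct) (auto simp: Ck_on_const intro!: Ck_on_add)

lemma smooth_on_sum:
  "open S \<Longrightarrow> (\<And>i. i \<in> I \<Longrightarrow> smooth_on S (f i)) \<Longrightarrow> smooth_on S (\<lambda>x. \<Sum>i\<in>I. f i x)"
  by (simp add: smooth_on_def Ck_on_sum)

text \<open>The derivative of \<open>f \<circ> g\<close> in a fixed direction is a combination, with the coordinates of the
  derivative of \<open>g\<close> as coefficients, of the partial derivatives of \<open>f\<close> composed with \<open>g\<close>; these
  have one order of differentiability less, so that induction applies.\<close>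

lemma Ck_on_compose:
  fixes f :: "'b::euclidean_space \<Rightarrow> 'c::real_normed_vector"
  assumes "open S" "open T"
  shows "g ` S \<subseteq> T \<Longrightarrow> Ck_on k f T \<Longrightarrow> Ck_on k g S \<Longrightarrow> Ck_on k (\<lambda>x. f (g x)) S"
proof (induction k arbitrary: f)
  case 0
  then show ?case by (auto intro: continuous_on_compose2)
next
  case (Suc k)
  let ?f' = "\<lambda>y. frechet_derivative f (at y)" and ?g' = "\<lambda>x. frechet_derivative g (at x)"
  have gk: "Ck_on k g S" using Suc.prems Ck_on_Suc_imp by blast
  have f': "(f has_derivative ?f' y) (at y)" if "y \<in> T" for y
    using Ck_on_SucD(1)[OF Suc.prems(2) that] .
  have g': "(g has_derivative ?g' x) (at x)" if "x \<in> S" for x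
    using Ck_on_SucD(1)[OF Suc.prems(3) that] .
  show ?case
  proof (rule Ck_on_SucI[OF assms(1)])
    fix x assume x: "x \<in> S"
    then have gx: "g x \<in> T" using Suc.prems(1) by auto
    have "((\<lambda>x. f (g x)) has_derivative (\<lambda>v. ?f' (g x) (?g' x v))) (at x)"
      using has_derivative_compose[OF g'[OF x] f'[OF gx]] .
    moreover have "?f' (g x) (?g' x v) = (\<Sum>b\<in>Basis. (?g' x v \<bullet> b) *\<^sub>R ?f' (g x) b)" for v
    proof -
      have lin: "linear (?f' (g x))"
        using f'[OF gx] has_derivative_bounded_linear bounded_linear.linear by blast
      have "?f' (g x) (?g' x v) = ?f' (g x) (\<Sum>b\<in>Basis. (?g' x v \<bullet> b) *\<^sub>R b)"
        by (simp add: euclidean_representation)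
      then show ?thesis using lin by (simp add: linear_sum linear_scale)
    qed
    ultimately show "((\<lambda>x. f (g x)) has_derivative
        (\<lambda>v. \<Sum>b\<in>Basis. (?g' x v \<bullet> b) *\<^sub>R ?f' (g x) b)) (at x)" by simp
  next
    fix v
    show "Ck_on k (\<lambda>x. \<Sum>b\<in>Basis. (?g' x v \<bullet> b) *\<^sub>R ?f' (g x) b) S"
    proof (intro Ck_on_sum bounded_bilinear.Ck_on[OF bounded_bilinear_scaleR]
        bounded_bilinear.Ck_on[OF bounded_bilinear_inner] assms(1) Ck_on_const)
      show "Ck_on k (\<lambda>x. ?g' x v) S" using Suc.prems(3) by simp
      fix b :: 'b
      show "Ck_on k (\<lambda>x. ?f' (g x) b) S"
        by (rule Suc.IH) (use Suc.prems gk in auto)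
    qed
  qed
qed

lemma smooth_on_compose:
  fixes f :: "'b::euclidean_space \<Rightarrow> 'c::real_normed_vector"
  assumes "open S" "open T" "g ` S \<subseteq> T" "smooth_on T f" "smooth_on S g"
  shows "smooth_on S (\<lambda>x. f (g x))"
  using assms(4,5) Ck_on_compose[where f=f and g=g, OF assms(1-3)] unfolding smooth_on_def
  by iprover

lemma smooth_on_compose_linear:
  fixes f :: "'b::euclidean_space \<Rightarrow> 'c::real_normed_vector"
  assumes "bounded_linear f" "open S" "smooth_on S g"
  shows "smooth_on S (\<lambda>x. f (g x))"
  using smooth_on_compose[of S UNIV g f] assms smooth_on_bounded_linear[OF assms(1)] by simp

lemma smooth_on_Pair:
  fixes f :: "'a::real_normed_vector \<Rightarrow> 'b::euclidean_space" and g :: "'a \<Rightarrow> 'c::euclidean_space"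
  assumes "open S" "smooth_on S f" "smooth_on S g"
  shows "smooth_on S (\<lambda>x. (f x, g x))"
proof -
  have "smooth_on S (\<lambda>x. (f x, 0) + (0, g x))"
    by (intro smooth_on_add assms smooth_on_compose_linear[of "\<lambda>a. (a, 0)"]
        smooth_on_compose_linear[of "\<lambda>a. (0, a)"] bounded_linear_Pair bounded_linear_ident
        bounded_linear_zero)
  then show ?thesis by simp
qed

text \<open>Roots and the flat function below are treated alike: a family of functions of one real
  variable whose derivatives are finite combinations of members of the family is smooth.\<close>

lemma Ck_on_powr:
  fixes a c :: real
  shows "Ck_on k (\<lambda>x. c * x powr a) {0<..}"
proof (induction k arbitrary: a c)
  case 0
  show ?case by (auto intro!: continuous_intros)
next
  case (Suc k)
  have "((\<lambda>x. c * x powr a) has_derivative (\<lambda>v. (v * (c * a)) * x powr (a - 1))) (at x)"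
    if "x \<in> {0<..}" for x
    using that by (auto intro!: derivative_eq_intros simp: field_simps powr_diff)
  then show ?case
    by (rule Ck_on_SucI[rotated]) (use Suc in auto)
qed

lemma smooth_on_sqrt: "smooth_on {0<..} sqrt"
proof -
  have "smooth_on {0<..} (\<lambda>x::real. 1 * x powr (1/2))"
    by (simp only: smooth_on_def Ck_on_powr simp_thms)
  then show ?thesis
    by (rule smooth_on_cong[rotated 2]) (auto simp: powr_half_sqrt)
qed

text \<open>All functions \<open>flat n\<close> are needed, since the derivatives of \<open>flat 0\<close> are combinations of them.\<close>

definition flat :: "nat \<Rightarrow> real \<Rightarrow> real" where
  "flat n x = (if x > 0 then exp (- 1 / x) / x ^ n else 0)"

text \<open>The bound is the term of order \<open>n + 2\<close> of the exponential series of \<open>1 / x\<close>; it makes \<open>flat n\<close>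
  differentiable at \<open>0\<close>.\<close>

lemma flat_le: "0 \<le> flat n x \<and> flat n x \<le> fact (n + 2) * x\<^sup>2"
proof (cases "x > 0")
  case True
  have "(1 / x) ^ (n + 2) / fact (n + 2) \<le> exp (1 / x)"
  proof -
    have "(\<lambda>m. (1 / x) ^ m /\<^sub>R fact m) sums exp (1 / x)" by (rule exp_converges)
    then have "(\<Sum>m\<in>{n + 2}. (1 / x) ^ m /\<^sub>R fact m) \<le> exp (1 / x)"
      unfolding sums_iff using sum_le_suminf[of "\<lambda>m. (1 / x) ^ m /\<^sub>R fact m" "{n + 2}"] True by simp
    then show ?thesis by (simp add: field_simps)
  qed
  moreover define E P F :: real where "E = exp (1 / x)" and "P = x ^ (n + 2)" and "F = fact (n + 2)"
  ultimately have "1 / P / F \<le> E" by (simp only: power_one_over)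
  moreover have "0 < P" "0 < F" "0 < E" using True by (auto simp: E_def P_def F_def)
  ultimately have "1 / E \<le> F * P" by (simp add: field_simps)
  then have "exp (- 1 / x) \<le> fact (n + 2) * x ^ (n + 2)"
    by (simp add: E_def P_def F_def exp_minus inverse_eq_divide)
  then show ?thesis using True by (simp add: flat_def field_simps power2_eq_square)
qed (auto simp: flat_def)

lemma flat_has_derivative:
  "(flat n has_field_derivative (flat (n + 2) x - n * flat (n + 1) x)) (at x)"
proof -
  consider "x > 0" | "x < 0" | "x = 0" by linarith
  then show ?thesis
  proof cases
    case 1
    have "((\<lambda>x. exp (- 1 / x) / x ^ n) has_field_derivative
        (exp (- 1 / x) * (1 / x\<^sup>2) * x ^ n - exp (- 1 / x) * (n * x ^ (n - 1))) / (x ^ n * x ^ n)) (at x)"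
      using 1 by (auto intro!: derivative_eq_intros simp: power2_eq_square)
    also have "n * x ^ (n - 1) = n * x ^ n / x"
      using 1 by (cases n) auto
    also have "(exp (- 1 / x) * (1 / x\<^sup>2) * x ^ n - exp (- 1 / x) * (n * x ^ n / x)) / (x ^ n * x ^ n) =
        flat (n + 2) x - n * flat (n + 1) x"
      using 1 by (simp add: flat_def field_simps power2_eq_square)
    finally have "((\<lambda>x. exp (- 1 / x) / x ^ n) has_field_derivative
        (flat (n + 2) x - n * flat (n + 1) x)) (at x)" .
    then show ?thesis
      by (rule has_field_derivative_transform_within_open[of _ _ _ "{0<..}"])
        (use 1 in \<open>auto simp: flat_def\<close>)
  next
    case 2
    have "((\<lambda>x. 0) has_field_derivative (flat (n + 2) x - n * flat (n + 1) x)) (at x)"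
      using 2 by (simp add: flat_def)
    then show ?thesis
      by (rule has_field_derivative_transform_within_open[of _ _ _ "{..<0}"])
        (use 2 in \<open>auto simp: flat_def\<close>)
  next
    case 3
    have "((\<lambda>h. (flat n (0 + h) - flat n 0) / h) \<longlongrightarrow> 0) (at 0)"
    proof (rule Lim_null_comparison)
      show "eventually (\<lambda>h. norm ((flat n (0 + h) - flat n 0) / h) \<le> fact (n + 2) * \<bar>h\<bar>) (at 0)"
      proof (rule always_eventually, rule allI)
        fix h :: real
        have "\<bar>flat n h\<bar> \<le> (fact (n + 2) * \<bar>h\<bar>) * \<bar>h\<bar>"
          using flat_le[of n h] by (simp add: power2_eq_square abs_mult[symmetric] mult.assoc)
        then show "norm ((flat n (0 + h) - flat n 0) / h) \<le> fact (n + 2) * \<bar>h\<bar>"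
          by (cases "h = 0") (auto simp: flat_def abs_divide divide_le_eq)
      qed
      show "((\<lambda>h::real. fact (n + 2) * \<bar>h\<bar>) \<longlongrightarrow> 0) (at 0)"
        by (auto intro!: tendsto_eq_intros)
    qed
    then show ?thesis
      using 3 by (simp add: DERIV_def flat_def)
  qed
qed

lemma Ck_on_flat: "Ck_on k (flat n) UNIV"
proof (induction k arbitrary: n)
  case 0
  then show ?case
    using flat_has_derivative DERIV_isCont continuous_at_imp_continuous_on by (simp, blast)
next
  case (Suc k)
  have "Ck_on k (\<lambda>x. (flat (n + 2) x + (- real n) * flat (n + 1) x) * v) UNIV" for v
    by (intro bounded_bilinear.Ck_on[OF bounded_bilinear_mult] Ck_on_add Ck_on_const Suc open_UNIV)
  then show ?case
    by (intro Ck_on_SucI[of UNIV _ "\<lambda>x v. (flat (n + 2) x + (- real n) * flat (n + 1) x) * v"])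
      (use flat_has_derivative[of n] in \<open>auto simp: has_field_derivative_def\<close>)
qed

text \<open>With \<open>s = flat 0\<close>, the function \<open>s (s 1 - s t)\<close> is a positive constant for \<open>t \<le> 0\<close> and
  vanishes for \<open>t \<ge> 1\<close>: two flat functions give a plateau without any division.\<close>

lemma cutoff_exists:
  fixes a :: "'a::euclidean_space"
  assumes "r > 0"
  obtains \<beta> :: "'a \<Rightarrow> real" where "smooth_on UNIV \<beta>" "\<And>x. x \<in> ball a (r / 2) \<Longrightarrow> \<beta> x = 1"
    "\<And>x. x \<notin> ball a r \<Longrightarrow> \<beta> x = 0" "\<And>x. 0 \<le> \<beta> x"
proof
  define s where "s = flat 0"
  \<comment> \<open>\<open>w\<close> is at most \<open>0\<close> on the ball of radius \<open>r / 2\<close> and at least \<open>1\<close> off the ball of radius \<open>r\<close>.\<close>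
  define w where "w x = ((x - a) \<bullet> (x - a)) * (4 / (3 * r\<^sup>2)) + (- 1 / 3)" for x
  define \<beta> where "\<beta> x = s (s 1 + (- 1) * s (w x)) * (1 / s (s 1))" for x
  have s: "smooth_on UNIV s"
    by (simp add: s_def smooth_on_def Ck_on_flat)
  have s1: "s 1 > 0" by (simp add: s_def flat_def)
  then have ss1: "s (s 1) > 0" by (simp add: s_def flat_def)
  have id: "smooth_on UNIV (\<lambda>x::'a. x - a)"
    using smooth_on_add[OF open_UNIV smooth_on_ident smooth_on_const[of _ "- a"]] by simp
  have w: "smooth_on UNIV w"
    unfolding w_def by (intro smooth_on_add smooth_on_mult smooth_on_inner id smooth_on_const open_UNIV)
  have sw: "smooth_on UNIV (\<lambda>x. s (w x))"
    by (rule smooth_on_compose[OF _ _ _ s w]) auto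
  show "smooth_on UNIV \<beta>"
    unfolding \<beta>_def
    by (intro smooth_on_mult smooth_on_const open_UNIV smooth_on_add
        smooth_on_compose[OF _ _ _ s] sw) auto
  show "0 \<le> \<beta> x" for x
    using ss1 by (simp add: \<beta>_def s_def flat_def)
  show "\<beta> x = 1" if "x \<in> ball a (r / 2)" for x
  proof -
    have "norm (x - a) \<le> r / 2" using that by (simp add: dist_norm norm_minus_commute)
    then have "(norm (x - a))\<^sup>2 \<le> (r / 2)\<^sup>2" by (intro power_mono) auto
    then have "w x \<le> 0"
      using assms by (simp add: w_def power2_norm_eq_inner field_simps)
    then show ?thesis using ss1 by (simp add: \<beta>_def s_def flat_def)
  qed
  show "\<beta> x = 0" if "x \<notin> ball a r" for x
  proof -
    have "r \<le> norm (x - a)" using that by (simp add: dist_norm norm_minus_commute)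
    then have "r\<^sup>2 \<le> (norm (x - a))\<^sup>2" using assms by (intro power_mono) auto
    then have "w x \<ge> 1"
      using assms by (simp add: w_def power2_norm_eq_inner field_simps)
    then have "s 1 \<le> s (w x)" by (simp add: s_def flat_def field_simps)
    then show ?thesis by (simp add: \<beta>_def s_def flat_def)
  qed
qed


lemma segment_in_ball:
  fixes a :: "'a::real_normed_vector"
  assumes "x \<in> ball a r" "t \<in> cbox 0 (1::real)"
  shows "a + t *\<^sub>R (x - a) \<in> ball a r"
proof -
  have "dist a (a + t *\<^sub>R (x - a)) = t * norm (x - a)"
    using assms by (simp add: dist_norm)
  also have "\<dots> \<le> norm (x - a)"
    using assms by (simp add: mult_left_le_one_le)
  finally show ?thesis using assms by (simp add: dist_norm norm_minus_commute)
qed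

text \<open>Differentiating under the integral sign turns an integral of this form into another one, with
  the exponent raised by one: hence the weight \<open>t ^ n\<close>.\<close>

lemma radial_integral_has_derivative:
  fixes F :: "'a::euclidean_space \<Rightarrow> real"
  assumes F: "smooth_on (ball a r) F" and x: "x \<in> ball a r"
  shows "((\<lambda>x. integral (cbox 0 1) (\<lambda>t. t ^ n * F (a + t *\<^sub>R (x - a)))) has_derivative
    (\<lambda>v. integral (cbox 0 1)
      (\<lambda>t. t ^ Suc n * frechet_derivative F (at (a + t *\<^sub>R (x - a))) v))) (at x)"
proof -
  let ?D = "\<lambda>x t v. t ^ Suc n * frechet_derivative F (at (a + t *\<^sub>R (x - a))) v"
  have der: "((\<lambda>x. t ^ n * F (a + t *\<^sub>R (x - a))) has_derivative ?D x t) (at x within ball a r)"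
    if "x \<in> ball a r" "t \<in> cbox 0 1" for x and t :: real
  proof -
    have *: "(F has_derivative frechet_derivative F (at (a + t *\<^sub>R (x - a)))) (at (a + t *\<^sub>R (x - a)))"
      by (rule smooth_on_has_derivative[OF F segment_in_ball[OF that]])
    have "((\<lambda>x. a + t *\<^sub>R (x - a)) has_derivative (\<lambda>v. t *\<^sub>R v)) (at x within ball a r)"
      by (auto intro!: derivative_eq_intros)
    from has_derivative_compose[OF this *] have "((\<lambda>x. F (a + t *\<^sub>R (x - a))) has_derivative
        (\<lambda>v. frechet_derivative F (at (a + t *\<^sub>R (x - a))) (t *\<^sub>R v))) (at x within ball a r)" .
    moreover have "linear (frechet_derivative F (at (a + t *\<^sub>R (x - a))))"
      using * has_derivative_linear by blast
    ultimately show ?thesis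
      by (auto intro!: derivative_eq_intros simp: linear_scale)
  qed
  have bl: "bounded_linear (?D x t)" if "x \<in> ball a r" "t \<in> cbox 0 1" for x and t :: real
    using der[OF that] has_derivative_bounded_linear by blast
  have cont: "continuous_on (ball a r \<times> cbox 0 1) (\<lambda>(x, t). h (a + t *\<^sub>R (x - a)))"
    if "smooth_on (ball a r) h" for h :: "'a \<Rightarrow> real"
    unfolding case_prod_beta
    by (rule continuous_on_compose2[OF smooth_on_continuous_on[OF that]])
      (use segment_in_ball[of _ a r] in \<open>auto intro!: continuous_intros\<close>)
  have contD: "continuous_on (ball a r \<times> cbox 0 1) (\<lambda>(x, t). ?D x t v)" for v
  proof -
    have "continuous_on (ball a r \<times> cbox 0 1) (\<lambda>p. snd p ^ Suc n *
        (\<lambda>(x, t). frechet_derivative F (at (a + t *\<^sub>R (x - a))) v) p)"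
      by (intro continuous_intros cont smooth_on_derivative F)
    then show ?thesis by (simp add: case_prod_beta)
  qed
  have L: "((\<lambda>x. integral (cbox 0 1) (\<lambda>t. t ^ n * F (a + t *\<^sub>R (x - a)))) has_derivative
      integral (cbox 0 1) (\<lambda>t. Blinfun (?D x t))) (at x within ball a r)"
  proof (rule leibniz_rule[where U="ball a r" and fx="\<lambda>x t. Blinfun (?D x t)"])
    show "((\<lambda>x. t ^ n * F (a + t *\<^sub>R (x - a))) has_derivative Blinfun (?D x t)) (at x within ball a r)"
      if "x \<in> ball a r" "t \<in> cbox 0 1" for x and t :: real
      using der[OF that] bl[OF that] by (simp only: bounded_linear_Blinfun_apply)
    show "(\<lambda>t. t ^ n * F (a + t *\<^sub>R (x - a))) integrable_on cbox 0 1" if "x \<in> ball a r" for x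
    proof (rule integrable_continuous)
      have "continuous_on (cbox 0 1) (\<lambda>t. (\<lambda>(x, t). F (a + t *\<^sub>R (x - a))) (x, t))"
        by (rule continuous_on_compose2[OF cont[OF F]]) (use that in \<open>auto intro!: continuous_intros\<close>)
      then show "continuous_on (cbox 0 1) (\<lambda>t. t ^ n * F (a + t *\<^sub>R (x - a)))"
        by (auto intro!: continuous_intros)
    qed
    show "continuous_on (ball a r \<times> cbox 0 1) (\<lambda>(x, t). Blinfun (?D x t))"
    proof (rule continuous_on_blinfun_componentwise)
      fix i :: 'a
      show "continuous_on (ball a r \<times> cbox 0 1) (\<lambda>p. (case p of (x, t) \<Rightarrow> Blinfun (?D x t)) i)"
        by (rule continuous_on_cong[THEN iffD1, OF refl _ contD[of i]])
          (use bl in \<open>auto simp only: bounded_linear_Blinfun_apply split: prod.splits\<close>)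
    qed
  qed (use x in auto)
  have "(\<lambda>t. Blinfun (?D x t)) integrable_on cbox 0 1"
  proof (rule integrable_continuous, rule continuous_on_blinfun_componentwise)
    fix i :: 'a
    have "continuous_on (cbox 0 1) (\<lambda>t. (\<lambda>(x, t). ?D x t i) (x, t))"
      by (rule continuous_on_compose2[OF contD[of i]]) (use x in \<open>auto intro!: continuous_intros\<close>)
    then show "continuous_on (cbox 0 1) (\<lambda>t. Blinfun (?D x t) i)"
      by (rule continuous_on_cong[THEN iffD1, OF refl, rotated])
        (use bl[OF x] in \<open>auto simp only: bounded_linear_Blinfun_apply split_conv\<close>)
  qed
  then have "integral (cbox 0 1) (\<lambda>t. Blinfun (?D x t)) v = integral (cbox 0 1) (\<lambda>t. ?D x t v)" for v
    by (subst blinfun_apply_integral)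
      (use bl[OF x] in \<open>auto intro!: integral_cong simp only: bounded_linear_Blinfun_apply\<close>)
  then have "blinfun_apply (integral (cbox 0 1) (\<lambda>t. Blinfun (?D x t))) =
      (\<lambda>v. integral (cbox 0 1) (\<lambda>t. ?D x t v))" by (rule ext)
  with L show ?thesis
    by (simp only: at_within_open[OF x open_ball])
qed

lemma Ck_on_radial_integral:
  fixes F :: "'a::euclidean_space \<Rightarrow> real"
  assumes "smooth_on (ball a r) F"
  shows "Ck_on k (\<lambda>x. integral (cbox 0 1) (\<lambda>t. t ^ n * F (a + t *\<^sub>R (x - a)))) (ball a r)"
  using assms
proof (induction k arbitrary: F n)
  case 0
  then show ?case
    unfolding Ck_on.simps
    using radial_integral_has_derivative[OF 0] has_derivative_continuous
    by (blast intro: continuous_at_imp_continuous_on)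
next
  case (Suc k)
  show ?case
    by (rule Ck_on_SucI[OF open_ball radial_integral_has_derivative[OF Suc.prems]])
      (assumption, rule Suc.IH[OF smooth_on_derivative[OF Suc.prems]])
qed

text \<open>The factors \<open>g b\<close> are the means of the partial derivatives over the segments from the centre.\<close>

lemma hadamard:
  fixes F :: "'a::euclidean_space \<Rightarrow> real"
  assumes F: "smooth_on (ball a r) F" and r: "r > 0"
  obtains g where "\<And>b. smooth_on (ball a r) (g b)" "\<And>b. g b a = frechet_derivative F (at a) b"
    "\<And>x. x \<in> ball a r \<Longrightarrow> F x = F a + (\<Sum>b\<in>Basis. ((x - a) \<bullet> b) * g b x)"
proof
  define g where "g b x = integral (cbox 0 1)
      (\<lambda>t::real. t ^ 0 * frechet_derivative F (at (a + t *\<^sub>R (x - a))) b)" for b x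
  show "smooth_on (ball a r) (g b)" for b
    unfolding g_def smooth_on_def
    by (intro allI Ck_on_radial_integral smooth_on_derivative F)
  show "g b a = frechet_derivative F (at a) b" for b
    by (simp add: g_def)
  fix x assume x: "x \<in> ball a r"
  let ?F' = "\<lambda>t::real. frechet_derivative F (at (a + t *\<^sub>R (x - a)))"
  have "((\<lambda>t. ?F' t (x - a)) has_integral F (a + 1 *\<^sub>R (x - a)) - F (a + 0 *\<^sub>R (x - a))) {0..1}"
  proof (rule fundamental_theorem_of_calculus)
    fix t :: real assume t: "t \<in> {0..1}"
    have *: "(F has_derivative ?F' t) (at (a + t *\<^sub>R (x - a)))"
      by (rule smooth_on_has_derivative[OF F segment_in_ball[OF x]]) (use t in auto)
    have "((\<lambda>t. a + t *\<^sub>R (x - a)) has_derivative (\<lambda>s. s *\<^sub>R (x - a))) (at t within {0..1})"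
      by (auto intro!: derivative_eq_intros)
    from has_derivative_compose[OF this *] has_derivative_linear[OF *]
    show "((\<lambda>t. F (a + t *\<^sub>R (x - a))) has_vector_derivative ?F' t (x - a)) (at t within {0..1})"
      by (simp add: has_vector_derivative_def linear_scale)
  qed simp
  then have 1: "F x - F a = integral (cbox 0 1) (\<lambda>t. ?F' t (x - a))"
    by (simp add: integral_unique)
  have "?F' t (x - a) = (\<Sum>b\<in>Basis. ((x - a) \<bullet> b) * ?F' t b)" if "t \<in> cbox 0 1" for t
  proof -
    have lin: "linear (?F' t)"
      using smooth_on_has_derivative[OF F segment_in_ball[OF x that]] has_derivative_linear by blast
    have "?F' t (x - a) = ?F' t (\<Sum>b\<in>Basis. ((x - a) \<bullet> b) *\<^sub>R b)"
      by (simp only: euclidean_representation)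
    then show ?thesis using lin by (simp add: linear_sum linear_scale)
  qed
  then have "F x - F a = integral (cbox 0 1) (\<lambda>t. \<Sum>b\<in>Basis. ((x - a) \<bullet> b) * ?F' t b)"
    unfolding 1 by (rule integral_cong)
  also have "\<dots> = (\<Sum>b\<in>Basis. ((x - a) \<bullet> b) * g b x)"
  proof (subst integral_sum)
    fix b :: 'a
    have "continuous_on (cbox 0 1) (\<lambda>t::real. ?F' t b)"
      by (rule continuous_on_compose2[OF smooth_on_continuous_on[OF smooth_on_derivative[OF F]]])
        (use segment_in_ball[OF x] in \<open>auto intro!: continuous_intros\<close>)
    then show "(\<lambda>t. ((x - a) \<bullet> b) * ?F' t b) integrable_on cbox 0 1"
      by (intro integrable_continuous continuous_intros)
  qed (auto simp: g_def)
  finally show "F x = F a + (\<Sum>b\<in>Basis. ((x - a) \<bullet> b) * g b x)" by simp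
qed

text \<open>The second difference of \<open>F\<close> over a small parallelogram is a value of either mixed partial
  derivative nearby, by applying the mean value theorem twice.\<close>

lemma second_difference:
  fixes F :: "'a::real_normed_vector \<Rightarrow> real"
  assumes F: "smooth_on S F" and h: "h > 0"
    and S: "\<And>s t. s \<in> {0..h} \<Longrightarrow> t \<in> {0..h} \<Longrightarrow> x + s *\<^sub>R v + t *\<^sub>R w \<in> S"
  obtains s t where "s \<in> {0..h}" "t \<in> {0..h}"
    "F (x + h *\<^sub>R v + h *\<^sub>R w) - F (x + h *\<^sub>R v) - F (x + h *\<^sub>R w) + F x =
      h * h * frechet_derivative (\<lambda>y. frechet_derivative F (at y) v) (at (x + s *\<^sub>R v + t *\<^sub>R w)) w"
proof -
  let ?G = "\<lambda>y. frechet_derivative F (at y) v"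
  have along: "((\<lambda>s. K (z + s *\<^sub>R u)) has_real_derivative frechet_derivative K (at (z + s *\<^sub>R u)) u) (at s)"
    if "smooth_on S K" "z + s *\<^sub>R u \<in> S" for K :: "'a \<Rightarrow> real" and z u s
  proof -
    have *: "(K has_derivative frechet_derivative K (at (z + s *\<^sub>R u))) (at (z + s *\<^sub>R u))"
      by (rule smooth_on_has_derivative[OF that])
    have "((\<lambda>s. z + s *\<^sub>R u) has_derivative (\<lambda>s. s *\<^sub>R u)) (at s)"
      by (auto intro!: derivative_eq_intros)
    from has_derivative_compose[OF this *] has_derivative_linear[OF *]
    show ?thesis by (simp add: has_field_derivative_def linear_scale mult_commute_abs)
  qed
  have "\<exists>s>0. s < h \<and> (F ((x + h *\<^sub>R w) + h *\<^sub>R v) - F (x + h *\<^sub>R v)) -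
      (F ((x + h *\<^sub>R w) + 0 *\<^sub>R v) - F (x + 0 *\<^sub>R v)) =
      (h - 0) * (?G ((x + h *\<^sub>R w) + s *\<^sub>R v) - ?G (x + s *\<^sub>R v))"
  proof (rule MVT2[OF h])
    fix s assume s: "0 \<le> s" "s \<le> h"
    show "((\<lambda>s. F ((x + h *\<^sub>R w) + s *\<^sub>R v) - F (x + s *\<^sub>R v)) has_real_derivative
        ?G ((x + h *\<^sub>R w) + s *\<^sub>R v) - ?G (x + s *\<^sub>R v)) (at s)"
      using S[of s h] S[of s 0] s h
      by (intro DERIV_diff along[OF F]) (auto simp: algebra_simps)
  qed
  then obtain s where s: "0 < s" "s < h" and 1: "F ((x + h *\<^sub>R w) + h *\<^sub>R v) - F (x + h *\<^sub>R v) -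
      (F (x + h *\<^sub>R w) - F x) = h * (?G ((x + h *\<^sub>R w) + s *\<^sub>R v) - ?G (x + s *\<^sub>R v))"
    by auto
  have "\<exists>t>0. t < h \<and> ?G ((x + s *\<^sub>R v) + h *\<^sub>R w) - ?G ((x + s *\<^sub>R v) + 0 *\<^sub>R w) =
      (h - 0) * frechet_derivative ?G (at ((x + s *\<^sub>R v) + t *\<^sub>R w)) w"
    using S[of s] s
    by (intro MVT2[OF h] along[OF smooth_on_derivative[OF F]]) auto
  then obtain t where t: "0 < t" "t < h" and 2: "?G ((x + s *\<^sub>R v) + h *\<^sub>R w) - ?G (x + s *\<^sub>R v) =
      h * frechet_derivative ?G (at ((x + s *\<^sub>R v) + t *\<^sub>R w)) w"
    by auto
  show thesis
  proof (rule that[of s t])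
    have "F (x + h *\<^sub>R v + h *\<^sub>R w) - F (x + h *\<^sub>R v) - F (x + h *\<^sub>R w) + F x =
        h * (?G ((x + h *\<^sub>R w) + s *\<^sub>R v) - ?G (x + s *\<^sub>R v))"
      using 1 by (simp add: algebra_simps)
    also have "(x + h *\<^sub>R w) + s *\<^sub>R v = (x + s *\<^sub>R v) + h *\<^sub>R w"
      by (simp add: algebra_simps)
    finally show "F (x + h *\<^sub>R v + h *\<^sub>R w) - F (x + h *\<^sub>R v) - F (x + h *\<^sub>R w) + F x =
        h * h * frechet_derivative ?G (at (x + s *\<^sub>R v + t *\<^sub>R w)) w"
      unfolding 2 by simp
  qed (use s t in auto)
qed

lemma mixed_derivatives_commute:
  fixes F :: "'a::real_normed_vector \<Rightarrow> real"
  assumes F: "smooth_on S F" and S: "open S" "x \<in> S"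
  shows "frechet_derivative (\<lambda>y. frechet_derivative F (at y) v) (at x) w =
    frechet_derivative (\<lambda>y. frechet_derivative F (at y) w) (at x) v" (is "?A x = ?B x")
proof (rule ccontr)
  assume ne: "?A x \<noteq> ?B x"
  define e where "e = \<bar>?A x - ?B x\<bar> / 2"
  have e: "e > 0" using ne by (simp add: e_def)
  have cont: "isCont ?A x" "isCont ?B x"
    using smooth_on_continuous_on[OF smooth_on_derivative[OF smooth_on_derivative[OF F]]] S
    by (auto simp: continuous_on_eq_continuous_at)
  obtain d1 where d1: "d1 > 0" "\<And>y. dist y x < d1 \<Longrightarrow> dist (?A y) (?A x) < e"
    using cont(1) e unfolding continuous_at_eps_delta by blast
  obtain d2 where d2: "d2 > 0" "\<And>y. dist y x < d2 \<Longrightarrow> dist (?B y) (?B x) < e"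
    using cont(2) e unfolding continuous_at_eps_delta by blast
  obtain d3 where d3: "d3 > 0" "\<And>y. dist y x < d3 \<Longrightarrow> y \<in> S"
    using S unfolding open_dist by blast
  define d where "d = min d1 (min d2 d3)"
  have d: "d > 0" using d1 d2 d3 by (simp add: d_def)
  define h where "h = d / (norm v + norm w + 1)"
  have pos: "norm v + norm w + 1 > 0" by (simp add: add_nonneg_pos)
  have h: "h > 0" using d pos by (simp add: h_def)
  have near: "dist (x + s *\<^sub>R v + t *\<^sub>R w) x < d" if "s \<in> {0..h}" "t \<in> {0..h}" for s t
  proof -
    have "dist (x + s *\<^sub>R v + t *\<^sub>R w) x = norm (s *\<^sub>R v + t *\<^sub>R w)"
      by (simp add: dist_norm algebra_simps)
    also have "\<dots> \<le> s * norm v + t * norm w"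
      using that by (intro norm_triangle_le) simp
    also have "\<dots> \<le> h * norm v + h * norm w"
      using that by (intro add_mono mult_right_mono) auto
    also have "\<dots> < h * (norm v + norm w + 1)"
      using h by (simp add: algebra_simps)
    also have "\<dots> = d" using pos by (simp add: h_def)
    finally show ?thesis .
  qed
  have inS: "x + s *\<^sub>R v + t *\<^sub>R w \<in> S" if "s \<in> {0..h}" "t \<in> {0..h}" for s t
    using d3(2) near[OF that] by (simp add: d_def)
  obtain s t where st: "s \<in> {0..h}" "t \<in> {0..h}"
    "F (x + h *\<^sub>R v + h *\<^sub>R w) - F (x + h *\<^sub>R v) - F (x + h *\<^sub>R w) + F x =
      h * h * ?A (x + s *\<^sub>R v + t *\<^sub>R w)"
    using second_difference[OF F h inS] by blast
  have inS': "x + s *\<^sub>R w + t *\<^sub>R v \<in> S" if "s \<in> {0..h}" "t \<in> {0..h}" for s t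
    using inS[OF that(2,1)] by (simp add: algebra_simps)
  obtain s' t' where st': "s' \<in> {0..h}" "t' \<in> {0..h}"
    "F (x + h *\<^sub>R w + h *\<^sub>R v) - F (x + h *\<^sub>R w) - F (x + h *\<^sub>R v) + F x =
      h * h * ?B (x + s' *\<^sub>R w + t' *\<^sub>R v)"
    using second_difference[OF F h inS'] by blast
  have comm: "x + h *\<^sub>R w + h *\<^sub>R v = x + h *\<^sub>R v + h *\<^sub>R w"
    "x + s' *\<^sub>R w + t' *\<^sub>R v = x + t' *\<^sub>R v + s' *\<^sub>R w"
    by (simp_all add: algebra_simps)
  have "h * h * ?A (x + s *\<^sub>R v + t *\<^sub>R w) = h * h * ?B (x + t' *\<^sub>R v + s' *\<^sub>R w)"
    using st(3) st'(3) unfolding comm by linarith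
  then have "?A (x + s *\<^sub>R v + t *\<^sub>R w) = ?B (x + t' *\<^sub>R v + s' *\<^sub>R w)"
    using h by simp
  moreover have "dist (?A (x + s *\<^sub>R v + t *\<^sub>R w)) (?A x) < e"
    using near[OF st(1,2)] by (intro d1) (simp add: d_def)
  moreover have "dist (?B (x + t' *\<^sub>R v + s' *\<^sub>R w)) (?B x) < e"
    using near[OF st'(2,1)] by (intro d2) (simp add: d_def)
  moreover have False if "X = Y" "dist X a < \<bar>a - b\<bar> / 2" "dist Y b < \<bar>a - b\<bar> / 2" for X Y a b :: real
    using that dist_triangle3[of a b X] by (simp add: dist_real_def[of a b])
  ultimately show False
    unfolding e_def by blast
qed

section \<open>Charts and smooth functions of a Lie group\<close>

lemma partial_derivative_snd:
  fixes Q :: "'a::real_normed_vector \<times> 'b::real_normed_vector \<Rightarrow> 'c::real_normed_vector"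
  assumes "smooth_on S Q" "(y, x) \<in> S"
  shows "((\<lambda>x. Q (y, x)) has_derivative (\<lambda>v. frechet_derivative Q (at (y, x)) (0, v))) (at x)"
    and "frechet_derivative (\<lambda>x. Q (y, x)) (at x) v = frechet_derivative Q (at (y, x)) (0, v)"
proof -
  have "((\<lambda>x. (y, x)) has_derivative (\<lambda>v. (0, v))) (at x)"
    by (auto intro!: derivative_eq_intros)
  from has_derivative_compose[OF this smooth_on_has_derivative[OF assms]]
  show "((\<lambda>x. Q (y, x)) has_derivative (\<lambda>v. frechet_derivative Q (at (y, x)) (0, v))) (at x)" .
  from frechet_derivative_at[OF this]
  show "frechet_derivative (\<lambda>x. Q (y, x)) (at x) v = frechet_derivative Q (at (y, x)) (0, v)"
    by metis
qed

lemma partial_derivative_fst: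
  fixes Q :: "'a::real_normed_vector \<times> 'b::real_normed_vector \<Rightarrow> 'c::real_normed_vector"
  assumes "smooth_on S Q" "(y, x) \<in> S"
  shows "frechet_derivative (\<lambda>y. Q (y, x)) (at y) v = frechet_derivative Q (at (y, x)) (v, 0)"
proof -
  have "((\<lambda>y. (y, x)) has_derivative (\<lambda>v. (v, 0))) (at y)"
    by (auto intro!: derivative_eq_intros)
  from has_derivative_compose[OF this smooth_on_has_derivative[OF assms]]
  have "((\<lambda>y. Q (y, x)) has_derivative (\<lambda>v. frechet_derivative Q (at (y, x)) (v, 0))) (at y)" .
  from frechet_derivative_at[OF this] show ?thesis by metis
qed

lemma frechet_derivative_cong:
  assumes "open S" "x \<in> S" "\<And>y. y \<in> S \<Longrightarrow> f y = g y" "f differentiable (at x)"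
  shows "frechet_derivative f (at x) = frechet_derivative g (at x)"
  using frechet_derivative_transform_within_open[OF assms(4,1,2,3)] .

context lie_group
begin

abbreviation "SF \<equiv> smooth_functions L"
abbreviation "VF \<equiv> vector_fields L"

lemma chart_props:
  assumes "(U, \<phi>) \<in> charts L"
  shows chart_openin: "openin (gtop L) U" and chart_open: "open (\<phi> ` U)"
    and chart_subset: "U \<subseteq> carrier L" and chart_inj: "inj_on \<phi> U"
    and chart_homeo: "homeomorphic_map (subtopology (gtop L) U) (top_of_set (\<phi> ` U)) \<phi>"
proof -
  show *: "openin (gtop L) U" "open (\<phi> ` U)"
    "homeomorphic_map (subtopology (gtop L) U) (top_of_set (\<phi> ` U)) \<phi>"
    using chart[OF assms] by auto
  show "U \<subseteq> carrier L" using *(1) openin_subset topspace_gtop by metis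
  then show "inj_on \<phi> U"
    using homeomorphic_imp_injective_map[OF *(3)] by (simp add: topspace_gtop Int_absorb1)
qed

lemma chart_inv_mem: "x \<in> \<phi> ` U \<Longrightarrow> inv_into U \<phi> x \<in> U"
  by (rule inv_into_into)

lemma chart_inv_f: "(U, \<phi>) \<in> charts L \<Longrightarrow> q \<in> U \<Longrightarrow> inv_into U \<phi> (\<phi> q) = q"
  by (rule inv_into_f_f[OF chart_inj])

lemma chart_inv_carrier: "(U, \<phi>) \<in> charts L \<Longrightarrow> x \<in> \<phi> ` U \<Longrightarrow> inv_into U \<phi> x \<in> carrier L"
  using inv_into_into[of x \<phi> U] chart_subset[of U \<phi>] by auto

lemma chart_exists:
  assumes "p \<in> carrier L" obtains U \<phi> where "(U, \<phi>) \<in> charts L" "p \<in> U"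
  using assms charts_cover by fastforce

lemma chart_image_open:
  assumes c: "(U, \<phi>) \<in> charts L" and W: "openin (gtop L) W" "W \<subseteq> U"
  shows "open (\<phi> ` W)"
proof -
  have "openin (subtopology (gtop L) U) W"
    using W by (simp add: openin_subset_topspace_eq openin_subtopology) blast
  then have "openin (top_of_set (\<phi> ` U)) (\<phi> ` W)"
    using homeomorphic_imp_open_map[OF chart_homeo[OF c]] by (simp add: open_map_def)
  then show ?thesis using chart_open[OF c] openin_open_eq by blast
qed

lemma chart_preimage_openin:
  assumes c: "(U, \<phi>) \<in> charts L" and T: "open T"
  shows "openin (gtop L) {q \<in> U. \<phi> q \<in> T}"
proof -
  have "continuous_map (subtopology (gtop L) U) (top_of_set (\<phi> ` U)) \<phi>"
    using chart_homeo[OF c] homeomorphic_imp_continuous_map by blast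
  then have "continuous_map (subtopology (gtop L) U) euclidean \<phi>"
    using continuous_map_in_subtopology by blast
  then have "openin (subtopology (gtop L) U) {q \<in> topspace (subtopology (gtop L) U). \<phi> q \<in> T}"
    by (rule openin_continuous_map_preimage) (use T in simp)
  moreover have "topspace (subtopology (gtop L) U) = U"
    using chart_subset[OF c] by (auto simp: topspace_gtop)
  ultimately show ?thesis
    using openin_trans_full[OF _ chart_openin[OF c]] by metis
qed

lemma chart_inv_continuous:
  assumes c: "(U, \<phi>) \<in> charts L"
  shows "continuous_map (top_of_set (\<phi> ` U)) (gtop L) (inv_into U \<phi>)"
proof -
  obtain g where g: "homeomorphic_maps (subtopology (gtop L) U) (top_of_set (\<phi> ` U)) \<phi> g"
    using chart_homeo[OF c] homeomorphic_map_maps by blast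
  then have cont: "continuous_map (top_of_set (\<phi> ` U)) (gtop L) g"
    unfolding homeomorphic_maps_def using continuous_map_in_subtopology by blast
  have "g x = inv_into U \<phi> x" if "x \<in> topspace (top_of_set (\<phi> ` U))" for x
  proof -
    from that obtain q where q: "q \<in> U" "x = \<phi> q" by auto
    then have "g (\<phi> q) = q"
      using g chart_subset[OF c] unfolding homeomorphic_maps_def by (auto simp: topspace_gtop)
    then show ?thesis using q chart_inv_f[OF c] by simp
  qed
  then show ?thesis using continuous_map_eq[OF cont] by blast
qed

subsection \<open>Smooth maps into the group\<close>

text \<open>Smoothness of maps from Euclidean spaces into the group, tested in a suitable chart around each
  image point. Composites of the group operations with inverse charts are of this kind, so that the
  smoothness of expressions such as \<open>f (inv (inv_into V \<psi> y) \<otimes> inv_into V \<psi> x)\<close> follows without any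
  further choice of charts.\<close>

definition smooth_into :: "'x::euclidean_space set \<Rightarrow> ('x \<Rightarrow> 'a) \<Rightarrow> bool" where
  "smooth_into S m \<longleftrightarrow> open S \<and> m ` S \<subseteq> carrier L \<and>
     (\<forall>x\<in>S. \<exists>W \<theta> T. (W, \<theta>) \<in> charts L \<and> open T \<and> x \<in> T \<and> T \<subseteq> S \<and> m ` T \<subseteq> W \<and>
        smooth_on T (\<lambda>x. \<theta> (m x)))"

lemma smooth_into_SF:
  assumes "smooth_into S m" "f \<in> SF"
  shows "smooth_on S (\<lambda>x. f (m x))"
proof (rule smooth_on_local)
  fix x assume "x \<in> S"
  then obtain W \<theta> T where W: "(W, \<theta>) \<in> charts L" and T: "open T" "x \<in> T" "m ` T \<subseteq> W"
    and s: "smooth_on T (\<lambda>x. \<theta> (m x))"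
    using assms(1) unfolding smooth_into_def by blast
  have f: "smooth_on (\<theta> ` W) (\<lambda>x. f (inv_into W \<theta> x))"
    using assms(2) W by (auto simp: smooth_functions_def)
  have "smooth_on T (\<lambda>x. f (inv_into W \<theta> (\<theta> (m x))))"
    by (rule smooth_on_compose[OF T(1) chart_open[OF W] _ f s]) (use T in auto)
  then have "smooth_on T (\<lambda>x. f (m x))"
    by (rule smooth_on_cong[OF T(1), rotated]) (use T chart_inv_f[OF W] in auto)
  then show "\<exists>T. open T \<and> x \<in> T \<and> smooth_on T (\<lambda>x. f (m x))"
    using T by blast
qed

lemma smooth_into_open: "smooth_into S m \<Longrightarrow> open S"
  by (simp add: smooth_into_def)

lemma smooth_into_carrier: "smooth_into S m \<Longrightarrow> x \<in> S \<Longrightarrow> m x \<in> carrier L"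
  by (auto simp: smooth_into_def)

lemma smooth_into_chart_inv:
  assumes c: "(U, \<phi>) \<in> charts L"
  shows "smooth_into (\<phi> ` U) (inv_into U \<phi>)"
proof -
  have "smooth_on (\<phi> ` U) (\<lambda>x. \<phi> (inv_into U \<phi> x))"
    by (rule smooth_on_cong[OF chart_open[OF c] _ smooth_on_ident]) (simp add: f_inv_into_f)
  then show ?thesis
    unfolding smooth_into_def
    using chart_open[OF c] c chart_inv_mem[of _ \<phi> U] chart_inv_carrier[OF c]
    by (auto intro!: exI[of _ U] exI[of _ \<phi>] exI[of _ "\<phi> ` U"])
qed

lemma smooth_into_compose:
  assumes m: "smooth_into S m" and k: "smooth_on R k" "open R" "k ` R \<subseteq> S"
  shows "smooth_into R (\<lambda>x. m (k x))"
  unfolding smooth_into_def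
proof (intro conjI ballI k)
  show "(\<lambda>x. m (k x)) ` R \<subseteq> carrier L"
    using k m by (auto simp: smooth_into_def)
  fix x assume x: "x \<in> R"
  then obtain W \<theta> T where W: "(W, \<theta>) \<in> charts L" and T: "open T" "k x \<in> T" "m ` T \<subseteq> W"
    and s: "smooth_on T (\<lambda>x. \<theta> (m x))"
    using m k unfolding smooth_into_def by blast
  let ?T = "R \<inter> k -` T"
  have o: "open ?T"
    using continuous_open_preimage[OF smooth_on_continuous_on[OF k(1)] k(2) T(1)] .
  have "smooth_on ?T (\<lambda>x. \<theta> (m (k x)))"
    by (rule smooth_on_compose[OF o T(1) _ s smooth_on_subset[OF k(1)]]) auto
  then show "\<exists>W \<theta> T. (W, \<theta>) \<in> charts L \<and> open T \<and> x \<in> T \<and> T \<subseteq> R \<and> (\<lambda>x. m (k x)) ` T \<subseteq> W \<and>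
      smooth_on T (\<lambda>x. \<theta> (m (k x)))"
    using o W x T by (intro exI[of _ W] exI[of _ \<theta>] exI[of _ ?T]) auto
qed

lemma smooth_into_const:
  assumes "open S" "a \<in> carrier L" shows "smooth_into S (\<lambda>x. a)"
proof -
  obtain W \<theta> where "(W, \<theta>) \<in> charts L" "a \<in> W" using chart_exists[OF assms(2)] .
  then show ?thesis
    unfolding smooth_into_def using assms smooth_on_const[of S "\<theta> a"]
    by (auto intro!: exI[of _ W] exI[of _ \<theta>] exI[of _ S])
qed

lemma mult_domain_open:
  assumes U: "(U, \<phi>) \<in> charts L" and V: "(V, \<psi>) \<in> charts L" and W: "openin (gtop L) W"
  shows "open {(x, y). x \<in> \<phi> ` U \<and> y \<in> \<psi> ` V \<and> inv_into U \<phi> x \<otimes> inv_into V \<psi> y \<in> W}" (is "open ?D")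
proof -
  let ?X = "top_of_set (\<phi> ` U \<times> \<psi> ` V)"
  have X: "?X = prod_topology (top_of_set (\<phi> ` U)) (top_of_set (\<psi> ` V))"
    by (simp add: subtopology_Times[symmetric])
  have "continuous_map ?X (gtop L) (\<lambda>z. inv_into U \<phi> (fst z))"
    unfolding X
    by (rule continuous_map_compose[OF continuous_map_fst chart_inv_continuous[OF U], unfolded o_def])
  moreover have "continuous_map ?X (gtop L) (\<lambda>z. inv_into V \<psi> (snd z))"
    unfolding X
    by (rule continuous_map_compose[OF continuous_map_snd chart_inv_continuous[OF V], unfolded o_def])
  ultimately have "continuous_map ?X (prod_topology (gtop L) (gtop L))
      (\<lambda>z. (inv_into U \<phi> (fst z), inv_into V \<psi> (snd z)))"
    by (simp add: continuous_map_pairwise o_def)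
  from continuous_map_compose[OF this continuous_mult]
  have "continuous_map ?X (gtop L) (\<lambda>z. inv_into U \<phi> (fst z) \<otimes> inv_into V \<psi> (snd z))"
    by (simp add: o_def)
  from openin_continuous_map_preimage[OF this W]
  have "openin ?X {z \<in> \<phi> ` U \<times> \<psi> ` V. inv_into U \<phi> (fst z) \<otimes> inv_into V \<psi> (snd z) \<in> W}"
    by simp
  moreover have "open (\<phi> ` U \<times> \<psi> ` V)"
    using chart_open[OF U] chart_open[OF V] by (rule open_Times)
  ultimately have "open {z \<in> \<phi> ` U \<times> \<psi> ` V. inv_into U \<phi> (fst z) \<otimes> inv_into V \<psi> (snd z) \<in> W}"
    using openin_open_eq by blast
  also have "{z \<in> \<phi> ` U \<times> \<psi> ` V. inv_into U \<phi> (fst z) \<otimes> inv_into V \<psi> (snd z) \<in> W} = ?D"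
    by auto
  finally show ?thesis .
qed

lemma smooth_into_mult:
  assumes m: "smooth_into S m" and n: "smooth_into S n"
  shows "smooth_into S (\<lambda>x. m x \<otimes> n x)"
  unfolding smooth_into_def
proof (intro conjI ballI)
  show "open S" using m by (rule smooth_into_open)
  show "(\<lambda>x. m x \<otimes> n x) ` S \<subseteq> carrier L"
    using smooth_into_carrier[OF m] smooth_into_carrier[OF n] by auto
  fix x assume x: "x \<in> S"
  obtain U \<phi> T where U: "(U, \<phi>) \<in> charts L" and T: "open T" "x \<in> T" "T \<subseteq> S" "m ` T \<subseteq> U"
    and sm: "smooth_on T (\<lambda>x. \<phi> (m x))"
    using m x unfolding smooth_into_def by blast
  obtain V \<psi> R where V: "(V, \<psi>) \<in> charts L" and R: "open R" "x \<in> R" "R \<subseteq> S" "n ` R \<subseteq> V"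
    and sn: "smooth_on R (\<lambda>x. \<psi> (n x))"
    using n x unfolding smooth_into_def by blast
  have "m x \<otimes> n x \<in> carrier L" using m n x smooth_into_carrier by blast
  then obtain W \<theta> where W: "(W, \<theta>) \<in> charts L" "m x \<otimes> n x \<in> W" using chart_exists by blast
  let ?D = "{(x, y). x \<in> \<phi> ` U \<and> y \<in> \<psi> ` V \<and> inv_into U \<phi> x \<otimes> inv_into V \<psi> y \<in> W}"
  let ?k = "\<lambda>x. (\<phi> (m x), \<psi> (n x))"
  have oTR: "open (T \<inter> R)" using T R by blast
  have k: "smooth_on (T \<inter> R) ?k"
    by (rule smooth_on_Pair[OF oTR]) (auto intro: smooth_on_subset[OF sm] smooth_on_subset[OF sn])
  have oD: "open ?D" by (rule mult_domain_open[OF U V chart_openin[OF W(1)]])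
  let ?Q = "(T \<inter> R) \<inter> ?k -` ?D"
  have oQ: "open ?Q"
    by (rule continuous_open_preimage[OF smooth_on_continuous_on[OF k] oTR oD])
  have mU: "m y \<in> U" "n y \<in> V" if "y \<in> T \<inter> R" for y using that T R by auto
  have s: "smooth_on ?Q (\<lambda>x. (\<lambda>(x, y). \<theta> (inv_into U \<phi> x \<otimes> inv_into V \<psi> y)) (?k x))"
    by (rule smooth_on_compose[OF oQ oD _ smooth_mult[OF U V W(1)] smooth_on_subset[OF k]]) auto
  have "smooth_on ?Q (\<lambda>x. \<theta> (m x \<otimes> n x))"
    by (rule smooth_on_cong[OF oQ _ s]) (use mU chart_inv_f[OF U] chart_inv_f[OF V] in auto)
  moreover have "x \<in> ?Q"
    using W mU[of x] x T R chart_inv_f[OF U] chart_inv_f[OF V] by auto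
  moreover have "m y \<otimes> n y \<in> W" if "y \<in> ?Q" for y
    using that mU[of y] chart_inv_f[OF U, of "m y"] chart_inv_f[OF V, of "n y"] by simp
  then have "(\<lambda>x. m x \<otimes> n x) ` ?Q \<subseteq> W" by blast
  ultimately show "\<exists>W \<theta> T. (W, \<theta>) \<in> charts L \<and> open T \<and> x \<in> T \<and> T \<subseteq> S \<and>
      (\<lambda>x. m x \<otimes> n x) ` T \<subseteq> W \<and> smooth_on T (\<lambda>x. \<theta> (m x \<otimes> n x))"
    using W oQ T by (intro exI[of _ W] exI[of _ \<theta>] exI[of _ ?Q]) auto
qed

lemma smooth_into_inv:
  assumes m: "smooth_into S m"
  shows "smooth_into S (\<lambda>x. inv (m x))"
  unfolding smooth_into_def
proof (intro conjI ballI)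
  show "open S" using m by (rule smooth_into_open)
  show "(\<lambda>x. inv (m x)) ` S \<subseteq> carrier L"
    using smooth_into_carrier[OF m] by auto
  fix x assume x: "x \<in> S"
  obtain U \<phi> T where U: "(U, \<phi>) \<in> charts L" and T: "open T" "x \<in> T" "T \<subseteq> S" "m ` T \<subseteq> U"
    and sm: "smooth_on T (\<lambda>x. \<phi> (m x))"
    using m x unfolding smooth_into_def by blast
  have "inv (m x) \<in> carrier L" using m x smooth_into_carrier by blast
  then obtain W \<theta> where W: "(W, \<theta>) \<in> charts L" "inv (m x) \<in> W" using chart_exists by blast
  let ?D = "{x \<in> \<phi> ` U. inv (inv_into U \<phi> x) \<in> W}"
  have oD: "open ?D"
  proof -
    have "continuous_map (top_of_set (\<phi> ` U)) (gtop L) (\<lambda>x. inv (inv_into U \<phi> x))"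
      using continuous_map_compose[OF chart_inv_continuous[OF U] continuous_inverse] by (simp add: o_def)
    from openin_continuous_map_preimage[OF this chart_openin[OF W(1)]]
    show ?thesis using openin_open_eq[OF chart_open[OF U]] by simp
  qed
  let ?Q = "T \<inter> (\<lambda>x. \<phi> (m x)) -` ?D"
  have oQ: "open ?Q"
    by (rule continuous_open_preimage[OF smooth_on_continuous_on[OF sm] T(1) oD])
  have mU: "m y \<in> U" if "y \<in> T" for y using that T by auto
  have s: "smooth_on ?Q (\<lambda>x. \<theta> (inv (inv_into U \<phi> (\<phi> (m x)))))"
    by (rule smooth_on_compose[OF oQ oD _ smooth_inverse[OF U W(1)] smooth_on_subset[OF sm]]) auto
  have "smooth_on ?Q (\<lambda>x. \<theta> (inv (m x)))"
    by (rule smooth_on_cong[OF oQ _ s]) (use mU chart_inv_f[OF U] in auto)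
  moreover have "x \<in> ?Q" using W mU[of x] x T chart_inv_f[OF U] by auto
  moreover have "inv (m y) \<in> W" if "y \<in> ?Q" for y
    using that mU[of y] chart_inv_f[OF U, of "m y"] by simp
  then have "(\<lambda>x. inv (m x)) ` ?Q \<subseteq> W" by blast
  ultimately show "\<exists>W \<theta> T. (W, \<theta>) \<in> charts L \<and> open T \<and> x \<in> T \<and> T \<subseteq> S \<and>
      (\<lambda>x. inv (m x)) ` T \<subseteq> W \<and> smooth_on T (\<lambda>x. \<theta> (inv (m x)))"
    using W oQ T by (intro exI[of _ W] exI[of _ \<theta>] exI[of _ ?Q]) auto
qed

subsection \<open>The algebra of smooth functions\<close>

lemma SF_zero: "f \<in> SF \<Longrightarrow> p \<notin> carrier L \<Longrightarrow> f p = 0"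
  by (simp add: smooth_functions_def)

lemma SF_smooth: "f \<in> SF \<Longrightarrow> (U, \<phi>) \<in> charts L \<Longrightarrow> smooth_on (\<phi> ` U) (\<lambda>x. f (inv_into U \<phi> x))"
  by (auto simp: smooth_functions_def)

lemma SF_I:
  assumes "\<And>p. p \<notin> carrier L \<Longrightarrow> f p = 0"
    and "\<And>U \<phi>. (U, \<phi>) \<in> charts L \<Longrightarrow> smooth_on (\<phi> ` U) (\<lambda>x. f (inv_into U \<phi> x))"
  shows "f \<in> SF"
  using assms by (auto simp: smooth_functions_def)

text \<open>The transition functions between charts allow one to test smoothness at each point in a single
  chart.\<close>

lemma SF_local:
  assumes "\<And>p. p \<notin> carrier L \<Longrightarrow> f p = 0"
    and loc: "\<And>p. p \<in> carrier L \<Longrightarrow> \<exists>U \<phi> N. (U, \<phi>) \<in> charts L \<and> openin (gtop L) N \<and> p \<in> N \<and> N \<subseteq> U \<and>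
      smooth_on (\<phi> ` N) (\<lambda>x. f (inv_into U \<phi> x))"
  shows "f \<in> SF"
proof (rule SF_I[OF assms(1)])
  fix V \<psi> assume V: "(V, \<psi>) \<in> charts L"
  show "smooth_on (\<psi> ` V) (\<lambda>x. f (inv_into V \<psi> x))"
  proof (rule smooth_on_local)
    fix y assume "y \<in> \<psi> ` V"
    then obtain q where q: "q \<in> V" "y = \<psi> q" by auto
    then obtain U \<phi> N where U: "(U, \<phi>) \<in> charts L" and N: "openin (gtop L) N" "q \<in> N" "N \<subseteq> U"
      and s: "smooth_on (\<phi> ` N) (\<lambda>x. f (inv_into U \<phi> x))"
      using loc[of q] chart_subset[OF V] by blast
    let ?T = "\<psi> ` (V \<inter> N)"
    have oT: "open ?T"
      by (rule chart_image_open[OF V]) (use N chart_openin[OF V] in auto)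
    have "smooth_on ?T (\<lambda>x. f (inv_into U \<phi> (\<phi> (inv_into V \<psi> x))))"
    proof (rule smooth_on_compose[OF oT chart_image_open[OF U N(1,3)] _ s])
      show "smooth_on ?T (\<lambda>x. \<phi> (inv_into V \<psi> x))"
        by (rule smooth_on_subset[OF charts_compatible[OF V U]]) (use N in auto)
    qed (use chart_inv_f[OF V] in auto)
    then have "smooth_on ?T (\<lambda>x. f (inv_into V \<psi> x))"
      by (rule smooth_on_cong[OF oT, rotated]) (use N chart_inv_f[OF V] chart_inv_f[OF U] in auto)
    then show "\<exists>T. open T \<and> y \<in> T \<and> smooth_on T (\<lambda>x. f (inv_into V \<psi> x))"
      using oT q N by blast
  qed
qed

lemma SF_add: "f \<in> SF \<Longrightarrow> h \<in> SF \<Longrightarrow> (\<lambda>p. f p + h p) \<in> SF"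
  by (rule SF_I) (simp add: SF_zero, rule smooth_on_add[OF chart_open SF_smooth SF_smooth])

lemma SF_mult: "f \<in> SF \<Longrightarrow> h \<in> SF \<Longrightarrow> (\<lambda>p. f p * h p) \<in> SF"
  by (rule SF_I) (simp add: SF_zero, rule smooth_on_mult[OF chart_open SF_smooth SF_smooth])

lemma SF_cmult: "f \<in> SF \<Longrightarrow> (\<lambda>p. c * f p) \<in> SF"
  by (rule SF_I) (simp add: SF_zero, rule smooth_on_mult[OF chart_open smooth_on_const SF_smooth])

lemma SF_diff: "f \<in> SF \<Longrightarrow> h \<in> SF \<Longrightarrow> (\<lambda>p. f p - h p) \<in> SF"
  using SF_add[OF _ SF_cmult[of h "-1"], of f] by simp

text \<open>Smooth functions vanish outside the carrier; these are the constants among them.\<close>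

definition const_fn :: "real \<Rightarrow> 'a \<Rightarrow> real" where
  "const_fn c p = (if p \<in> carrier L then c else 0)"

lemma SF_const: "const_fn c \<in> SF"
proof (rule SF_I)
  fix U and \<phi> :: "'a \<Rightarrow> 'e" assume U: "(U, \<phi>) \<in> charts L"
  show "smooth_on (\<phi> ` U) (\<lambda>x. const_fn c (inv_into U \<phi> x))"
    by (rule smooth_on_cong[OF chart_open[OF U] _ smooth_on_const[of _ c]])
      (use chart_inv_carrier[OF U] in \<open>simp add: const_fn_def\<close>)
qed (simp add: const_fn_def)

lemma SF_zero_fn: "(\<lambda>p. 0) \<in> SF"
  using SF_const[of 0] by (simp add: const_fn_def[abs_def])

lemma SF_sum: "(\<And>i. i \<in> I \<Longrightarrow> f i \<in> SF) \<Longrightarrow> (\<lambda>p. \<Sum>i\<in>I. f i p) \<in> SF"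
proof (induction I rule: infinite_finite_induct)
  case (insert i I)
  then have "(\<lambda>p. f i p + (\<Sum>i\<in>I. f i p)) \<in> SF" by (intro SF_add) auto
  then show ?case using insert by simp
qed (auto intro: SF_zero_fn)

lemma SF_continuous:
  assumes "f \<in> SF" shows "continuous_map (gtop L) euclideanreal f"
  unfolding continuous_map
proof (intro conjI allI impI)
  fix T :: "real set" assume T: "openin euclidean T"
  show "openin (gtop L) {p \<in> topspace (gtop L). f p \<in> T}"
  proof (subst openin_subopen, intro ballI)
    fix p assume p: "p \<in> {p \<in> topspace (gtop L). f p \<in> T}"
    then obtain U \<phi> where U: "(U, \<phi>) \<in> charts L" "p \<in> U"
      using chart_exists topspace_gtop by auto
    let ?S = "\<phi> ` U \<inter> (\<lambda>x. f (inv_into U \<phi> x)) -` T"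
    have oS: "open ?S"
      using continuous_open_preimage[OF smooth_on_continuous_on[OF SF_smooth[OF assms U(1)]]
          chart_open[OF U(1)]] T by simp
    have "f q \<in> T" if "q \<in> U" "\<phi> q \<in> ?S" for q
      using that chart_inv_f[OF U(1), of q] by simp
    then have "{q \<in> U. \<phi> q \<in> ?S} \<subseteq> {p \<in> topspace (gtop L). f p \<in> T}"
      using chart_subset[OF U(1)] topspace_gtop by blast
    moreover have "p \<in> {q \<in> U. \<phi> q \<in> ?S}"
      using p U chart_inv_f[OF U(1)] by auto
    ultimately show "\<exists>T'. openin (gtop L) T' \<and> p \<in> T' \<and> T' \<subseteq> {p \<in> topspace (gtop L). f p \<in> T}"
      using chart_preimage_openin[OF U(1) oS] by blast
  qed
qed auto

lemma translate_SF:
  assumes "f \<in> SF" "a \<in> carrier L" shows "translate L a f \<in> SF"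
proof (rule SF_I)
  show "translate L a f p = 0" if "p \<notin> carrier L" for p
    using that SF_zero[OF assms(1)] by (simp add: translate_def)
  fix U and \<phi> :: "'a \<Rightarrow> 'e" assume U: "(U, \<phi>) \<in> charts L"
  have "smooth_on (\<phi> ` U) (\<lambda>x. f (a \<otimes> inv_into U \<phi> x))"
    by (intro smooth_into_SF[OF smooth_into_mult] smooth_into_const smooth_into_chart_inv assms
        chart_open U)
  then show "smooth_on (\<phi> ` U) (\<lambda>x. translate L a f (inv_into U \<phi> x))"
    by (rule smooth_on_cong[OF chart_open[OF U], rotated])
      (use chart_inv_carrier[OF U] in \<open>simp add: translate_def\<close>)
qed

lemma translate_translate:
  assumes "a \<in> carrier L" "b \<in> carrier L"
  shows "translate L a (translate L b f) = translate L (b \<otimes> a) f"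
  using assms by (auto simp: translate_def fun_eq_iff m_assoc)

lemma translate_one: "translate L \<one> f = f"
  by (auto simp: translate_def fun_eq_iff)

lemma translate_inv:
  "a \<in> carrier L \<Longrightarrow> translate L a (translate L (inv a) f) = f"
  "a \<in> carrier L \<Longrightarrow> translate L (inv a) (translate L a f) = f"
  by (simp_all add: translate_translate translate_one)

text \<open>The cutoff function of Euclidean space carries a function given in a chart to the group. Its
  support is compact, hence closed since the group is a Hausdorff space, so that the extension by
  zero is smooth.\<close>

lemma extend_from_chart:
  fixes F :: "'e \<Rightarrow> real"
  assumes V: "(V, \<psi>) \<in> charts L" "p \<in> V" and S: "open S" "\<psi> p \<in> S" "S \<subseteq> \<psi> ` V" and F: "smooth_on S F"
  obtains f N K where "f \<in> SF" "openin (gtop L) N" "p \<in> N" "N \<subseteq> V" "\<And>q. q \<in> N \<Longrightarrow> f q = F (\<psi> q)"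
    "compactin (gtop L) K" "K \<subseteq> {q \<in> V. \<psi> q \<in> S}" "\<And>q. q \<notin> K \<Longrightarrow> f q = 0"
    "(\<And>x. x \<in> S \<Longrightarrow> 0 \<le> F x) \<Longrightarrow> (\<And>q. 0 \<le> f q)"
proof -
  obtain r where r: "r > 0" "cball (\<psi> p) r \<subseteq> S"
    using S open_contains_cball by blast
  obtain \<beta> :: "'e \<Rightarrow> real" where \<beta>: "smooth_on UNIV \<beta>" "\<And>x. x \<in> ball (\<psi> p) (r / 2) \<Longrightarrow> \<beta> x = 1"
    "\<And>x. x \<notin> ball (\<psi> p) r \<Longrightarrow> \<beta> x = 0" "\<And>x. 0 \<le> \<beta> x"
    using cutoff_exists[OF r(1)] by blast
  define f where "f q = (if q \<in> V then \<beta> (\<psi> q) * F (\<psi> q) else 0)" for q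
  define K where "K = {q \<in> V. \<psi> q \<in> cball (\<psi> p) r}"
  define N where "N = {q \<in> V. \<psi> q \<in> ball (\<psi> p) (r / 2)}"
  have "K = inv_into V \<psi> ` cball (\<psi> p) r"
  proof (intro equalityI subsetI)
    fix q assume "q \<in> K" then show "q \<in> inv_into V \<psi> ` cball (\<psi> p) r"
      unfolding K_def using chart_inv_f[OF V(1), of q] by force
  next
    fix q assume "q \<in> inv_into V \<psi> ` cball (\<psi> p) r"
    then obtain x where x: "x \<in> cball (\<psi> p) r" "q = inv_into V \<psi> x" by blast
    then have "x \<in> \<psi> ` V" using r S by blast
    then show "q \<in> K" using x by (simp add: K_def inv_into_into f_inv_into_f del: mem_cball)
  qed
  moreover have "compactin (top_of_set (\<psi> ` V)) (cball (\<psi> p) r)"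
    using r S by (auto simp: compactin_subtopology)
  ultimately have K: "compactin (gtop L) K"
    using image_compactin chart_inv_continuous[OF V(1)] by metis
  have Kc: "closedin (gtop L) K" using compactin_imp_closedin[OF Hausdorff K] .
  have fK: "f q = 0" if "q \<notin> K" for q
    using that \<beta>(3)[of "\<psi> q"] by (auto simp: f_def K_def)
  have fSF: "f \<in> SF"
  proof (rule SF_local)
    show "f q = 0" if "q \<notin> carrier L" for q using that chart_subset[OF V(1)] by (auto simp: f_def)
    fix q assume q: "q \<in> carrier L"
    show "\<exists>U \<phi> N. (U, \<phi>) \<in> charts L \<and> openin (gtop L) N \<and> q \<in> N \<and> N \<subseteq> U \<and>
      smooth_on (\<phi> ` N) (\<lambda>x. f (inv_into U \<phi> x))"
    proof (cases "q \<in> V \<and> \<psi> q \<in> S")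
      case True
      let ?N = "{q \<in> V. \<psi> q \<in> S}"
      have N: "\<psi> ` ?N = S" using S by auto
      have "smooth_on S (\<lambda>x. \<beta> x * F x)"
        by (rule smooth_on_mult[OF S(1) smooth_on_subset[OF \<beta>(1)] F]) simp
      then have "smooth_on S (\<lambda>x. f (inv_into V \<psi> x))"
        by (rule smooth_on_cong[OF S(1), rotated])
          (use S in \<open>auto simp: f_def f_inv_into_f inv_into_into subset_iff\<close>)
      then show ?thesis
        using V True chart_preimage_openin[OF V(1) S(1)] N
        by (intro exI[of _ V] exI[of _ \<psi>] exI[of _ ?N]) auto
    next
      case False
      obtain U \<phi> where U: "(U, \<phi>) \<in> charts L" "q \<in> U" using chart_exists[OF q] .
      have o: "openin (gtop L) (U - K)" using chart_openin[OF U(1)] Kc by (rule openin_diff)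
      have "q \<notin> K" using False r by (auto simp: K_def)
      moreover have "smooth_on (\<phi> ` (U - K)) (\<lambda>x. f (inv_into U \<phi> x))"
      proof (rule smooth_on_cong[OF chart_image_open[OF U(1) o] _ smooth_on_const[of _ 0]])
        show "0 = f (inv_into U \<phi> x)" if "x \<in> \<phi> ` (U - K)" for x
          using that fK chart_inv_f[OF U(1)] by auto
      qed simp
      ultimately show ?thesis using U o by (intro exI[of _ U] exI[of _ \<phi>] exI[of _ "U - K"]) auto
    qed
  qed
  have "openin (gtop L) N" unfolding N_def by (rule chart_preimage_openin[OF V(1)]) simp
  moreover have "f q = F (\<psi> q)" if "q \<in> N" for q
    using that \<beta>(2)[of "\<psi> q"] by (simp add: N_def f_def)
  moreover have "0 \<le> f q" if "\<And>x. x \<in> S \<Longrightarrow> 0 \<le> F x" for q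
  proof (cases "q \<in> K")
    case True
    then show ?thesis using that \<beta>(4) r by (auto simp: f_def K_def)
  qed (simp add: fK)
  moreover have "K \<subseteq> {q \<in> V. \<psi> q \<in> S}" "p \<in> N" "N \<subseteq> V"
    using r V by (auto simp: K_def N_def)
  ultimately show thesis
    using that[of f N K] fSF K fK by blast
qed

lemma coordinates_exist:
  assumes V: "(V, \<psi>) \<in> charts L" "p \<in> V"
  obtains Y N where "\<And>b. b \<in> Basis \<Longrightarrow> Y b \<in> SF" "openin (gtop L) N" "p \<in> N" "N \<subseteq> V"
    "\<And>q b. q \<in> N \<Longrightarrow> b \<in> Basis \<Longrightarrow> Y b q = \<psi> q \<bullet> b"
proof -
  have "\<exists>f N. f \<in> SF \<and> openin (gtop L) N \<and> p \<in> N \<and> N \<subseteq> V \<and> (\<forall>q\<in>N. f q = \<psi> q \<bullet> b)" for b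
  proof -
    have lin: "smooth_on (\<psi> ` V) (\<lambda>x. x \<bullet> b)"
      by (rule smooth_on_bounded_linear) (rule bounded_linear_inner_left)
    show ?thesis
      by (rule extend_from_chart[OF V chart_open[OF V(1)] imageI[OF V(2)] order_refl lin]) blast
  qed
  then obtain Y N where *: "\<And>b. Y b \<in> SF \<and> openin (gtop L) (N b) \<and> p \<in> N b \<and> N b \<subseteq> V \<and>
      (\<forall>q\<in>N b. Y b q = \<psi> q \<bullet> b)" by metis
  have "openin (gtop L) (\<Inter> (N ` Basis))"
    by (rule openin_Inter) (use * in auto)
  then show thesis
    using that[of Y "\<Inter> (N ` Basis)"] * nonempty_Basis by blast
qed

section \<open>Vector fields\<close>

subsection \<open>Derivations at a point\<close>

definition point_derivation :: "'a \<Rightarrow> (('a \<Rightarrow> real) \<Rightarrow> real) \<Rightarrow> bool" where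
  "point_derivation p \<delta> \<longleftrightarrow> (\<forall>f\<in>SF. \<forall>h\<in>SF. \<delta> (\<lambda>q. f q + h q) = \<delta> f + \<delta> h \<and>
      \<delta> (\<lambda>q. f q * h q) = f p * \<delta> h + h p * \<delta> f) \<and> (\<forall>c. \<forall>f\<in>SF. \<delta> (\<lambda>q. c * f q) = c * \<delta> f)"

lemma
  assumes "point_derivation p \<delta>" "f \<in> SF"
  shows point_derivation_add: "h \<in> SF \<Longrightarrow> \<delta> (\<lambda>q. f q + h q) = \<delta> f + \<delta> h"
    and point_derivation_mult: "h \<in> SF \<Longrightarrow> \<delta> (\<lambda>q. f q * h q) = f p * \<delta> h + h p * \<delta> f"
    and point_derivation_cmult: "\<delta> (\<lambda>q. c * f q) = c * \<delta> f"
  using assms by (simp_all add: point_derivation_def)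

lemma point_derivation_const:
  assumes "point_derivation p \<delta>" "p \<in> carrier L" shows "\<delta> (const_fn c) = 0"
proof -
  have "(\<lambda>q. const_fn 1 q * const_fn 1 q) = const_fn 1" by (auto simp: const_fn_def)
  then have "\<delta> (const_fn 1) = const_fn 1 p * \<delta> (const_fn 1) + const_fn 1 p * \<delta> (const_fn 1)"
    using point_derivation_mult[OF assms(1) SF_const[of 1] SF_const[of 1]] by simp
  then have "\<delta> (const_fn 1) = 0" using assms(2) by (simp add: const_fn_def)
  moreover have "(\<lambda>q. c * const_fn 1 q) = const_fn c" by (auto simp: const_fn_def)
  ultimately show ?thesis
    using point_derivation_cmult[OF assms(1) SF_const[of 1], of c] by simp
qed

lemma point_derivation_zero:
  assumes "point_derivation p \<delta>" shows "\<delta> (\<lambda>q. 0) = 0"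
  using point_derivation_cmult[OF assms SF_zero_fn, of 0] by simp

lemma point_derivation_sum:
  assumes "point_derivation p \<delta>" and "\<And>i. i \<in> I \<Longrightarrow> f i \<in> SF"
  shows "\<delta> (\<lambda>q. \<Sum>i\<in>I. f i q) = (\<Sum>i\<in>I. \<delta> (f i))"
  using assms(2)
proof (induction I rule: infinite_finite_induct)
  case (insert i I)
  then have "\<delta> (\<lambda>q. f i q + (\<Sum>i\<in>I. f i q)) = \<delta> (f i) + \<delta> (\<lambda>q. \<Sum>i\<in>I. f i q)"
    by (intro point_derivation_add[OF assms(1)] SF_sum) auto
  then show ?case using insert by simp
qed (use point_derivation_zero[OF assms(1)] in auto)

text \<open>Multiplying \<open>f - h\<close> by a cutoff function that is \<open>1\<close> at \<open>p\<close> gives zero, and the product rule returns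
  the value on \<open>f - h\<close>.\<close>

lemma point_derivation_local:
  assumes \<delta>: "point_derivation p \<delta>" and f: "f \<in> SF" and h: "h \<in> SF"
    and N: "openin (gtop L) N" "p \<in> N" "\<And>q. q \<in> N \<Longrightarrow> f q = h q"
  shows "\<delta> f = \<delta> h"
proof -
  have "p \<in> carrier L" using N openin_subset topspace_gtop by blast
  then obtain V \<psi> where V: "(V, \<psi>) \<in> charts L" "p \<in> V" using chart_exists by blast
  let ?S = "\<psi> ` (V \<inter> N)"
  have "open ?S" by (rule chart_image_open[OF V(1)]) (use N chart_openin[OF V(1)] in auto)
  then obtain b N' K where b: "b \<in> SF" "p \<in> N'" "\<And>q. q \<in> N' \<Longrightarrow> b q = 1" "K \<subseteq> {q \<in> V. \<psi> q \<in> ?S}"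
    "\<And>q. q \<notin> K \<Longrightarrow> b q = 0"
  proof (rule extend_from_chart[OF V _ _ _ smooth_on_const[of ?S 1]])
    show "\<psi> p \<in> ?S" "?S \<subseteq> \<psi> ` V" using V N by auto
  qed auto
  have d: "(\<lambda>q. f q + (-1) * h q) \<in> SF" using f h by (intro SF_add SF_cmult)
  have KN: "q \<in> N" if "q \<in> K" for q
    using that b(4) chart_inj[OF V(1)] by (auto dest: inj_onD)
  have "(\<lambda>q. b q * (f q + (-1) * h q)) = (\<lambda>q. 0)"
  proof
    show "b q * (f q + (-1) * h q) = 0" for q using b(5)[of q] N(3)[of q] KN[of q] by auto
  qed
  then have "0 = b p * \<delta> (\<lambda>q. f q + (-1) * h q) + (f p + (-1) * h p) * \<delta> b"
    using point_derivation_mult[OF \<delta> b(1) d] point_derivation_zero[OF \<delta>] by simp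
  then have "\<delta> (\<lambda>q. f q + (-1) * h q) = 0" using b(3)[OF b(2)] N(3)[OF N(2)] by simp
  moreover have "\<delta> (\<lambda>q. f q + (-1) * h q) = \<delta> f + \<delta> (\<lambda>q. (-1) * h q)"
    by (rule point_derivation_add[OF \<delta> f SF_cmult[OF h]])
  moreover have "\<delta> (\<lambda>q. (-1) * h q) = (-1) * \<delta> h"
    by (rule point_derivation_cmult[OF \<delta> h])
  ultimately show ?thesis by simp
qed

text \<open>By Hadamard's lemma a smooth function is, near \<open>p\<close>, a constant plus a sum of products of two
  smooth functions the first of which is a coordinate vanishing at \<open>p\<close>; the product rule does the rest.\<close>

lemma point_derivation_expand:
  assumes \<delta>: "point_derivation p \<delta>" and V: "(V, \<psi>) \<in> charts L"
    and N: "openin (gtop L) N" "p \<in> N" "N \<subseteq> V"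
    and Y: "\<And>b. b \<in> Basis \<Longrightarrow> Y b \<in> SF" "\<And>q b. q \<in> N \<Longrightarrow> b \<in> Basis \<Longrightarrow> Y b q = \<psi> q \<bullet> b"
    and f: "f \<in> SF"
  shows "\<delta> f = (\<Sum>b\<in>Basis. \<delta> (Y b) * frechet_derivative (\<lambda>x. f (inv_into V \<psi> x)) (at (\<psi> p)) b)"
proof -
  let ?F = "\<lambda>x. f (inv_into V \<psi> x)"
  have pV: "p \<in> V" and pc: "p \<in> carrier L" using N chart_subset[OF V] by auto
  obtain r where r: "r > 0" "ball (\<psi> p) r \<subseteq> \<psi> ` N"
    using chart_image_open[OF V N(1,3)] N(2) open_contains_ball by blast
  then have sub: "ball (\<psi> p) r \<subseteq> \<psi> ` V" using N by blast
  obtain g where g: "\<And>b. smooth_on (ball (\<psi> p) r) (g b)" "\<And>b. g b (\<psi> p) = frechet_derivative ?F (at (\<psi> p)) b"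
    "\<And>x. x \<in> ball (\<psi> p) r \<Longrightarrow> ?F x = ?F (\<psi> p) + (\<Sum>b\<in>Basis. ((x - \<psi> p) \<bullet> b) * g b x)"
    using hadamard[OF smooth_on_subset[OF SF_smooth[OF f V] sub] r(1)] by blast
  have "\<exists>G M. G \<in> SF \<and> openin (gtop L) M \<and> p \<in> M \<and> M \<subseteq> V \<and> (\<forall>q\<in>M. G q = g b (\<psi> q))" for b
    by (rule extend_from_chart[OF V pV open_ball _ sub g(1)[of b]]) (use r(1) in \<open>simp, blast\<close>)
  then obtain G M where G: "\<And>b. G b \<in> SF \<and> openin (gtop L) (M b) \<and> p \<in> M b \<and> M b \<subseteq> V \<and>
      (\<forall>q\<in>M b. G b q = g b (\<psi> q))" by metis
  define Z where "Z b = (\<lambda>q. Y b q + const_fn (- (\<psi> p \<bullet> b)) q)" for b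
  define h where "h = (\<lambda>q. const_fn (f p) q + (\<Sum>b\<in>Basis. Z b q * G b q))"
  have Z: "Z b \<in> SF" if "b \<in> Basis" for b
    unfolding Z_def using that by (intro SF_add Y SF_const)
  have ZG: "(\<lambda>q. Z b q * G b q) \<in> SF" if "b \<in> Basis" for b
    using that G by (intro SF_mult Z) auto
  have h: "h \<in> SF" unfolding h_def by (intro SF_add SF_const SF_sum ZG)
  let ?N = "{q \<in> V. \<psi> q \<in> ball (\<psi> p) r} \<inter> N \<inter> \<Inter> (M ` Basis)"
  have "openin (gtop L) (\<Inter> (M ` Basis))" by (rule openin_Inter) (use G in auto)
  then have oN: "openin (gtop L) ?N"
    by (intro openin_Int N chart_preimage_openin[OF V] open_ball)
  have eq: "f q = h q" if q: "q \<in> ?N" for q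
  proof -
    have qV: "q \<in> V" "q \<in> carrier L" using q chart_subset[OF V] by auto
    have "f q = ?F (\<psi> q)" using chart_inv_f[OF V qV(1)] by simp
    also have "\<dots> = f p + (\<Sum>b\<in>Basis. ((\<psi> q - \<psi> p) \<bullet> b) * g b (\<psi> q))"
      using g(3)[of "\<psi> q"] q chart_inv_f[OF V pV] by auto
    also have "(\<Sum>b\<in>Basis. ((\<psi> q - \<psi> p) \<bullet> b) * g b (\<psi> q)) = (\<Sum>b\<in>Basis. Z b q * G b q)"
      using q qV Y(2)[of q] G by (intro sum.cong) (auto simp: Z_def const_fn_def inner_diff_left)
    finally show ?thesis using qV by (simp add: h_def const_fn_def)
  qed
  have "\<delta> f = \<delta> h"
    by (rule point_derivation_local[OF \<delta> f h oN _ eq]) (use r N pV G in auto)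
  also have "\<dots> = \<delta> (const_fn (f p)) + \<delta> (\<lambda>q. \<Sum>b\<in>Basis. Z b q * G b q)"
    unfolding h_def by (rule point_derivation_add[OF \<delta> SF_const SF_sum[OF ZG]])
  also have "\<dots> = (\<Sum>b\<in>Basis. \<delta> (\<lambda>q. Z b q * G b q))"
    using point_derivation_const[OF \<delta> pc] point_derivation_sum[OF \<delta> ZG] by simp
  also have "\<dots> = (\<Sum>b\<in>Basis. \<delta> (Y b) * g b (\<psi> p))"
  proof (rule sum.cong[OF refl])
    fix b :: 'e assume b: "b \<in> Basis"
    have "\<delta> (\<lambda>q. Z b q * G b q) = Z b p * \<delta> (G b) + G b p * \<delta> (Z b)"
      by (rule point_derivation_mult[OF \<delta> Z[OF b]]) (use G in auto)
    moreover have "Z b p = 0" using Y(2)[OF N(2) b] pc by (simp add: Z_def const_fn_def)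
    moreover have "\<delta> (Z b) = \<delta> (Y b)"
      using point_derivation_add[OF \<delta> Y(1)[OF b] SF_const] point_derivation_const[OF \<delta> pc]
      by (simp add: Z_def)
    ultimately show "\<delta> (\<lambda>q. Z b q * G b q) = \<delta> (Y b) * g b (\<psi> p)" using G by simp
  qed
  finally show ?thesis by (simp add: g(2))
qed

end

context lie_group
begin

subsection \<open>Vector fields as derivations\<close>

lemma
  assumes "X \<in> VF"
  shows VF_SF: "f \<in> SF \<Longrightarrow> X f \<in> SF"
    and VF_not_SF: "f \<notin> SF \<Longrightarrow> X f = (\<lambda>p. 0)"
    and VF_add: "f \<in> SF \<Longrightarrow> h \<in> SF \<Longrightarrow> X (\<lambda>p. f p + h p) = (\<lambda>p. X f p + X h p)"
    and VF_mult: "f \<in> SF \<Longrightarrow> h \<in> SF \<Longrightarrow> X (\<lambda>p. f p * h p) = (\<lambda>p. f p * X h p + h p * X f p)"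
    and VF_cmult: "f \<in> SF \<Longrightarrow> X (\<lambda>p. c * f p) = (\<lambda>p. c * X f p)"
  using assms unfolding vector_fields_def by simp_all

lemma VF_I:
  assumes "\<And>f. f \<in> SF \<Longrightarrow> X f \<in> SF" "\<And>f. f \<notin> SF \<Longrightarrow> X f = (\<lambda>p. 0)"
    and "\<And>f h. f \<in> SF \<Longrightarrow> h \<in> SF \<Longrightarrow> X (\<lambda>p. f p + h p) = (\<lambda>p. X f p + X h p)"
    and "\<And>f h. f \<in> SF \<Longrightarrow> h \<in> SF \<Longrightarrow> X (\<lambda>p. f p * h p) = (\<lambda>p. f p * X h p + h p * X f p)"
    and "\<And>f c. f \<in> SF \<Longrightarrow> X (\<lambda>p. c * f p) = (\<lambda>p. c * X f p)"
  shows "X \<in> VF"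
  unfolding vector_fields_def using assms by simp

lemma VF_zero: "X \<in> VF \<Longrightarrow> p \<notin> carrier L \<Longrightarrow> X f p = 0"
  using VF_SF[of X f] VF_not_SF[of X f] SF_zero[of "X f" p] by (cases "f \<in> SF") auto

lemma VF_eqI:
  assumes "X \<in> VF" "Y \<in> VF" "\<And>f p. f \<in> SF \<Longrightarrow> p \<in> carrier L \<Longrightarrow> X f p = Y f p"
  shows "X = Y"
proof (intro ext)
  fix f p show "X f p = Y f p"
    using assms(3)[of f p] VF_not_SF[OF assms(1), of f] VF_not_SF[OF assms(2), of f]
      VF_zero[OF assms(1), of p f] VF_zero[OF assms(2), of p f]
    by (cases "f \<in> SF"; cases "p \<in> carrier L") auto
qed

lemma VF_point_derivation: "X \<in> VF \<Longrightarrow> point_derivation p (\<lambda>f. X f p)"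
  by (simp add: point_derivation_def VF_add VF_mult VF_cmult)

lemma vf_add_VF: "X \<in> VF \<Longrightarrow> Y \<in> VF \<Longrightarrow> vf_add X Y \<in> VF"
  by (rule VF_I)
    (auto simp: vf_add_def VF_not_SF VF_add VF_mult VF_cmult algebra_simps intro: SF_add VF_SF)

lemma vf_mult_VF:
  assumes "h \<in> SF" "X \<in> VF" shows "vf_mult h X \<in> VF"
  using assms
  by (intro VF_I) (auto simp: vf_mult_def VF_not_SF VF_add VF_mult VF_cmult algebra_simps
      intro: SF_mult VF_SF)

text \<open>The axioms of metrics and connections speak of multiples by smooth functions, which vanish outside
  the carrier.\<close>

lemma vf_cmult_eq: "X \<in> VF \<Longrightarrow> vf_mult (\<lambda>_. c) X = vf_mult (const_fn c) X"
  by (auto simp: vf_mult_def const_fn_def fun_eq_iff VF_zero)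

lemma lie_bracket_VF:
  assumes X: "X \<in> VF" and Y: "Y \<in> VF" shows "lie_bracket X Y \<in> VF"
proof (rule VF_I)
  have zero: "Z (\<lambda>p. 0) = (\<lambda>p. 0)" if "Z \<in> VF" for Z
    using VF_cmult[OF that SF_zero_fn, of 0] by simp
  fix f
  show "lie_bracket X Y f = (\<lambda>p. 0)" if "f \<notin> SF"
    unfolding lie_bracket_def VF_not_SF[OF X that] VF_not_SF[OF Y that] zero[OF X] zero[OF Y] by simp
  assume f: "f \<in> SF"
  show "lie_bracket X Y f \<in> SF"
    unfolding lie_bracket_def by (rule SF_diff[OF VF_SF[OF X VF_SF[OF Y f]] VF_SF[OF Y VF_SF[OF X f]]])
  show "lie_bracket X Y (\<lambda>p. c * f p) = (\<lambda>p. c * lie_bracket X Y f p)" for c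
    unfolding lie_bracket_def VF_cmult[OF X f] VF_cmult[OF Y f]
      VF_cmult[OF X VF_SF[OF Y f]] VF_cmult[OF Y VF_SF[OF X f]]
    by (simp add: algebra_simps)
  fix h assume h: "h \<in> SF"
  have twice: "A (B (\<lambda>p. f p * h p)) = (\<lambda>p. (f p * A (B h) p + B h p * A f p) +
      (h p * A (B f) p + B f p * A h p))" if A: "A \<in> VF" and B: "B \<in> VF" for A B
    unfolding VF_mult[OF B f h]
      VF_add[OF A SF_mult[OF f VF_SF[OF B h]] SF_mult[OF h VF_SF[OF B f]]]
      VF_mult[OF A f VF_SF[OF B h]] VF_mult[OF A h VF_SF[OF B f]] ..
  show "lie_bracket X Y (\<lambda>p. f p * h p) = (\<lambda>p. f p * lie_bracket X Y h p + h p * lie_bracket X Y f p)"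
    unfolding lie_bracket_def twice[OF X Y] twice[OF Y X] by (simp add: algebra_simps)
  show "lie_bracket X Y (\<lambda>p. f p + h p) = (\<lambda>p. lie_bracket X Y f p + lie_bracket X Y h p)"
    unfolding lie_bracket_def VF_add[OF X f h] VF_add[OF Y f h]
      VF_add[OF X VF_SF[OF Y f] VF_SF[OF Y h]] VF_add[OF Y VF_SF[OF X f] VF_SF[OF X h]]
    by (simp add: algebra_simps)
qed

text \<open>The velocity at \<open>x0\<close>, in direction \<open>v\<close>, of a family of maps \<open>p \<mapsto> \<Theta> p x\<close> that is the identity
  for \<open>x = x0\<close>. Left and right multiplication by the points of a chart give the right and left
  invariant vector fields.\<close>

definition flow_field :: "('a \<Rightarrow> 'e \<Rightarrow> 'a) \<Rightarrow> 'e \<Rightarrow> 'e \<Rightarrow> 'a operator" where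
  "flow_field \<Theta> x0 v f p =
     (if f \<in> SF \<and> p \<in> carrier L then frechet_derivative (\<lambda>x. f (\<Theta> p x)) (at x0) v else 0)"

definition smooth_flow :: "('a \<Rightarrow> 'e \<Rightarrow> 'a) \<Rightarrow> 'e set \<Rightarrow> 'e \<Rightarrow> bool" where
  "smooth_flow \<Theta> S x0 \<longleftrightarrow> open S \<and> x0 \<in> S \<and> (\<forall>p\<in>carrier L. \<Theta> p x0 = p) \<and>
     (\<forall>V \<psi>. (V, \<psi>) \<in> charts L \<longrightarrow> smooth_into (\<psi> ` V \<times> S) (\<lambda>(y, x). \<Theta> (inv_into V \<psi> y) x))"

lemma smooth_flow_joint:
  assumes "smooth_flow \<Theta> S x0" "f \<in> SF" "(V, \<psi>) \<in> charts L"
  shows "smooth_on (\<psi> ` V \<times> S) (\<lambda>(y, x). f (\<Theta> (inv_into V \<psi> y) x))"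
  using smooth_into_SF[of "\<psi> ` V \<times> S" "\<lambda>(y, x). \<Theta> (inv_into V \<psi> y) x" f] assms
  by (simp add: smooth_flow_def case_prod_unfold)

lemma smooth_flow_slice:
  assumes "smooth_flow \<Theta> S x0" "f \<in> SF" "p \<in> carrier L"
  shows "smooth_on S (\<lambda>x. f (\<Theta> p x))"
proof -
  obtain V \<psi> where V: "(V, \<psi>) \<in> charts L" "p \<in> V" using chart_exists[OF assms(3)] .
  have S: "open S" using assms(1) by (simp add: smooth_flow_def)
  have "smooth_on S (\<lambda>x. (\<lambda>(y, x). f (\<Theta> (inv_into V \<psi> y) x)) (\<psi> p, x))"
    by (rule smooth_on_compose[OF S open_Times[OF chart_open[OF V(1)] S] _ smooth_flow_joint[OF assms(1,2) V(1)]])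
      (use V S in \<open>auto intro!: smooth_on_Pair smooth_on_const smooth_on_ident\<close>)
  then show ?thesis by (simp add: chart_inv_f[OF V])
qed

lemma flow_field_has_derivative:
  assumes "smooth_flow \<Theta> S x0" "f \<in> SF" "p \<in> carrier L"
  shows "((\<lambda>x. f (\<Theta> p x)) has_derivative (\<lambda>v. flow_field \<Theta> x0 v f p)) (at x0)"
proof -
  have "(\<lambda>v. flow_field \<Theta> x0 v f p) = frechet_derivative (\<lambda>x. f (\<Theta> p x)) (at x0)"
    using assms by (auto simp: flow_field_def)
  then show ?thesis
    using smooth_on_has_derivative[OF smooth_flow_slice[OF assms], of x0] assms(1)
    by (simp add: smooth_flow_def)
qed

lemma flow_field_eqI:
  assumes "((\<lambda>x. f (\<Theta> p x)) has_derivative D) (at x0)" "f \<in> SF" "p \<in> carrier L"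
  shows "flow_field \<Theta> x0 v f p = D v"
  using frechet_derivative_at[OF assms(1)] assms(2,3) by (simp add: flow_field_def)

lemma flow_field_linear:
  assumes "smooth_flow \<Theta> S x0"
  shows "linear (\<lambda>v. flow_field \<Theta> x0 v f p)"
proof (cases "f \<in> SF \<and> p \<in> carrier L")
  case True
  then show ?thesis
    using flow_field_has_derivative[OF assms, of f p] has_derivative_linear by blast
next
  case False
  then have "(\<lambda>v. flow_field \<Theta> x0 v f p) = (\<lambda>v. 0)" by (auto simp: flow_field_def)
  then show ?thesis by (simp add: module_hom_zero linear_iff)
qed

lemma flow_field_VF:
  assumes fl: "smooth_flow \<Theta> S x0"
  shows "flow_field \<Theta> x0 v \<in> VF"
proof (rule VF_I)
  have x0: "x0 \<in> S" "open S" and id: "\<And>p. p \<in> carrier L \<Longrightarrow> \<Theta> p x0 = p"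
    using fl by (auto simp: smooth_flow_def)
  note der = flow_field_has_derivative[OF fl]
  fix f assume f: "f \<in> SF"
  show "flow_field \<Theta> x0 v f \<in> SF"
  proof (rule SF_I)
    fix V and \<psi> :: "'a \<Rightarrow> 'e" assume V: "(V, \<psi>) \<in> charts L"
    let ?Q = "\<lambda>(y, x). f (\<Theta> (inv_into V \<psi> y) x)"
    have Q: "smooth_on (\<psi> ` V \<times> S) ?Q" by (rule smooth_flow_joint[OF fl f V])
    have o: "open (\<psi> ` V)" "open (\<psi> ` V \<times> S)" using chart_open[OF V] x0(2) by (auto intro: open_Times)
    have k: "smooth_on (\<psi> ` V) (\<lambda>y. (y, x0))"
      by (intro smooth_on_Pair smooth_on_ident smooth_on_const o)
    have "smooth_on (\<psi> ` V) (\<lambda>y. frechet_derivative ?Q (at (y, x0)) (0, v))"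
      by (rule smooth_on_compose[OF o _ smooth_on_derivative[OF Q] k]) (use x0 in auto)
    moreover have "frechet_derivative ?Q (at (y, x0)) (0, v) = flow_field \<Theta> x0 v f (inv_into V \<psi> y)"
      if "y \<in> \<psi> ` V" for y
      using partial_derivative_snd(2)[OF Q, of y x0 v] that x0 f chart_inv_carrier[OF V that]
      by (simp add: flow_field_def)
    ultimately show "smooth_on (\<psi> ` V) (\<lambda>y. flow_field \<Theta> x0 v f (inv_into V \<psi> y))"
      by (rule smooth_on_cong[OF o(1), rotated]) 
  qed (simp add: flow_field_def)
  show "flow_field \<Theta> x0 v (\<lambda>p. c * f p) = (\<lambda>p. c * flow_field \<Theta> x0 v f p)" for c
  proof
    fix p show "flow_field \<Theta> x0 v (\<lambda>p. c * f p) p = c * flow_field \<Theta> x0 v f p"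
    proof (cases "p \<in> carrier L")
      case True
      have "((\<lambda>x. c * f (\<Theta> p x)) has_derivative (\<lambda>v. c * flow_field \<Theta> x0 v f p)) (at x0)"
        by (intro has_derivative_mult_right der f True)
      from flow_field_eqI[where f="\<lambda>p. c * f p" and \<Theta>=\<Theta> and p=p, OF this SF_cmult[OF f] True] show ?thesis .
    qed (simp add: flow_field_def)
  qed
  fix h assume h: "h \<in> SF"
  show "flow_field \<Theta> x0 v (\<lambda>p. f p + h p) = (\<lambda>p. flow_field \<Theta> x0 v f p + flow_field \<Theta> x0 v h p)"
  proof
    fix p show "flow_field \<Theta> x0 v (\<lambda>p. f p + h p) p = flow_field \<Theta> x0 v f p + flow_field \<Theta> x0 v h p"
    proof (cases "p \<in> carrier L")
      case True
      from flow_field_eqI[where f="\<lambda>p. f p + h p" and \<Theta>=\<Theta> and p=p,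
          OF has_derivative_add[OF der[OF f True] der[OF h True]] SF_add[OF f h] True]
      show ?thesis .
    qed (simp add: flow_field_def)
  qed
  show "flow_field \<Theta> x0 v (\<lambda>p. f p * h p) =
      (\<lambda>p. f p * flow_field \<Theta> x0 v h p + h p * flow_field \<Theta> x0 v f p)"
  proof
    fix p
    show "flow_field \<Theta> x0 v (\<lambda>p. f p * h p) p =
      f p * flow_field \<Theta> x0 v h p + h p * flow_field \<Theta> x0 v f p"
    proof (cases "p \<in> carrier L")
      case True
      show ?thesis
        using flow_field_eqI[where f="\<lambda>p. f p * h p" and \<Theta>=\<Theta> and p=p,
            OF has_derivative_mult[OF der[OF f True] der[OF h True]] SF_mult[OF f h] True]
        by (simp add: id[OF True])
    qed (simp add: flow_field_def)
  qed
qed (auto simp: flow_field_def)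

end

section \<open>The Lie algebra\<close>

text \<open>The Lie algebra is identified with the model space of a chart around the unit.\<close>

locale lie_group_chart = lie_group L for L :: "('a, 'e::euclidean_space) smooth_group" (structure) +
  fixes U :: "'a set" and \<phi> :: "'a \<Rightarrow> 'e"
  assumes U_chart: "(U, \<phi>) \<in> charts L" and one_U: "\<one> \<in> U"
begin

abbreviation \<gamma> :: "'e \<Rightarrow> 'a" where "\<gamma> \<equiv> inv_into U \<phi>"

definition linv :: "'e \<Rightarrow> 'a operator" where
  "linv = flow_field (\<lambda>p x. p \<otimes> \<gamma> x) (\<phi> \<one>)"

definition rinv :: "'e \<Rightarrow> 'a operator" where
  "rinv = flow_field (\<lambda>p x. \<gamma> x \<otimes> p) (\<phi> \<one>)"

lemma \<gamma>_one: "\<gamma> (\<phi> \<one>) = \<one>"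
  by (rule chart_inv_f[OF U_chart one_U])

lemma \<gamma>_carrier: "x \<in> \<phi> ` U \<Longrightarrow> \<gamma> x \<in> carrier L"
  by (rule chart_inv_carrier[OF U_chart])

lemma open_image: "open (\<phi> ` U)"
  by (rule chart_open[OF U_chart])

lemma smooth_into_fst_snd:
  assumes V: "(V, \<psi>) \<in> charts L" and W: "(W, \<theta>) \<in> charts L"
  shows "smooth_into (\<psi> ` V \<times> \<theta> ` W) (\<lambda>z. inv_into V \<psi> (fst z))"
    and "smooth_into (\<psi> ` V \<times> \<theta> ` W) (\<lambda>z. inv_into W \<theta> (snd z))"
  by (rule smooth_into_compose[OF smooth_into_chart_inv[OF V]] smooth_into_compose[OF smooth_into_chart_inv[OF W]];
      auto intro!: smooth_on_bounded_linear bounded_linear_fst bounded_linear_snd open_Times chart_open V W)+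

lemma left_flow: "smooth_flow (\<lambda>p x. p \<otimes> \<gamma> x) (\<phi> ` U) (\<phi> \<one>)"
  unfolding smooth_flow_def case_prod_beta
  using one_U open_image smooth_into_mult[OF smooth_into_fst_snd(1)[OF _ U_chart] smooth_into_fst_snd(2)[OF _ U_chart]]
  by (auto simp: \<gamma>_one)

lemma right_flow: "smooth_flow (\<lambda>p x. \<gamma> x \<otimes> p) (\<phi> ` U) (\<phi> \<one>)"
  unfolding smooth_flow_def case_prod_beta
  using one_U open_image smooth_into_mult[OF smooth_into_fst_snd(2)[OF _ U_chart] smooth_into_fst_snd(1)[OF _ U_chart]]
  by (auto simp: \<gamma>_one)

lemma linv_VF: "linv v \<in> VF"
  unfolding linv_def by (rule flow_field_VF[OF left_flow])

lemma rinv_VF: "rinv v \<in> VF"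
  unfolding rinv_def by (rule flow_field_VF[OF right_flow])

lemma linv_linear: "linear (\<lambda>v. linv v f p)"
  unfolding linv_def by (rule flow_field_linear[OF left_flow])

lemma linv_eq: "f \<in> SF \<Longrightarrow> p \<in> carrier L \<Longrightarrow>
    linv v f p = frechet_derivative (\<lambda>x. f (p \<otimes> \<gamma> x)) (at (\<phi> \<one>)) v"
  by (simp add: linv_def flow_field_def)

lemma rinv_eq: "f \<in> SF \<Longrightarrow> p \<in> carrier L \<Longrightarrow>
    rinv v f p = frechet_derivative (\<lambda>x. f (\<gamma> x \<otimes> p)) (at (\<phi> \<one>)) v"
  by (simp add: rinv_def flow_field_def)

lemma SF_chart_differentiable: "f \<in> SF \<Longrightarrow> (\<lambda>x. f (\<gamma> x)) differentiable (at (\<phi> \<one>))"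
  using smooth_on_differentiable[OF SF_smooth[OF _ U_chart]] one_U by blast

lemma linv_one:
  assumes "f \<in> SF"
  shows "linv v f \<one> = frechet_derivative (\<lambda>x. f (\<gamma> x)) (at (\<phi> \<one>)) v"
    and "rinv v f \<one> = frechet_derivative (\<lambda>x. f (\<gamma> x)) (at (\<phi> \<one>)) v"
proof -
  have "\<phi> \<one> \<in> \<phi> ` U" using one_U by blast
  note cong = frechet_derivative_cong[OF open_image this _ SF_chart_differentiable[OF assms]]
  show "linv v f \<one> = frechet_derivative (\<lambda>x. f (\<gamma> x)) (at (\<phi> \<one>)) v"
    using cong[of "\<lambda>x. f (\<one> \<otimes> \<gamma> x)"] \<gamma>_carrier by (simp add: linv_eq[OF assms])
  show "rinv v f \<one> = frechet_derivative (\<lambda>x. f (\<gamma> x)) (at (\<phi> \<one>)) v"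
    using cong[of "\<lambda>x. f (\<gamma> x \<otimes> \<one>)"] \<gamma>_carrier by (simp add: rinv_eq[OF assms])
qed

lemma linv_translate:
  assumes "f \<in> SF" "p \<in> carrier L"
  shows "linv v (translate L p f) \<one> = linv v f p"
proof -
  have "\<phi> \<one> \<in> \<phi> ` U" using one_U by blast
  have "frechet_derivative (\<lambda>x. translate L p f (\<gamma> x)) (at (\<phi> \<one>)) =
      frechet_derivative (\<lambda>x. f (p \<otimes> \<gamma> x)) (at (\<phi> \<one>))"
    by (rule frechet_derivative_cong[OF open_image \<open>\<phi> \<one> \<in> \<phi> ` U\<close> _
          SF_chart_differentiable[OF translate_SF[OF assms]]])
      (use \<gamma>_carrier in \<open>simp add: translate_def\<close>)
  then show ?thesis
    by (simp add: linv_one(1)[OF translate_SF[OF assms]] linv_eq[OF assms])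
qed

lemma linv_sum: "linv v f p = (\<Sum>b\<in>Basis. (v \<bullet> b) * linv b f p)"
proof -
  have "linv v f p = linv (\<Sum>b\<in>Basis. (v \<bullet> b) *\<^sub>R b) f p"
    by (simp only: euclidean_representation)
  also have "\<dots> = (\<Sum>b\<in>Basis. linv ((v \<bullet> b) *\<^sub>R b) f p)"
    by (rule linear_sum[OF linv_linear])
  also have "\<dots> = (\<Sum>b\<in>Basis. (v \<bullet> b) * linv b f p)"
    using linear_scale[OF linv_linear] by simp
  finally show ?thesis .
qed

lemma coordinates_at_one:
  obtains Y N where "\<And>b. b \<in> Basis \<Longrightarrow> Y b \<in> SF" "openin (gtop L) N" "\<one> \<in> N" "N \<subseteq> U"
    "\<And>q b. q \<in> N \<Longrightarrow> b \<in> Basis \<Longrightarrow> Y b q = \<phi> q \<bullet> b"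
    "\<And>v b. b \<in> Basis \<Longrightarrow> linv v (Y b) \<one> = v \<bullet> b"
proof (rule coordinates_exist[OF U_chart one_U])
  fix Y N
  assume Y: "\<And>b. b \<in> Basis \<Longrightarrow> Y b \<in> SF" "openin (gtop L) N" "\<one> \<in> N" "N \<subseteq> U"
    "\<And>q b. q \<in> N \<Longrightarrow> b \<in> Basis \<Longrightarrow> Y b q = \<phi> q \<bullet> b"
  have "linv v (Y b) \<one> = v \<bullet> b" if b: "b \<in> Basis" for v b
  proof -
    have o: "open (\<phi> ` N)" by (rule chart_image_open[OF U_chart Y(2,4)])
    have "((\<lambda>x. x \<bullet> b) has_derivative (\<lambda>v. v \<bullet> b)) (at (\<phi> \<one>))"
      by (auto intro!: derivative_eq_intros)
    then have "((\<lambda>x. Y b (\<gamma> x)) has_derivative (\<lambda>v. v \<bullet> b)) (at (\<phi> \<one>))"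
    proof (rule has_derivative_transform_within_open[OF _ o])
      show "\<phi> \<one> \<in> \<phi> ` N" using Y by blast
      show "x \<bullet> b = Y b (\<gamma> x)" if x: "x \<in> \<phi> ` N" for x
      proof -
        obtain q where q: "q \<in> N" "x = \<phi> q" using x by blast
        then have "\<gamma> x = q" using chart_inv_f[OF U_chart] Y(4) by blast
        then show ?thesis using Y(5)[OF q(1) b] q by simp
      qed
    qed
    from frechet_derivative_at[OF this, symmetric] show ?thesis by (simp add: linv_one[OF Y(1)[OF b]])
  qed
  then show thesis using that[of Y N] Y by blast
qed

text \<open>Coordinate functions, cut off outside a neighbourhood of the unit, recover \<open>v\<close>.\<close>

lemma linv_determined:
  assumes "\<And>f. f \<in> SF \<Longrightarrow> linv v f \<one> = linv w f \<one>" shows "v = w"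
proof (rule coordinates_at_one)
  fix Y N
  assume Y: "\<And>b. b \<in> Basis \<Longrightarrow> Y b \<in> SF" "\<And>v b. b \<in> Basis \<Longrightarrow> linv v (Y b) \<one> = v \<bullet> b"
  show "v = w"
  proof (rule euclidean_eqI)
    fix b :: 'e assume b: "b \<in> Basis"
    show "v \<bullet> b = w \<bullet> b" using assms[OF Y(1)[OF b]] Y(2)[OF b] by simp
  qed
qed

lemma linv_inj: "linv v = linv w \<Longrightarrow> v = w"
  using linv_determined[of v w] by simp

text \<open>The left invariant vector fields form a global frame. The coefficients of \<open>X\<close> at \<open>p\<close> are read
  off from the coordinates at the unit, translated to \<open>p\<close>; expressing \<open>X\<close> near a point by the partial
  derivatives of one fixed chart shows that they are smooth.\<close>

lemma vector_field_expand:
  assumes X: "X \<in> VF"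
  obtains h :: "'a \<Rightarrow> 'e" where "\<And>b. b \<in> Basis \<Longrightarrow> (\<lambda>p. h p \<bullet> b) \<in> SF"
    "\<And>f p. f \<in> SF \<Longrightarrow> p \<in> carrier L \<Longrightarrow> X f p = linv (h p) f p"
proof (rule coordinates_at_one)
  fix Y N
  assume Y: "\<And>b. b \<in> Basis \<Longrightarrow> Y b \<in> SF" and N: "openin (gtop L) N" "\<one> \<in> N" "N \<subseteq> U"
    and YN: "\<And>q b. q \<in> N \<Longrightarrow> b \<in> Basis \<Longrightarrow> Y b q = \<phi> q \<bullet> b"
  define H where "H b p = X (translate L (inv p) (Y b)) p" for b p
  define h where "h p = (if p \<in> carrier L then \<Sum>b\<in>Basis. H b p *\<^sub>R b else 0)" for p
  have hb: "h p \<bullet> b = (if p \<in> carrier L then H b p else 0)" if "b \<in> Basis" for p b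
    using that by (simp add: h_def inner_sum_left_Basis)
  show thesis
  proof (rule that)
    fix b :: 'e assume b: "b \<in> Basis"
    show "(\<lambda>p. h p \<bullet> b) \<in> SF"
    proof (rule SF_local)
      fix p0 assume p0: "p0 \<in> carrier L"
      obtain V \<psi> where V: "(V, \<psi>) \<in> charts L" "p0 \<in> V" using chart_exists[OF p0] .
      obtain Z M where Z: "\<And>b. b \<in> Basis \<Longrightarrow> Z b \<in> SF" and M: "openin (gtop L) M" "p0 \<in> M" "M \<subseteq> V"
        and ZM: "\<And>q b. q \<in> M \<Longrightarrow> b \<in> Basis \<Longrightarrow> Z b q = \<psi> q \<bullet> b"
        using coordinates_exist[OF V] by blast
      have oM: "open (\<psi> ` M)" by (rule chart_image_open[OF V(1) M(1,3)])
      have oVV: "open (\<psi> ` V \<times> \<psi> ` V)" using chart_open[OF V(1)] by (intro open_Times)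
      let ?Q = "\<lambda>z. Y b (inv (inv_into V \<psi> (fst z)) \<otimes> inv_into V \<psi> (snd z))"
      have Q: "smooth_on (\<psi> ` V \<times> \<psi> ` V) ?Q"
        by (rule smooth_into_SF[OF smooth_into_mult[OF smooth_into_inv] Y[OF b]])
          (rule smooth_into_fst_snd[OF V(1) V(1)])+
      have k: "smooth_on (\<psi> ` M) (\<lambda>y. (y, y))" by (intro smooth_on_Pair smooth_on_ident oM)
      let ?R = "\<lambda>y. \<Sum>i\<in>Basis. X (Z i) (inv_into V \<psi> y) * frechet_derivative ?Q (at (y, y)) (0, i)"
      have "smooth_on (\<psi> ` M) (\<lambda>y. frechet_derivative ?Q (at (y, y)) (0, i))" for i
        by (rule smooth_on_compose[OF oM oVV _ smooth_on_derivative[OF Q] k]) (use M in auto)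
      moreover have "smooth_on (\<psi> ` M) (\<lambda>y. X (Z i) (inv_into V \<psi> y))" if "i \<in> Basis" for i
        by (rule smooth_on_subset[OF SF_smooth[OF VF_SF[OF X Z[OF that]] V(1)]]) (use M in blast)
      ultimately have R: "smooth_on (\<psi> ` M) ?R"
        by (intro smooth_on_sum smooth_on_mult oM) 
      have "?R y = h (inv_into V \<psi> y) \<bullet> b" if "y \<in> \<psi> ` M" for y
      proof -
        obtain p where p: "p \<in> M" "y = \<psi> p" using \<open>y \<in> \<psi> ` M\<close> by blast
        have pV: "p \<in> V" "inv_into V \<psi> y = p" using p M chart_inv_f[OF V(1)] by auto
        then have pc: "p \<in> carrier L" using chart_subset[OF V(1)] by blast
        have yV: "y \<in> \<psi> ` V" using p M by blast
        have tr: "translate L (inv p) (Y b) \<in> SF" using pc by (intro translate_SF Y b) auto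
        have "X (translate L (inv p) (Y b)) p = (\<Sum>i\<in>Basis. X (Z i) p *
            frechet_derivative (\<lambda>x. translate L (inv p) (Y b) (inv_into V \<psi> x)) (at (\<psi> p)) i)"
          by (rule point_derivation_expand[OF VF_point_derivation[OF X] V(1) M(1) p(1) M(3) Z ZM tr])
        also have "\<dots> = (\<Sum>i\<in>Basis. X (Z i) p * frechet_derivative ?Q (at (y, y)) (0, i))"
        proof (intro sum.cong refl arg_cong2[of _ _ _ _ "(*)"])
          fix i :: 'e
          have "frechet_derivative (\<lambda>x. translate L (inv p) (Y b) (inv_into V \<psi> x)) (at (\<psi> p)) =
              frechet_derivative (\<lambda>x. ?Q (y, x)) (at y)"
            unfolding p(2)[symmetric]
          proof (rule frechet_derivative_cong[OF chart_open[OF V(1)] yV])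
            show "translate L (inv p) (Y b) (inv_into V \<psi> x) = ?Q (y, x)" if "x \<in> \<psi> ` V" for x
              using chart_inv_carrier[OF V(1) that] pV by (simp add: translate_def)
            show "(\<lambda>x. translate L (inv p) (Y b) (inv_into V \<psi> x)) differentiable (at y)"
              by (rule smooth_on_differentiable[OF SF_smooth[OF tr V(1)] yV])
          qed
          then show "frechet_derivative (\<lambda>x. translate L (inv p) (Y b) (inv_into V \<psi> x)) (at (\<psi> p)) i =
              frechet_derivative ?Q (at (y, y)) (0, i)"
            using partial_derivative_snd(2)[OF Q, of y y i] yV by simp
        qed
        finally show ?thesis using hb[OF b, of p] pc pV by (simp add: H_def)
      qed
      then have "smooth_on (\<psi> ` M) (\<lambda>y. h (inv_into V \<psi> y) \<bullet> b)"
        by (rule smooth_on_cong[OF oM _ R])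
      then show "\<exists>V \<psi> M. (V, \<psi>) \<in> charts L \<and> openin (gtop L) M \<and> p0 \<in> M \<and> M \<subseteq> V \<and>
          smooth_on (\<psi> ` M) (\<lambda>x. h (inv_into V \<psi> x) \<bullet> b)"
        using V M by blast
    qed (simp add: h_def)
  next
    fix f p assume f: "f \<in> SF" and p: "p \<in> carrier L"
    have ip: "inv p \<in> carrier L" using p by simp
    define \<delta> where "\<delta> k = X (translate L (inv p) k) p" for k
    have "point_derivation \<one> \<delta>"
    proof -
      have pd: "point_derivation p (\<lambda>f. X f p)" by (rule VF_point_derivation[OF X])
      have t: "translate L (inv p) (\<lambda>q. k q + l q) = (\<lambda>q. translate L (inv p) k q + translate L (inv p) l q)"
        "translate L (inv p) (\<lambda>q. k q * l q) = (\<lambda>q. translate L (inv p) k q * translate L (inv p) l q)"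
        "translate L (inv p) (\<lambda>q. c * k q) = (\<lambda>q. c * translate L (inv p) k q)" for k l c
        by (auto simp: translate_def)
      have tp: "translate L (inv p) k p = k \<one>" for k using p by (simp add: translate_def)
      show ?thesis
        unfolding point_derivation_def
      proof (intro conjI ballI allI)
        fix k l assume kl: "k \<in> SF" "l \<in> SF"
        note tr = translate_SF[OF kl(1) ip] translate_SF[OF kl(2) ip]
        show "\<delta> (\<lambda>q. k q + l q) = \<delta> k + \<delta> l"
          unfolding \<delta>_def t(1) by (rule point_derivation_add[OF pd tr])
        show "\<delta> (\<lambda>q. k q * l q) = k \<one> * \<delta> l + l \<one> * \<delta> k"
          using point_derivation_mult[OF pd tr] unfolding \<delta>_def t(2) tp .
      next
        fix c k assume k: "k \<in> SF"
        show "\<delta> (\<lambda>q. c * k q) = c * \<delta> k"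
          unfolding \<delta>_def t(3) by (rule point_derivation_cmult[OF pd translate_SF[OF k ip]])
      qed
    qed
    from point_derivation_expand[OF this U_chart N Y YN translate_SF[OF f p]]
    have "\<delta> (translate L p f) = (\<Sum>b\<in>Basis. \<delta> (Y b) * linv b (translate L p f) \<one>)"
      by (simp add: linv_one[OF translate_SF[OF f p]])
    also have "\<dots> = linv (h p) f p"
      unfolding linv_sum[of "h p"] linv_translate[OF f p] using hb p by (simp add: H_def \<delta>_def)
    finally show "X f p = linv (h p) f p" by (simp add: \<delta>_def translate_inv[OF p])
  qed
qed

text \<open>Every field is a combination of the frame with smooth coefficients. Hence identities that are
  linear over the smooth functions need only be verified on the frame.\<close>

lemma vector_field_induct [consumes 1, case_names frame add mult]:
  assumes X: "X \<in> VF" and frame: "\<And>b. b \<in> Basis \<Longrightarrow> P (linv b)"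
    and add: "\<And>X Y. X \<in> VF \<Longrightarrow> Y \<in> VF \<Longrightarrow> P X \<Longrightarrow> P Y \<Longrightarrow> P (vf_add X Y)"
    and mult: "\<And>h X. h \<in> SF \<Longrightarrow> X \<in> VF \<Longrightarrow> P X \<Longrightarrow> P (vf_mult h X)"
  shows "P X"
proof (rule vector_field_expand[OF X])
  fix h :: "'a \<Rightarrow> 'e"
  assume h: "\<And>b. b \<in> Basis \<Longrightarrow> (\<lambda>p. h p \<bullet> b) \<in> SF"
    "\<And>f p. f \<in> SF \<Longrightarrow> p \<in> carrier L \<Longrightarrow> X f p = linv (h p) f p"
  let ?S = "\<lambda>B f p. \<Sum>b\<in>B. (h p \<bullet> b) * linv b f p"
  have S: "P (?S B) \<and> ?S B \<in> VF" if "finite B" "B \<subseteq> Basis" for B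
    using that
  proof (induction B rule: finite_induct)
    case empty
    obtain b :: 'e where b: "b \<in> Basis" using nonempty_Basis by blast
    have "?S {} = vf_mult (\<lambda>p. 0) (linv b)" by (simp add: vf_mult_def)
    then show ?case using mult[OF SF_zero_fn linv_VF frame[OF b]] vf_mult_VF[OF SF_zero_fn linv_VF] by simp
  next
    case (insert b B)
    have "?S (insert b B) = vf_add (vf_mult (\<lambda>p. h p \<bullet> b) (linv b)) (?S B)"
      using insert by (simp add: vf_add_def vf_mult_def)
    moreover have b: "b \<in> Basis" and IH: "P (?S B)" "?S B \<in> VF" using insert by auto
    moreover have "vf_mult (\<lambda>p. h p \<bullet> b) (linv b) \<in> VF" by (rule vf_mult_VF[OF h(1)[OF b] linv_VF])
    moreover have "P (vf_mult (\<lambda>p. h p \<bullet> b) (linv b))" by (rule mult[OF h(1)[OF b] linv_VF frame[OF b]])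
    ultimately show ?case using add vf_add_VF by simp
  qed
  have "X = ?S Basis"
    by (rule VF_eqI[OF X]) (use S[of Basis] h(2) linv_sum[symmetric] in simp_all)
  then show "P X" using S[of Basis] by simp
qed

abbreviation "LA \<equiv> lie_algebra L"

lemma LA_VF: "X \<in> LA \<Longrightarrow> X \<in> VF"
  by (simp add: lie_algebra_def)

lemma translate_not_SF: "f \<notin> SF \<Longrightarrow> a \<in> carrier L \<Longrightarrow> translate L a f \<notin> SF"
  using translate_SF[of "translate L a f" "inv a"] translate_inv(2)[of a f] by auto

lemma linv_LA: "linv v \<in> LA"
  unfolding lie_algebra_def
proof (intro CollectI conjI ballI linv_VF ext)
  fix a f p assume a: "a \<in> carrier L"
  show "push L a (linv v) f p = linv v f p"
  proof (cases "f \<in> SF \<and> p \<in> carrier L")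
    case True
    have tr: "translate L a f \<in> SF" using True a translate_SF by blast
    have "push L a (linv v) f p = linv v (translate L a f) (inv a \<otimes> p)"
      using True by (simp add: push_def translate_def)
    also have "\<dots> = linv v (translate L (inv a \<otimes> p) (translate L a f)) \<one>"
      using True a by (subst linv_translate[OF tr]) auto
    also have "translate L (inv a \<otimes> p) (translate L a f) = translate L p f"
      using True a by (simp add: translate_translate m_assoc[symmetric])
    also have "linv v \<dots> \<one> = linv v f p" using True by (intro linv_translate) auto
    finally show ?thesis .
  next
    case False
    then show ?thesis
      using a translate_not_SF[of f a] VF_zero[OF linv_VF] VF_not_SF[OF linv_VF]
      by (auto simp: push_def translate_def)
  qed
qed

lemma LA_translate:
  assumes "X \<in> LA" "a \<in> carrier L"
  shows "X (translate L a f) = translate L a (X f)"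
proof -
  have "push L a X f = X f" using assms by (simp add: lie_algebra_def)
  then have "translate L a (translate L (inv a) (X (translate L a f))) = translate L a (X f)"
    by (simp add: push_def)
  then show ?thesis using assms by (simp add: translate_inv)
qed

text \<open>A left invariant field is determined by its value at the unit.\<close>

lemma LA_eq_linv:
  assumes X: "X \<in> LA" obtains v where "X = linv v"
proof (rule vector_field_expand[OF LA_VF[OF X]])
  fix h assume h: "\<And>f p. f \<in> SF \<Longrightarrow> p \<in> carrier L \<Longrightarrow> X f p = linv (h p) f p"
  have "X = linv (h \<one>)"
  proof (rule VF_eqI[OF LA_VF[OF X] linv_VF])
    fix f p assume fp: "f \<in> SF" "p \<in> carrier L"
    have "X f p = translate L p (X f) \<one>" using fp by (simp add: translate_def)
    also have "\<dots> = X (translate L p f) \<one>" using LA_translate[OF X fp(2)] by simp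
    also have "\<dots> = linv (h \<one>) (translate L p f) \<one>" using fp by (intro h translate_SF) auto
    also have "\<dots> = linv (h \<one>) f p" by (rule linv_translate[OF fp])
    finally show "X f p = linv (h \<one>) f p" .
  qed
  then show thesis using that by blast
qed

lemma LA_range: "LA = range linv"
  using linv_LA LA_eq_linv by blast

lemma lie_bracket_LA:
  assumes "X \<in> LA" "Y \<in> LA" shows "lie_bracket X Y \<in> LA"
  unfolding lie_algebra_def
proof (intro CollectI conjI ballI lie_bracket_VF LA_VF assms)
  fix a assume a: "a \<in> carrier L"
  have "lie_bracket X Y (translate L a f) = translate L a (lie_bracket X Y f)" for f
    unfolding lie_bracket_def LA_translate[OF assms(1) a] LA_translate[OF assms(2) a]
    by (auto simp: translate_def)
  then show "push L a (lie_bracket X Y) = lie_bracket X Y"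
    by (intro ext) (simp add: push_def translate_inv[OF a])
qed

definition br :: "'e \<Rightarrow> 'e \<Rightarrow> 'e" where
  "br v w = (THE u. linv u = lie_bracket (linv v) (linv w))"

lemma linv_br: "linv (br v w) = lie_bracket (linv v) (linv w)"
proof -
  obtain u where u: "lie_bracket (linv v) (linv w) = linv u"
    using LA_eq_linv[OF lie_bracket_LA[OF linv_LA linv_LA]] by blast
  have "br v w = u" unfolding br_def
    by (rule the_equality) (use u linv_inj in auto)
  then show ?thesis using u by simp
qed

lemma linv_add: "linv (v + w) = vf_add (linv v) (linv w)"
  by (auto simp: vf_add_def fun_eq_iff linear_add[OF linv_linear])

lemma linv_scale: "linv (c *\<^sub>R v) = vf_mult (\<lambda>_. c) (linv v)"
  by (auto simp: vf_mult_def fun_eq_iff linear_scale[OF linv_linear])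

lemma br_antisym: "br v w = - br w v"
proof (rule linv_inj)
  have "linv (- br w v) = linv ((-1) *\<^sub>R br w v)" by simp
  then show "linv (br v w) = linv (- br w v)"
    by (simp only: linv_scale linv_br) (simp add: lie_bracket_def vf_mult_def fun_eq_iff)
qed

lemma br_add_left: "br (u + v) w = br u w + br v w"
proof (rule linv_inj)
  have "linv w (vf_add (linv u) (linv v) f) p = linv w (linv u f) p + linv w (linv v f) p" for f p
  proof (cases "f \<in> SF")
    case True
    then show ?thesis
      using VF_add[OF linv_VF[of w] VF_SF[OF linv_VF[of u] True] VF_SF[OF linv_VF[of v] True]]
      by (simp add: vf_add_def)
  next
    case False
    then have "linv x f = (\<lambda>p. 0)" for x using VF_not_SF[OF linv_VF] by blast
    then show ?thesis
      using VF_cmult[OF linv_VF[of w] SF_zero_fn, of 0] by (simp add: vf_add_def)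
  qed
  then show "linv (br (u + v) w) = linv (br u w + br v w)"
    by (simp add: linv_br linv_add fun_eq_iff lie_bracket_def) (simp add: vf_add_def)
qed

lemma br_scale_left: "br (c *\<^sub>R u) w = c *\<^sub>R br u w"
proof (rule linv_inj)
  have "linv w (vf_mult (\<lambda>_. c) (linv u) f) p = c * linv w (linv u f) p" for f p
  proof (cases "f \<in> SF")
    case True
    then show ?thesis
      using VF_cmult[OF linv_VF[of w] VF_SF[OF linv_VF[of u] True], of c]
      by (simp add: vf_mult_def)
  next
    case False
    then have "linv x f = (\<lambda>p. 0)" for x using VF_not_SF[OF linv_VF] by blast
    then show ?thesis
      using VF_cmult[OF linv_VF[of w] SF_zero_fn, of 0] by (simp add: vf_mult_def)
  qed
  then show "linv (br (c *\<^sub>R u) w) = linv (c *\<^sub>R br u w)"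
    by (simp add: linv_br linv_scale fun_eq_iff lie_bracket_def) (simp add: vf_mult_def algebra_simps)
qed

lemma br_linear_left: "linear (\<lambda>v. br v w)"
  by (rule linearI) (simp_all add: br_add_left br_scale_left)

lemma br_linear_right: "linear (br v)"
proof -
  have "br v = (\<lambda>w. - br w v)" using br_antisym by blast
  then show ?thesis using linear_compose_neg[OF br_linear_left] by simp
qed

end

section \<open>Unimodular groups\<close>

locale unimodular_chart = lie_group_chart L U \<phi>
  for L :: "('a, 'e::euclidean_space) smooth_group" (structure) and U \<phi> +
  fixes \<mu> :: "'a measure"
  assumes haar: "left_haar_measure L \<mu>"
    and right_invariant: "\<And>a A. a \<in> carrier L \<Longrightarrow> A \<in> sets \<mu> \<Longrightarrow>
          emeasure \<mu> ((\<lambda>p. p \<otimes> a) ` A) = emeasure \<mu> A"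
begin

lemma space_\<mu>: "space \<mu> = carrier L"
  using haar by (simp add: left_haar_measure_def)

lemma sets_\<mu>: "sets \<mu> = sigma_sets (carrier L) {U. openin (gtop L) U}"
  using haar by (simp add: left_haar_measure_def)

lemma open_measurable: "openin (gtop L) W \<Longrightarrow> W \<in> sets \<mu>"
  by (simp add: sets_\<mu> sigma_sets.Basic)

lemma compact_measurable: "compactin (gtop L) K \<Longrightarrow> K \<in> sets \<mu>"
proof -
  assume K: "compactin (gtop L) K"
  then have "openin (gtop L) (carrier L - K)"
    using compactin_imp_closedin[OF Hausdorff K] topspace_gtop by (simp add: closedin_def)
  then have "space \<mu> - (carrier L - K) \<in> sets \<mu>"
    by (intro sets.compl_sets open_measurable)
  moreover have "K \<subseteq> carrier L" using compactin_subset_topspace[OF K] topspace_gtop by simp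
  ultimately show "K \<in> sets \<mu>" by (simp add: space_\<mu> double_diff)
qed

lemma compact_finite: "compactin (gtop L) K \<Longrightarrow> emeasure \<mu> K < \<infinity>"
  using haar by (simp add: left_haar_measure_def)

lemma SF_measurable:
  assumes "f \<in> SF" shows "f \<in> borel_measurable \<mu>"
proof (rule borel_measurableI)
  fix S :: "real set" assume "open S"
  then have "openin (gtop L) {p \<in> topspace (gtop L). f p \<in> S}"
    by (intro openin_continuous_map_preimage[OF SF_continuous[OF assms]]) simp
  moreover have "{p \<in> topspace (gtop L). f p \<in> S} = f -` S \<inter> space \<mu>"
    by (auto simp: topspace_gtop space_\<mu>)
  ultimately show "f -` S \<inter> space \<mu> \<in> sets \<mu>" using open_measurable by simp
qed

lemma continuous_measurable:
  assumes "continuous_map (gtop L) (gtop L) T" shows "T \<in> measurable \<mu> \<mu>"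
proof (rule measurable_sigma_sets[OF sets_\<mu>])
  show "{U. openin (gtop L) U} \<subseteq> Pow (carrier L)"
    using openin_subset topspace_gtop by fastforce
  show "T \<in> space \<mu> \<rightarrow> carrier L"
    using continuous_map_funspace[OF assms] by (simp add: topspace_gtop space_\<mu>)
  fix W assume "W \<in> {U. openin (gtop L) U}"
  then have "openin (gtop L) {p \<in> topspace (gtop L). T p \<in> W}"
    using openin_continuous_map_preimage[OF assms] by simp
  moreover have "{p \<in> topspace (gtop L). T p \<in> W} = T -` W \<inter> space \<mu>"
    by (auto simp: topspace_gtop space_\<mu>)
  ultimately show "T -` W \<inter> space \<mu> \<in> sets \<mu>" using open_measurable by simp
qed

lemma translation_continuous:
  assumes "a \<in> carrier L"
  shows "continuous_map (gtop L) (gtop L) (\<lambda>p. p \<otimes> a)" "continuous_map (gtop L) (gtop L) (\<lambda>p. a \<otimes> p)"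
proof -
  have "continuous_map (gtop L) (prod_topology (gtop L) (gtop L)) (\<lambda>p. (p, a))"
    "continuous_map (gtop L) (prod_topology (gtop L) (gtop L)) (\<lambda>p. (a, p))"
    using assms by (auto simp: continuous_map_pairwise o_def topspace_gtop)
  from this[THEN continuous_map_compose, OF continuous_mult]
  show "continuous_map (gtop L) (gtop L) (\<lambda>p. p \<otimes> a)" "continuous_map (gtop L) (gtop L) (\<lambda>p. a \<otimes> p)"
    by (simp_all add: o_def)
qed

lemma distr_translation:
  assumes a: "a \<in> carrier L"
  shows "distr \<mu> \<mu> (\<lambda>p. p \<otimes> a) = \<mu>" "distr \<mu> \<mu> (\<lambda>p. a \<otimes> p) = \<mu>"
proof -
  have sub: "A \<subseteq> carrier L" if "A \<in> sets \<mu>" for A using sets.sets_into_space[OF that] space_\<mu> by simp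
  have r: "(\<lambda>p. p \<otimes> a) -` A \<inter> space \<mu> = (\<lambda>p. p \<otimes> inv a) ` A" if A: "A \<in> sets \<mu>" for A
  proof (intro equalityI subsetI)
    fix p assume p: "p \<in> (\<lambda>p. p \<otimes> a) -` A \<inter> space \<mu>"
    then have "p = (p \<otimes> a) \<otimes> inv a" using a by (simp add: space_\<mu> m_assoc)
    then show "p \<in> (\<lambda>p. p \<otimes> inv a) ` A" using p by blast
  qed (use a sub[OF A] in \<open>auto simp: space_\<mu> m_assoc subset_iff\<close>)
  have l: "(\<lambda>p. a \<otimes> p) -` A \<inter> space \<mu> = (\<lambda>p. inv a \<otimes> p) ` A" if A: "A \<in> sets \<mu>" for A
  proof (intro equalityI subsetI)
    fix p assume p: "p \<in> (\<lambda>p. a \<otimes> p) -` A \<inter> space \<mu>"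
    then have "p = inv a \<otimes> (a \<otimes> p)" using a by (simp add: space_\<mu> m_assoc[symmetric])
    then show "p \<in> (\<lambda>p. inv a \<otimes> p) ` A" using p by blast
  qed (use a sub[OF A] in \<open>auto simp: space_\<mu> m_assoc[symmetric] subset_iff\<close>)
  show "distr \<mu> \<mu> (\<lambda>p. p \<otimes> a) = \<mu>"
  proof (rule measure_eqI)
    fix A assume "A \<in> sets (distr \<mu> \<mu> (\<lambda>p. p \<otimes> a))"
    then have A: "A \<in> sets \<mu>" by simp
    show "emeasure (distr \<mu> \<mu> (\<lambda>p. p \<otimes> a)) A = emeasure \<mu> A"
      using emeasure_distr[OF continuous_measurable[OF translation_continuous(1)[OF a]] A]
        right_invariant[OF inv_closed[OF a] A] by (simp only: r[OF A])
  qed simp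
  show "distr \<mu> \<mu> (\<lambda>p. a \<otimes> p) = \<mu>"
  proof (rule measure_eqI)
    fix A assume "A \<in> sets (distr \<mu> \<mu> (\<lambda>p. a \<otimes> p))"
    then have A: "A \<in> sets \<mu>" by simp
    have "emeasure \<mu> ((\<lambda>p. inv a \<otimes> p) ` A) = emeasure \<mu> A"
      using haar inv_closed[OF a] A unfolding left_haar_measure_def by blast
    then show "emeasure (distr \<mu> \<mu> (\<lambda>p. a \<otimes> p)) A = emeasure \<mu> A"
      using emeasure_distr[OF continuous_measurable[OF translation_continuous(2)[OF a]] A]
      by (simp only: l[OF A])
  qed simp
qed

lemma compactly_supported_bounded:
  assumes f: "f \<in> SF" and K: "compactin (gtop L) K" "\<And>p. p \<notin> K \<Longrightarrow> f p = 0"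
  obtains C where "\<And>p. \<bar>f p\<bar> \<le> C"
proof -
  have "compact (f ` K)"
    using image_compactin[OF K(1) SF_continuous[OF f]] by simp
  then obtain C where C: "\<And>y. y \<in> f ` K \<Longrightarrow> \<bar>y\<bar> \<le> C"
    using compact_imp_bounded bounded_real by metis
  have "\<bar>f p\<bar> \<le> max C 0" for p
    by (cases "p \<in> K") (use C K(2) in \<open>auto simp: le_max_iff_disj\<close>)
  then show thesis using that by blast
qed

lemma integrable_compact_support:
  assumes "f \<in> borel_measurable \<mu>" "compactin (gtop L) K" "\<And>p. p \<in> carrier L \<Longrightarrow> p \<notin> K \<Longrightarrow> f p = 0"
    "\<And>p. \<bar>f p\<bar> \<le> (C::real)"
  shows "integrable \<mu> f"
proof (rule Bochner_Integration.integrable_bound)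
  show "integrable \<mu> (\<lambda>p. C * indicator K p)"
    using compact_measurable[OF assms(2)] compact_finite[OF assms(2)] by simp
  show "AE p in \<mu>. norm (f p) \<le> norm (C * indicator K p)"
  proof (rule AE_I2)
    fix p assume "p \<in> space \<mu>"
    then show "norm (f p) \<le> norm (C * indicator K p)"
      using assms(3)[of p] assms(4)[of p] by (cases "p \<in> K") (auto simp: space_\<mu>)
  qed
qed (use assms in auto)

text \<open>Directional derivatives along the flow are bounded on compact sets: they are continuous in a
  chart, and a compact set is covered by finitely many charts.\<close>

lemma flow_derivative_bounded:
  assumes fl: "smooth_flow \<Theta> S x0" and f: "f \<in> SF" and K: "compactin (gtop L) K" and r: "cball x0 r \<subseteq> S"
  obtains M where "\<And>p x. p \<in> K \<Longrightarrow> x \<in> cball x0 r \<Longrightarrow>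
    \<bar>frechet_derivative (\<lambda>x. f (\<Theta> p x)) (at x) v\<bar> \<le> M"
proof -
  let ?D = "\<lambda>p x. frechet_derivative (\<lambda>x. f (\<Theta> p x)) (at x) v"
  define \<N> where "\<N> = {N. openin (gtop L) N \<and> (\<exists>M. \<forall>p\<in>N. \<forall>x\<in>cball x0 r. \<bar>?D p x\<bar> \<le> M)}"
  have "\<exists>N\<in>\<N>. p0 \<in> N" if p0: "p0 \<in> K" for p0
  proof -
    have "p0 \<in> carrier L" using p0 compactin_subset_topspace[OF K] topspace_gtop by auto
    then obtain V \<psi> where V: "(V, \<psi>) \<in> charts L" "p0 \<in> V" using chart_exists by blast
    obtain s where s: "s > 0" "cball (\<psi> p0) s \<subseteq> \<psi> ` V"
      using chart_open[OF V(1)] V(2) open_contains_cball by blast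
    let ?Q = "\<lambda>(y, x). f (\<Theta> (inv_into V \<psi> y) x)"
    have Q: "smooth_on (\<psi> ` V \<times> S) ?Q" by (rule smooth_flow_joint[OF fl f V(1)])
    define G where "G z = frechet_derivative ?Q (at z) (0, v)" for z
    have "continuous_on (\<psi> ` V \<times> S) G"
      unfolding G_def by (rule smooth_on_continuous_on[OF smooth_on_derivative[OF Q]])
    then have "continuous_on (cball (\<psi> p0) s \<times> cball x0 r) G"
      by (rule continuous_on_subset) (rule Sigma_mono[OF s(2) r])
    then have "bounded (G ` (cball (\<psi> p0) s \<times> cball x0 r))"
      by (intro compact_imp_bounded compact_continuous_image compact_Times compact_cball)
    then obtain M where "\<forall>y\<in>G ` (cball (\<psi> p0) s \<times> cball x0 r). \<bar>y\<bar> \<le> M"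
      unfolding bounded_real by blast
    then have M: "\<bar>G z\<bar> \<le> M" if "z \<in> cball (\<psi> p0) s \<times> cball x0 r" for z
      using that by blast
    have "\<bar>?D p x\<bar> \<le> M" if p: "p \<in> V" "\<psi> p \<in> ball (\<psi> p0) s" and x: "x \<in> cball x0 r" for p x
    proof -
      have "frechet_derivative (\<lambda>x. ?Q (\<psi> p, x)) (at x) v = frechet_derivative ?Q (at (\<psi> p, x)) (0, v)"
        by (rule partial_derivative_snd(2)[OF Q]) (use p x r in auto)
      then show ?thesis
        using M[of "(\<psi> p, x)"] p x by (simp add: chart_inv_f[OF V(1) p(1)] G_def)
    qed
    then have "{q \<in> V. \<psi> q \<in> ball (\<psi> p0) s} \<in> \<N>"
      unfolding \<N>_def using chart_preimage_openin[OF V(1) open_ball] by blast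
    then show ?thesis using V(2) s(1) by (intro bexI) auto
  qed
  then have "K \<subseteq> \<Union>\<N>" by blast
  moreover have "\<forall>N\<in>\<N>. openin (gtop L) N" by (simp add: \<N>_def)
  ultimately obtain \<F> where F: "finite \<F>" "\<F> \<subseteq> \<N>" "K \<subseteq> \<Union>\<F>"
    using K unfolding compactin_def by meson
  have "\<forall>N\<in>\<F>. \<exists>M. \<forall>p\<in>N. \<forall>x\<in>cball x0 r. \<bar>?D p x\<bar> \<le> M" using F(2) by (auto simp: \<N>_def)
  then obtain M where M: "\<And>N p x. N \<in> \<F> \<Longrightarrow> p \<in> N \<Longrightarrow> x \<in> cball x0 r \<Longrightarrow> \<bar>?D p x\<bar> \<le> M N"
    by metis
  show thesis
  proof (rule that[of "\<Sum>N\<in>\<F>. \<bar>M N\<bar>"])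
    fix p x assume p: "p \<in> K" and x: "x \<in> cball x0 r"
    then obtain N where N: "N \<in> \<F>" "p \<in> N" using F(3) by blast
    have "\<bar>?D p x\<bar> \<le> \<bar>M N\<bar>" using M[OF N x] by linarith
    also have "\<dots> \<le> (\<Sum>N\<in>\<F>. \<bar>M N\<bar>)" by (rule member_le_sum[OF N(1)]) (use F(1) in auto)
    finally show "\<bar>?D p x\<bar> \<le> (\<Sum>N\<in>\<F>. \<bar>M N\<bar>)" .
  qed
qed

text \<open>The integral of \<open>f\<close> composed with a measure preserving map does not depend on the map;
  differentiating under the integral sign gives integral zero for the derivative.\<close>

lemma flow_field_integral_zero:
  assumes fl: "smooth_flow \<Theta> S x0" and f: "f \<in> SF" and K: "compactin (gtop L) K" "\<And>p. p \<notin> K \<Longrightarrow> f p = 0"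
    and cont: "\<And>x. x \<in> S \<Longrightarrow> continuous_map (gtop L) (gtop L) (\<lambda>p. \<Theta> p x)"
    and inv: "\<And>x. x \<in> S \<Longrightarrow> distr \<mu> \<mu> (\<lambda>p. \<Theta> p x) = \<mu>"
    and r: "r > 0" "cball x0 r \<subseteq> S" and K': "compactin (gtop L) K'"
    and supp: "\<And>p x. p \<in> carrier L \<Longrightarrow> x \<in> cball x0 r \<Longrightarrow> \<Theta> p x \<in> K \<Longrightarrow> p \<in> K'"
  shows "integrable \<mu> (flow_field \<Theta> x0 v f)" "integral\<^sup>L \<mu> (flow_field \<Theta> x0 v f) = 0"
proof -
  obtain C where C: "\<And>p. \<bar>f p\<bar> \<le> C" using compactly_supported_bounded[OF f K] by blast
  obtain M where M: "\<And>p x. p \<in> K' \<Longrightarrow> x \<in> cball x0 r \<Longrightarrow>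
      \<bar>frechet_derivative (\<lambda>x. f (\<Theta> p x)) (at x) v\<bar> \<le> M"
    using flow_derivative_bounded[OF fl f K' r(2)] by blast
  \<comment> \<open>For \<open>0 \<le> t \<le> \<delta>\<close> the point \<open>x0 + t v\<close> stays in the ball on which supports and derivatives are
    controlled.\<close>
  define \<delta> where "\<delta> = r / (norm v + 1)"
  have np: "norm v + 1 > 0" by (simp add: add_nonneg_pos)
  have \<delta>: "\<delta> > 0" using r np by (simp add: \<delta>_def)
  have seg: "x0 + t *\<^sub>R v \<in> cball x0 r" if "0 \<le> t" "t \<le> \<delta>" for t
  proof -
    have "norm (t *\<^sub>R v) \<le> \<delta> * norm v" using that by (simp add: mult_right_mono)
    also have "\<dots> \<le> \<delta> * (norm v + 1)" using \<delta> by (intro mult_left_mono) auto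
    also have "\<dots> = r" using np by (simp add: \<delta>_def)
    finally show ?thesis by (simp add: dist_norm)
  qed
  define t where "t n = \<delta> / (real n + 1)" for n :: nat
  have t: "0 < t n" "t n \<le> \<delta>" for n using \<delta> by (auto simp: t_def field_simps)
  have t0: "t \<longlonglongrightarrow> 0"
    unfolding t_def using tendsto_mult_right[OF LIMSEQ_inverse_real_of_nat, of \<delta>]
    by (simp add: field_simps)
  have id: "\<Theta> p x0 = p" if "p \<in> carrier L" for p using fl that by (simp add: smooth_flow_def)
  define s where "s n p = (f (\<Theta> p (x0 + t n *\<^sub>R v)) - f p) / t n" for n p
  have off: "f (\<Theta> p x) = 0" if "p \<in> carrier L" "p \<notin> K'" "x \<in> cball x0 r" for p x
    using supp[OF that(1,3)] that(2) K(2) by blast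
  have along: "((\<lambda>u. f (\<Theta> p (x0 + u *\<^sub>R v))) has_real_derivative
      frechet_derivative (\<lambda>x. f (\<Theta> p x)) (at (x0 + u *\<^sub>R v)) v) (at u)"
    if p: "p \<in> carrier L" and u: "0 \<le> u" "u \<le> \<delta>" for p u
  proof -
    have *: "((\<lambda>x. f (\<Theta> p x)) has_derivative frechet_derivative (\<lambda>x. f (\<Theta> p x)) (at (x0 + u *\<^sub>R v)))
        (at (x0 + u *\<^sub>R v))"
      by (rule smooth_on_has_derivative[OF smooth_flow_slice[OF fl f p]]) (use seg[OF u] r in blast)
    have "((\<lambda>u. x0 + u *\<^sub>R v) has_derivative (\<lambda>s. s *\<^sub>R v)) (at u)"
      by (auto intro!: derivative_eq_intros)
    from has_derivative_compose[OF this *] has_derivative_linear[OF *]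
    show ?thesis by (simp add: has_field_derivative_def linear_scale mult_commute_abs)
  qed
  have meas: "(\<lambda>p. f (\<Theta> p x)) \<in> borel_measurable \<mu>" if "x \<in> S" for x
    using measurable_compose[OF continuous_measurable[OF cont[OF that]] SF_measurable[OF f]] .
  have int: "integrable \<mu> (\<lambda>p. f (\<Theta> p x))" if "x \<in> cball x0 r" for x
    by (rule integrable_compact_support[OF meas K' off C]) (use that r in auto)
  have intf: "integrable \<mu> f"
    by (rule integrable_compact_support[OF SF_measurable[OF f] K(1) K(2) C])
  have s_zero: "integral\<^sup>L \<mu> (s n) = 0" for n
  proof -
    have x: "x0 + t n *\<^sub>R v \<in> cball x0 r" using t[of n] by (intro seg) auto
    then have xS: "x0 + t n *\<^sub>R v \<in> S" using r by blast
    have "integral\<^sup>L \<mu> (\<lambda>p. f (\<Theta> p (x0 + t n *\<^sub>R v))) = integral\<^sup>L \<mu> f"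
      using integral_distr[OF continuous_measurable[OF cont[OF xS]] SF_measurable[OF f]] inv[OF xS] by simp
    then show ?thesis
      unfolding s_def using int[OF x] intf by simp
  qed
  have bound: "\<bar>s n p\<bar> \<le> M * indicator K' p" if p: "p \<in> carrier L" for n p
  proof (cases "p \<in> K'")
    case True
    have "\<exists>u>0. u < t n \<and> f (\<Theta> p (x0 + t n *\<^sub>R v)) - f (\<Theta> p (x0 + 0 *\<^sub>R v)) =
        (t n - 0) * frechet_derivative (\<lambda>x. f (\<Theta> p x)) (at (x0 + u *\<^sub>R v)) v"
      by (rule MVT2[OF t(1)]) (use t[of n] in \<open>auto intro!: along p\<close>)
    then obtain u where u: "0 < u" "u < t n" and
      eq: "s n p = frechet_derivative (\<lambda>x. f (\<Theta> p x)) (at (x0 + u *\<^sub>R v)) v"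
      using t[of n] id[OF p] by (auto simp: s_def)
    show ?thesis
      unfolding eq using M[OF True seg[of u]] u t[of n] True by simp
  next
    case False
    then show ?thesis
      using off[OF p False seg[of "t n"]] off[OF p False seg[of 0]] t[of n] \<delta> id[OF p] by (simp add: s_def)
  qed
  have lim: "(\<lambda>n. s n p) \<longlonglongrightarrow> flow_field \<Theta> x0 v f p" if p: "p \<in> carrier L" for p
  proof -
    have "((\<lambda>h. (f (\<Theta> p (x0 + (0 + h) *\<^sub>R v)) - f (\<Theta> p (x0 + 0 *\<^sub>R v))) / h) \<longlongrightarrow>
        frechet_derivative (\<lambda>x. f (\<Theta> p x)) (at (x0 + 0 *\<^sub>R v)) v) (at 0)"
      using along[OF p, of 0] \<delta> unfolding DERIV_def by simp
    moreover have "filterlim t (at 0) sequentially"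
      using t0 t(1) by (simp add: filterlim_at less_imp_neq[symmetric])
    ultimately show ?thesis
      using filterlim_compose[of _ _ "at 0" t] p f id[OF p] unfolding s_def flow_field_def
      by (fastforce simp: o_def)
  qed
  have w: "integrable \<mu> (\<lambda>p. M * indicator K' p)"
    using compact_measurable[OF K'] compact_finite[OF K'] by simp
  have sm: "s n \<in> borel_measurable \<mu>" for n
  proof -
    have "x0 + t n *\<^sub>R v \<in> S" using seg[of "t n"] t[of n] r by auto
    then show ?thesis unfolding s_def using meas SF_measurable[OF f] by (intro borel_measurable_divide borel_measurable_diff) auto
  qed
  have fm: "flow_field \<Theta> x0 v f \<in> borel_measurable \<mu>"
    by (rule SF_measurable[OF VF_SF[OF flow_field_VF[OF fl] f]])
  have AEs: "AE p in \<mu>. (\<lambda>n. s n p) \<longlonglongrightarrow> flow_field \<Theta> x0 v f p"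
    "AE p in \<mu>. norm (s n p) \<le> M * indicator K' p" for n
    using lim bound by (auto simp: space_\<mu> intro!: AE_I2)
  show "integrable \<mu> (flow_field \<Theta> x0 v f)"
    by (rule integrable_dominated_convergence[OF fm sm w AEs])
  have "(\<lambda>n. integral\<^sup>L \<mu> (s n)) \<longlonglongrightarrow> integral\<^sup>L \<mu> (flow_field \<Theta> x0 v f)"
    by (rule integral_dominated_convergence[OF fm sm w AEs])
  then show "integral\<^sup>L \<mu> (flow_field \<Theta> x0 v f) = 0"
    using s_zero LIMSEQ_unique[OF _ tendsto_const[of 0]] by simp
qed

lemma small_compact_ball:
  obtains r where "r > 0" "cball (\<phi> \<one>) r \<subseteq> \<phi> ` U" "compactin (gtop L) (\<gamma> ` cball (\<phi> \<one>) r)"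
proof -
  obtain r where r: "r > 0" "cball (\<phi> \<one>) r \<subseteq> \<phi> ` U"
    using open_image one_U open_contains_cball by blast
  have "compactin (top_of_set (\<phi> ` U)) (cball (\<phi> \<one>) r)"
    using r by (auto simp: compactin_subtopology)
  then show thesis
    using that[OF r] image_compactin[OF _ chart_inv_continuous[OF U_chart]] by blast
qed

lemma product_compact:
  assumes "compactin (gtop L) A" "compactin (gtop L) B"
  shows "compactin (gtop L) ((\<lambda>(p, q). p \<otimes> q) ` (A \<times> B))"
  by (rule image_compactin[OF _ continuous_mult]) (simp add: compactin_Times assms)

lemma inv_compact: "compactin (gtop L) A \<Longrightarrow> compactin (gtop L) ((\<lambda>p. inv p) ` A)"
  by (rule image_compactin[OF _ continuous_inverse])

text \<open>Left invariant fields are velocities of right translations and vice versa, so that each of the two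
  invariances of the measure is used. If \<open>f\<close> is supported in \<open>K\<close>, the translates of \<open>f\<close> by the points of a
  compact set \<open>C\<close> are supported in \<open>K C\<^sup>-\<^sup>1\<close> or \<open>C\<^sup>-\<^sup>1 K\<close>.\<close>

lemma invariant_field_integral_zero:
  assumes f: "f \<in> SF" and K: "compactin (gtop L) K" "\<And>p. p \<notin> K \<Longrightarrow> f p = 0"
  shows "integrable \<mu> (linv v f)" "integral\<^sup>L \<mu> (linv v f) = 0"
    and "integrable \<mu> (rinv v f)" "integral\<^sup>L \<mu> (rinv v f) = 0"
proof -
  obtain r where r: "r > 0" "cball (\<phi> \<one>) r \<subseteq> \<phi> ` U" and B: "compactin (gtop L) (\<gamma> ` cball (\<phi> \<one>) r)"
    using small_compact_ball .
  have g: "\<gamma> x \<in> carrier L" if "x \<in> \<phi> ` U" for x by (rule \<gamma>_carrier[OF that])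
  let ?K1 = "(\<lambda>(p, q). p \<otimes> q) ` (K \<times> (\<lambda>p. inv p) ` \<gamma> ` cball (\<phi> \<one>) r)"
  have K1: "p \<in> ?K1" if p: "p \<in> carrier L" and x: "x \<in> cball (\<phi> \<one>) r" and k: "p \<otimes> \<gamma> x \<in> K" for p x
  proof -
    have "p = (p \<otimes> \<gamma> x) \<otimes> inv (\<gamma> x)" using p g[of x] x r by (auto simp: m_assoc)
    then show ?thesis using x k by (intro image_eqI[of _ _ "(p \<otimes> \<gamma> x, inv (\<gamma> x))"]) auto
  qed
  show "integrable \<mu> (linv v f)" "integral\<^sup>L \<mu> (linv v f) = 0"
    unfolding linv_def
    by (rule flow_field_integral_zero[OF left_flow f K(1) _ _ _ r product_compact[OF K(1) inv_compact[OF B]]];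
        use translation_continuous(1)[OF g] distr_translation(1)[OF g] K(2) K1 in blast)+
  let ?K2 = "(\<lambda>(p, q). p \<otimes> q) ` ((\<lambda>p. inv p) ` \<gamma> ` cball (\<phi> \<one>) r \<times> K)"
  have K2: "p \<in> ?K2" if p: "p \<in> carrier L" and x: "x \<in> cball (\<phi> \<one>) r" and k: "\<gamma> x \<otimes> p \<in> K" for p x
  proof -
    have "p = inv (\<gamma> x) \<otimes> (\<gamma> x \<otimes> p)" using p g[of x] x r by (auto simp: m_assoc[symmetric])
    then show ?thesis using x k by (intro image_eqI[of _ _ "(inv (\<gamma> x), \<gamma> x \<otimes> p)"]) auto
  qed
  show "integrable \<mu> (rinv v f)" "integral\<^sup>L \<mu> (rinv v f) = 0"
    unfolding rinv_def
    by (rule flow_field_integral_zero[OF right_flow f K(1) _ _ _ r product_compact[OF inv_compact[OF B] K(1)]];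
        use translation_continuous(2)[OF g] distr_translation(2)[OF g] K(2) K2 in blast)+
qed

text \<open>Left and right translations commute, and so do their velocity fields; at the unit this is the
  symmetry of the second derivatives of \<open>f (\<gamma> x \<otimes> \<gamma> y)\<close>.\<close>

lemma left_right_commute:
  assumes f: "f \<in> SF"
  shows "rinv v (linv w f) \<one> = linv w (rinv v f) \<one>"
proof -
  let ?x0 = "\<phi> \<one>" and ?W = "\<phi> ` U \<times> \<phi> ` U"
  let ?Q = "\<lambda>z. f (\<gamma> (fst z) \<otimes> \<gamma> (snd z))"
  have x0: "?x0 \<in> \<phi> ` U" using one_U by blast
  have Q: "smooth_on ?W ?Q"
    by (rule smooth_into_SF[OF smooth_into_mult f]) (rule smooth_into_fst_snd[OF U_chart U_chart])+
  have oW: "open ?W" using open_image by (intro open_Times)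
  have 1: "linv w f (\<gamma> x) = frechet_derivative ?Q (at (x, ?x0)) (0, w)" if x: "x \<in> \<phi> ` U" for x
    using partial_derivative_snd(2)[OF Q, of x ?x0 w] x x0 by (simp add: linv_eq[OF f \<gamma>_carrier[OF x]])
  have 2: "rinv v f (\<gamma> y) = frechet_derivative ?Q (at (?x0, y)) (v, 0)" if y: "y \<in> \<phi> ` U" for y
    using partial_derivative_fst[OF Q, of ?x0 y v] y x0 by (simp add: rinv_eq[OF f \<gamma>_carrier[OF y]])
  have lf: "linv w f \<in> SF" and rf: "rinv v f \<in> SF"
    using VF_SF[OF linv_VF f] VF_SF[OF rinv_VF f] by auto
  have "rinv v (linv w f) \<one> = frechet_derivative (\<lambda>x. frechet_derivative ?Q (at (x, ?x0)) (0, w)) (at ?x0) v"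
    unfolding linv_one(2)[OF lf]
    using frechet_derivative_cong[OF open_image x0 1 SF_chart_differentiable[OF lf]] by simp
  also have "\<dots> = frechet_derivative (\<lambda>z. frechet_derivative ?Q (at z) (0, w)) (at (?x0, ?x0)) (v, 0)"
    by (rule partial_derivative_fst[OF smooth_on_derivative[OF Q]]) (use x0 in simp)
  also have "\<dots> = frechet_derivative (\<lambda>z. frechet_derivative ?Q (at z) (v, 0)) (at (?x0, ?x0)) (0, w)"
    by (rule mixed_derivatives_commute[OF Q oW]) (use x0 in simp)
  also have "\<dots> = frechet_derivative (\<lambda>y. frechet_derivative ?Q (at (?x0, y)) (v, 0)) (at ?x0) w"
    by (rule partial_derivative_snd(2)[OF smooth_on_derivative[OF Q], symmetric]) (use x0 in simp)
  also have "\<dots> = linv w (rinv v f) \<one>"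
    unfolding linv_one(1)[OF rf]
    using frechet_derivative_cong[OF open_image x0 2 SF_chart_differentiable[OF rf]] by simp
  finally show ?thesis .
qed

text \<open>Write the right invariant field of \<open>v\<close> as \<open>\<Sum>b. A b * linv b\<close>. All fields \<open>linv b\<close> and this one
  have integral zero on compactly supported functions, so that integration by parts shows that
  \<open>\<Sum>b. linv b (A b)\<close> is orthogonal to all such functions and vanishes. As the field commutes with the left
  invariant ones, \<open>linv w (A b)\<close> at the unit is the coordinate \<open>b\<close> of the bracket of \<open>v\<close> and \<open>w\<close>.\<close>

lemma trace_bracket_zero: "(\<Sum>b\<in>Basis. br v b \<bullet> b) = 0"
proof (rule vector_field_expand[OF rinv_VF[of v]])
  fix h :: "'a \<Rightarrow> 'e"
  assume A: "\<And>b. b \<in> Basis \<Longrightarrow> (\<lambda>p. h p \<bullet> b) \<in> SF"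
    and h: "\<And>f p. f \<in> SF \<Longrightarrow> p \<in> carrier L \<Longrightarrow> rinv v f p = linv (h p) f p"
  define A where "A b = (\<lambda>p. h p \<bullet> b)" for b
  have A: "A b \<in> SF" if "b \<in> Basis" for b using A[OF that] by (simp add: A_def)
  have expand: "rinv v f = (\<lambda>p. \<Sum>b\<in>Basis. A b p * linv b f p)" if f: "f \<in> SF" for f
  proof
    fix p show "rinv v f p = (\<Sum>b\<in>Basis. A b p * linv b f p)"
    proof (cases "p \<in> carrier L")
      case True
      then show ?thesis using h[OF f True] linv_sum[of "h p" f p] by (simp add: A_def)
    qed (simp add: VF_zero[OF rinv_VF] VF_zero[OF linv_VF])
  qed
  define d where "d = (\<lambda>p. \<Sum>b\<in>Basis. linv b (A b) p)"
  have d: "d \<in> SF" unfolding d_def by (intro SF_sum VF_SF[OF linv_VF] A)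
  have orth: "integrable \<mu> (\<lambda>p. f p * d p) \<and> integral\<^sup>L \<mu> (\<lambda>p. f p * d p) = 0"
    if f: "f \<in> SF" and K: "compactin (gtop L) K" "\<And>p. p \<notin> K \<Longrightarrow> f p = 0" for f K
  proof -
    have Af: "(\<lambda>p. A b p * f p) \<in> SF" if "b \<in> Basis" for b using A[OF that] f by (rule SF_mult)
    have Lz: "integrable \<mu> (linv b (\<lambda>p. A b p * f p))" "integral\<^sup>L \<mu> (linv b (\<lambda>p. A b p * f p)) = 0"
      if "b \<in> Basis" for b
      by (rule invariant_field_integral_zero[OF Af[OF that] K(1)]; use K(2) in simp)+
    have "(\<Sum>b\<in>Basis. linv b (\<lambda>p. A b p * f p) p) = rinv v f p + f p * d p" for p
      unfolding expand[OF f] d_def sum_distrib_left sum.distrib[symmetric]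
      by (rule sum.cong[OF refl]) (simp add: VF_mult[OF linv_VF A f])
    then have eq: "(\<lambda>p. f p * d p) = (\<lambda>p. (\<Sum>b\<in>Basis. linv b (\<lambda>p. A b p * f p) p) - rinv v f p)"
      by (simp add: fun_eq_iff)
    have i1: "integrable \<mu> (\<lambda>p. \<Sum>b\<in>Basis. linv b (\<lambda>p. A b p * f p) p)"
      by (intro Bochner_Integration.integrable_sum Lz)
    have i2: "integrable \<mu> (rinv v f)" "integral\<^sup>L \<mu> (rinv v f) = 0"
      using invariant_field_integral_zero(3,4)[OF f K] by auto
    have "integral\<^sup>L \<mu> (\<lambda>p. \<Sum>b\<in>Basis. linv b (\<lambda>p. A b p * f p) p) = 0"
      using Lz by (subst Bochner_Integration.integral_sum) auto
    then show ?thesis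
      unfolding eq using i1 i2 by simp
  qed
  \<comment> \<open>Otherwise \<open>c d\<^sup>2\<close>, for a cutoff function \<open>c\<close> at the unit, would have a positive integral.\<close>
  have "d \<one> = 0"
  proof (rule ccontr)
    assume nz: "d \<one> \<noteq> 0"
    obtain c N K where c: "c \<in> SF" "openin (gtop L) N" "\<one> \<in> N" "\<And>q. q \<in> N \<Longrightarrow> c q = 1"
      "compactin (gtop L) K" "\<And>q. q \<notin> K \<Longrightarrow> c q = 0" "\<And>q. 0 \<le> c q"
    proof (rule extend_from_chart[OF U_chart one_U open_image _ order_refl smooth_on_const[of "\<phi> ` U" 1]])
      show "\<phi> \<one> \<in> \<phi> ` U" using one_U by blast
    qed auto
    have cd: "(\<lambda>p. c p * d p) \<in> SF" using c(1) d by (rule SF_mult)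
    have o: "integrable \<mu> (\<lambda>p. c p * d p * d p)" "integral\<^sup>L \<mu> (\<lambda>p. c p * d p * d p) = 0"
      using orth[OF cd c(5)] c(6) by auto
    have nn: "0 \<le> c p * d p * d p" for p using c(7)[of p] by (simp add: mult.assoc)
    have ae: "AE p in \<mu>. c p * d p * d p = 0"
      using integral_nonneg_eq_0_iff_AE[OF o(1)] nn o(2) by simp
    let ?W = "N \<inter> {p \<in> topspace (gtop L). d p \<in> - {0}}"
    have W: "openin (gtop L) ?W"
      by (intro openin_Int c openin_continuous_map_preimage[OF SF_continuous[OF d]]) auto
    have "AE p in \<mu>. p \<notin> ?W"
      using ae by (rule AE_mp) (auto simp: c(4) intro!: AE_I2)
    then have "emeasure \<mu> ?W = 0"
      using AE_iff_null_sets[OF open_measurable[OF W]] by (simp add: null_sets_def)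
    moreover have "?W \<noteq> {}" using c(3) nz topspace_gtop by auto
    then have "0 < emeasure \<mu> ?W"
      using haar W by (simp add: left_haar_measure_def)
    ultimately show False by simp
  qed
  moreover have "br v w = (\<Sum>b\<in>Basis. linv w (A b) \<one> *\<^sub>R b)" (is "_ = ?u") for w
  proof (rule linv_determined)
    fix f assume f: "f \<in> SF"
    have lf: "linv x f \<in> SF" for x by (rule VF_SF[OF linv_VF f])
    have h1: "h \<one> = v"
    proof (rule linv_determined)
      fix k assume "k \<in> SF"
      then show "linv (h \<one>) k \<one> = linv v k \<one>" using h[of k \<one>] by (simp add: linv_one)
    qed
    note pd = VF_point_derivation[OF linv_VF[of w], of \<one>]
    have lin: "linv w (linv v f) \<one> = (\<Sum>b\<in>Basis. A b \<one> * linv w (linv b f) \<one>)"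
    proof -
      have "linv v f = (\<lambda>p. \<Sum>b\<in>Basis. A b \<one> * linv b f p)"
        using linv_sum[of v f] h1 by (auto simp: A_def)
      then show ?thesis
        using point_derivation_sum[OF pd, of Basis "\<lambda>b p. A b \<one> * linv b f p"] SF_cmult[OF lf]
          point_derivation_cmult[OF pd lf] by simp
    qed
    have "linv v (linv w f) \<one> = rinv v (linv w f) \<one>" by (simp add: linv_one[OF lf])
    also have "\<dots> = linv w (\<lambda>p. \<Sum>b\<in>Basis. A b p * linv b f p) \<one>"
      using left_right_commute[OF f] expand[OF f] by simp
    also have "\<dots> = (\<Sum>b\<in>Basis. linv w (\<lambda>p. A b p * linv b f p) \<one>)"
      by (rule point_derivation_sum[OF pd]) (intro SF_mult A lf)
    also have "\<dots> = (\<Sum>b\<in>Basis. A b \<one> * linv w (linv b f) \<one> + linv b f \<one> * linv w (A b) \<one>)"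
      by (rule sum.cong[OF refl]) (rule point_derivation_mult[OF pd A lf])
    also have "\<dots> = linv w (linv v f) \<one> + (\<Sum>b\<in>Basis. linv b f \<one> * linv w (A b) \<one>)"
      by (simp add: sum.distrib lin)
    also have "(\<Sum>b\<in>Basis. linv b f \<one> * linv w (A b) \<one>) = linv ?u f \<one>"
      unfolding linv_sum[of ?u] by (rule sum.cong[OF refl]) simp
    finally show "linv (br v w) f \<one> = linv ?u f \<one>"
      by (simp add: linv_br lie_bracket_def)
  qed
  then have "br v b \<bullet> b = linv b (A b) \<one>" if "b \<in> Basis" for b
    using that by simp
  ultimately show ?thesis by (simp add: d_def)
qed

end

section \<open>Three-dimensional unimodular metric Lie algebras\<close>

text \<open>A unit vector of \<open>S\<close> at which \<open>q\<close> is maximal is \<open>q\<close>-orthogonal to its orthogonal complement in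
  \<open>S\<close>, as the first variation shows; so one splits it off and repeats.\<close>

lemma orthonormal_diagonalization:
  fixes q :: "'a::euclidean_space \<Rightarrow> 'a \<Rightarrow> real"
  assumes q: "bilinear q" "\<And>x y. q x y = q y x"
  shows "subspace S \<Longrightarrow> \<exists>B. finite B \<and> B \<subseteq> S \<and> span B = S \<and>
    (\<forall>b\<in>B. norm b = 1) \<and> (\<forall>b\<in>B. \<forall>c\<in>B. b \<noteq> c \<longrightarrow> b \<bullet> c = 0 \<and> q b c = 0)"
proof (induction "dim S" arbitrary: S rule: less_induct)
  case less
  show ?case
  proof (cases "S = {0}")
    case True
    then show ?thesis by (intro exI[of _ "{}"]) auto
  next
    case False
    have compact: "compact (S \<inter> sphere 0 1)"
      using closed_subspace[OF less.prems] by (intro closed_Int_compact) auto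
    obtain z where z: "z \<in> S" "z \<noteq> 0" using False less.prems subspace_0 by blast
    then have "z /\<^sub>R norm z \<in> S \<inter> sphere 0 1"
      using less.prems subspace_scale by auto
    then have "S \<inter> sphere 0 1 \<noteq> {}" by blast
    moreover have "continuous_on (S \<inter> sphere 0 1) (\<lambda>x. q x x)"
      using bilinear_continuous_on_compose[OF continuous_on_id continuous_on_id q(1)] by simp
    ultimately obtain v where v': "v \<in> S \<inter> sphere 0 1" and max': "\<forall>x\<in>S \<inter> sphere 0 1. q x x \<le> q v v"
      using continuous_attains_sup[OF compact, of "\<lambda>x. q x x"] by blast
    have v: "v \<in> S" "norm v = 1" using v' by auto
    have max: "q x x \<le> q v v" if "x \<in> S" "norm x = 1" for x using max' that by auto
    have le: "q x x \<le> q v v * (x \<bullet> x)" if "x \<in> S" for x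
    proof (cases "x = 0")
      case False
      have "q (x /\<^sub>R norm x) (x /\<^sub>R norm x) \<le> q v v"
        using that less.prems subspace_scale False by (intro max) auto
      then have "q x x / (norm x)\<^sup>2 \<le> q v v"
        by (simp add: bilinear_lmul[OF q(1)] bilinear_rmul[OF q(1)] power2_eq_square divide_inverse mult_ac)
      then show ?thesis using False by (simp add: power2_norm_eq_inner[symmetric] divide_le_eq)
    qed (simp add: bilinear_lzero[OF q(1)])
    have orth: "q v w = 0" if w: "w \<in> S" "v \<bullet> w = 0" for w
    proof -
      define b where "b = q v v * (w \<bullet> w) - q w w"
      have t: "2 * t * q v w \<le> t\<^sup>2 * b" for t
      proof -
        have "v + t *\<^sub>R w \<in> S" using v w less.prems by (simp add: subspace_add subspace_scale)
        from le[OF this] have "q v v + 2 * t * q v w + t\<^sup>2 * q w w \<le> q v v * (1 + t\<^sup>2 * (w \<bullet> w))"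
          using v w q(2)[of w v]
          by (simp add: bilinear_ladd[OF q(1)] bilinear_radd[OF q(1)] bilinear_lmul[OF q(1)]
              bilinear_rmul[OF q(1)] inner_add_left inner_add_right inner_commute[of w v]
              power2_eq_square norm_eq_1 algebra_simps)
        then show ?thesis by (simp add: b_def algebra_simps)
      qed
      define a where "a = q v w"
      define d where "d = \<bar>b\<bar> + 1"
      have d: "d > 0" "b \<le> d" by (auto simp: d_def)
      have "2 * (a / d) * a \<le> (a / d)\<^sup>2 * b"
        using t[of "a / d"] by (simp add: a_def)
      also have "\<dots> \<le> (a / d)\<^sup>2 * d"
        using d by (intro mult_left_mono) auto
      also have "\<dots> = (a / d) * a"
        using d by (simp add: power2_eq_square)
      finally have "a * a / d \<le> 0" by simp
      then have "a * a \<le> 0" using d by (simp add: divide_le_0_iff zero_le_mult_iff not_le)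
      then show ?thesis by (auto simp: a_def mult_le_0_iff)
    qed
    define S' where "S' = S \<inter> {w. v \<bullet> w = 0}"
    have S': "subspace S'" unfolding S'_def by (intro subspace_inter less.prems subspace_hyperplane)
    have "v \<notin> S'" using v by (auto simp: S'_def norm_eq_1)
    moreover have "S' \<subseteq> S" by (auto simp: S'_def)
    ultimately have "S' \<subset> S" using v(1) by blast
    then have "dim S' < dim S"
      using dim_psubset[of S' S] S' less.prems by (metis span_eq_iff)
    from less.hyps[OF this S'] obtain B where B: "finite B" "B \<subseteq> S'" "span B = S'"
      "\<forall>b\<in>B. norm b = 1" "\<forall>b\<in>B. \<forall>c\<in>B. b \<noteq> c \<longrightarrow> b \<bullet> c = 0 \<and> q b c = 0" by blast
    have Bv: "v \<bullet> b = 0 \<and> q v b = 0 \<and> b \<bullet> v = 0 \<and> q b v = 0" if "b \<in> B" for b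
    proof -
      have "b \<in> S" "v \<bullet> b = 0" using that B(2) by (auto simp: S'_def)
      then show ?thesis using orth[of b] q(2)[of b v] by (simp add: inner_commute)
    qed
    have "S \<subseteq> span (insert v B)"
    proof
      fix x assume x: "x \<in> S"
      have "x - (v \<bullet> x) *\<^sub>R v \<in> S'"
        using x v less.prems by (auto simp: S'_def subspace_diff subspace_scale inner_diff_right norm_eq_1)
      then have "x - (v \<bullet> x) *\<^sub>R v \<in> span B" using B(3) by simp
      then show "x \<in> span (insert v B)" by (auto simp: span_insert)
    qed
    moreover have "insert v B \<subseteq> S" using v B(2) by (auto simp: S'_def)
    ultimately have "span (insert v B) = S"
      using span_minimal[OF _ less.prems] by blast
    then show ?thesis
      using B v \<open>insert v B \<subseteq> S\<close> Bv by (intro exI[of _ "insert v B"]) auto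
  qed
qed

lemma orthonormal_diagonalization_3:
  fixes q :: "real^3 \<Rightarrow> real^3 \<Rightarrow> real"
  assumes q: "bilinear q" "\<And>x y. q x y = q y x"
  obtains v :: "3 \<Rightarrow> real^3" where "\<And>i j. v i \<bullet> v j = (if i = j then 1 else 0)"
    "\<And>i j. i \<noteq> j \<Longrightarrow> q (v i) (v j) = 0"
proof -
  obtain B :: "(real^3) set" where B: "finite B" "span B = UNIV" "\<And>b. b \<in> B \<Longrightarrow> norm b = 1"
    "\<And>b c. b \<in> B \<Longrightarrow> c \<in> B \<Longrightarrow> b \<noteq> c \<Longrightarrow> b \<bullet> c = 0 \<and> q b c = 0"
    using orthonormal_diagonalization[OF q subspace_UNIV] by blast
  have "independent B"
    by (rule pairwise_orthogonal_independent) (use B(4) B(3)[of 0] in \<open>auto simp: pairwise_def orthogonal_def\<close>)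
  then have "card B = dim (UNIV :: (real^3) set)"
    using dim_eq_card_independent[of B] dim_span[of B] B(2) by simp
  then have "card (UNIV :: 3 set) = card B" by simp
  then obtain v where v: "bij_betw v (UNIV :: 3 set) B"
    using finite_same_card_bij[of "UNIV :: 3 set" B] B(1) by auto
  then have vB: "v i \<in> B" and vi: "i \<noteq> j \<Longrightarrow> v i \<noteq> v j" for i j
    by (auto simp: bij_betw_def inj_def)
  show thesis
  proof (rule that[of v])
    show "v i \<bullet> v j = (if i = j then 1 else 0)" for i j
      using B(3)[OF vB[of i]] B(4)[OF vB[of i] vB[of j]] vi[of i j] by (auto simp: norm_eq_1)
    show "q (v i) (v j) = 0" if "i \<noteq> j" for i j
      using B(4)[OF vB[of i] vB[of j] vi[OF that]] by simp
  qed
qed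

text \<open>Here \<open>B\<close> is any bilinear form. Orthonormality alone makes three vectors linearly independent,
  hence a basis.\<close>

lemma orthonormal_expansion:
  fixes B :: "real^3 \<Rightarrow> real^3 \<Rightarrow> real" and u :: "3 \<Rightarrow> real^3"
  assumes B: "bilinear B" and u: "\<And>i j. B (u i) (u j) = (if i = j then 1 else 0)"
  shows "x = (\<Sum>k\<in>UNIV. B x (u k) *\<^sub>R u k)"
proof -
  have comb: "B (\<Sum>k\<in>UNIV. c k *\<^sub>R u k) (u j) = c j" for c :: "3 \<Rightarrow> real" and j
  proof -
    have "linear (\<lambda>x. B x (u j))" using B by (simp add: bilinear_def)
    then have "B (\<Sum>k\<in>UNIV. c k *\<^sub>R u k) (u j) = (\<Sum>k\<in>UNIV. c k * B (u k) (u j))"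
      using linear_sum[of "\<lambda>x. B x (u j)" "\<lambda>k. c k *\<^sub>R u k" UNIV] bilinear_lmul[OF B] by simp
    also have "\<dots> = c j" by (simp add: u if_distrib sum.delta cong: if_cong)
    finally show ?thesis .
  qed
  have inj: "inj u"
  proof (rule injI)
    fix i j assume "u i = u j"
    then show "i = j" using u[of i i] u[of i j] by (auto split: if_splits)
  qed
  have rep: "(\<Sum>v\<in>range u. r v *\<^sub>R v) = (\<Sum>k\<in>UNIV. r (u k) *\<^sub>R u k)" for r
    using inj by (simp add: sum.reindex)
  have "independent (range u)"
  proof (rule independent_if_scalars_zero)
    fix r v assume "(\<Sum>v\<in>range u. r v *\<^sub>R v) = 0" and v: "v \<in> range u"
    then have 0: "(\<Sum>k\<in>UNIV. r (u k) *\<^sub>R u k) = 0" by (simp add: rep)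
    obtain j where j: "v = u j" using v by blast
    show "r v = 0"
      using comb[of "\<lambda>k. r (u k)" j] unfolding 0 by (simp add: j bilinear_lzero[OF B])
  qed simp
  moreover have "card (range u) = 3" using inj by (simp add: card_image)
  ultimately have "UNIV \<subseteq> span (range u)"
    by (intro card_ge_dim_independent) auto
  then have "x \<in> span (range u)" by blast
  then obtain r where "x = (\<Sum>v\<in>range u. r v *\<^sub>R v)"
    by (auto simp: span_finite)
  then have x: "x = (\<Sum>k\<in>UNIV. r (u k) *\<^sub>R u k)" by (simp add: rep)
  then have "B x (u k) = r (u k)" for k using comb[of "\<lambda>k. r (u k)" k] by simp
  then show ?thesis using x by simp
qed

lemma orthonormal_frame_exists:
  fixes B :: "real^3 \<Rightarrow> real^3 \<Rightarrow> real"
  assumes B: "bilinear B" "\<And>x y. B x y = B y x" "\<And>x. x \<noteq> 0 \<Longrightarrow> B x x > 0"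
  obtains u :: "3 \<Rightarrow> real^3" where "\<And>i j. B (u i) (u j) = (if i = j then 1 else 0)"
proof -
  obtain v :: "3 \<Rightarrow> real^3" where v: "\<And>i j. v i \<bullet> v j = (if i = j then 1 else 0)"
    "\<And>i j. i \<noteq> j \<Longrightarrow> B (v i) (v j) = 0"
    using orthonormal_diagonalization_3[OF B(1,2)] by blast
  have nz: "v i \<noteq> 0" for i using v(1)[of i i] by auto
  show thesis
  proof (rule that[of "\<lambda>i. v i /\<^sub>R sqrt (B (v i) (v i))"])
    fix i j
    have "inverse (sqrt b) * (inverse (sqrt b) * b) = 1" if "b > 0" for b
      using that by (simp add: field_simps real_sqrt_mult_self)
    then show "B (v i /\<^sub>R sqrt (B (v i) (v i))) (v j /\<^sub>R sqrt (B (v j) (v j))) = (if i = j then 1 else 0)"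
      using v(2)[of i j] B(3)[OF nz[of i]]
      by (auto simp: bilinear_lmul[OF B(1)] bilinear_rmul[OF B(1)])
  qed
qed

text \<open>The trace may be computed in a frame that is orthonormal for \<open>B\<close> instead of the Euclidean inner
  product.\<close>

lemma trace_orthonormal:
  fixes B :: "real^3 \<Rightarrow> real^3 \<Rightarrow> real" and u :: "3 \<Rightarrow> real^3" and f :: "real^3 \<Rightarrow> real^3"
  assumes B: "bilinear B" and u: "\<And>i j. B (u i) (u j) = (if i = j then 1 else 0)" and f: "linear f"
  shows "(\<Sum>k\<in>UNIV. B (f (u k)) (u k)) = (\<Sum>b\<in>Basis. f b \<bullet> b)"
proof -
  have "f b \<bullet> b = (\<Sum>k\<in>UNIV. B b (u k) * (f (u k) \<bullet> b))" for b
  proof -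
    have "f b = f (\<Sum>k\<in>UNIV. B b (u k) *\<^sub>R u k)"
      using orthonormal_expansion[OF B u, of b] by simp
    also have "\<dots> = (\<Sum>k\<in>UNIV. B b (u k) *\<^sub>R f (u k))"
      using f by (simp add: linear_sum linear_scale)
    finally show ?thesis by (simp add: inner_sum_left)
  qed
  then have "(\<Sum>b\<in>Basis. f b \<bullet> b) = (\<Sum>k\<in>UNIV. \<Sum>b\<in>Basis. B b (u k) * (f (u k) \<bullet> b))"
    using sum.swap by (simp add: sum.swap[of _ UNIV Basis])
  also have "\<dots> = (\<Sum>k\<in>UNIV. B (f (u k)) (u k))"
  proof (rule sum.cong[OF refl])
    fix k
    have lin: "linear (\<lambda>x. B x (u k))" using B by (simp add: bilinear_def)
    have "B (f (u k)) (u k) = B (\<Sum>b\<in>Basis. (f (u k) \<bullet> b) *\<^sub>R b) (u k)"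
      by (simp only: euclidean_representation)
    also have "\<dots> = (\<Sum>b\<in>Basis. (f (u k) \<bullet> b) * B b (u k))"
      unfolding linear_sum[OF lin] bilinear_lmul[OF B] by simp
    finally show "(\<Sum>b\<in>Basis. B b (u k) * (f (u k) \<bullet> b)) = B (f (u k)) (u k)"
      by (simp add: mult.commute)
  qed
  finally show ?thesis by simp
qed

text \<open>Milnor's normal form. In an orthonormal frame the bracket is a linear map \<open>K\<close> applied to the
  vector product; unimodularity says that \<open>K\<close> is self-adjoint, and an orthonormal frame of
  eigenvectors of \<open>K\<close> is as required. The frame need not be positively oriented: the sign
  \<open>s\<close> is absorbed in the eigenvalues.\<close>

lemma milnor_frame:
  fixes B :: "real^3 \<Rightarrow> real^3 \<Rightarrow> real" and br :: "real^3 \<Rightarrow> real^3 \<Rightarrow> real^3"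
  assumes B: "bilinear B" "\<And>x y. B x y = B y x" "\<And>x. x \<noteq> 0 \<Longrightarrow> B x x > 0"
    and br: "bilinear br" "\<And>x y. br x y = - br y x"
    and tr: "\<And>x. (\<Sum>b\<in>Basis. br x b \<bullet> b) = 0"
  obtains w :: "3 \<Rightarrow> real^3" and l1 l2 l3 where "\<And>i j. B (w i) (w j) = (if i = j then 1 else 0)"
    "br (w 2) (w 3) = l1 *\<^sub>R w 1" "br (w 3) (w 1) = l2 *\<^sub>R w 2" "br (w 1) (w 2) = l3 *\<^sub>R w 3"
proof -
  obtain u :: "3 \<Rightarrow> real^3" where u: "\<And>i j. B (u i) (u j) = (if i = j then 1 else 0)"
    using orthonormal_frame_exists[OF B] by blast
  note lin = bilinear_ladd[OF B(1)] bilinear_radd[OF B(1)] bilinear_lmul[OF B(1)] bilinear_rmul[OF B(1)]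
    bilinear_ladd[OF br(1)] bilinear_radd[OF br(1)] bilinear_lmul[OF br(1)] bilinear_rmul[OF br(1)]
  have brself: "br x x = 0" for x using br(2)[of x x] by (simp add: vec_eq_iff)
  define T where "T x = x $ 1 *\<^sub>R u 1 + x $ 2 *\<^sub>R u 2 + x $ 3 *\<^sub>R u 3" for x :: "real^3"
  define K where "K x = x $ 1 *\<^sub>R br (u 2) (u 3) + x $ 2 *\<^sub>R br (u 3) (u 1) + x $ 3 *\<^sub>R br (u 1) (u 2)"
    for x :: "real^3"
  define q where "q x y = B (K x) (T y)" for x y
  have neq: "(1::3) \<noteq> 2" "(1::3) \<noteq> 3" "(2::3) \<noteq> 3" by simp_all
  have BT: "B (T x) (T y) = x \<bullet> y" for x y
    unfolding T_def lin u by (simp add: neq neq[symmetric] inner_vec_def sum_3 algebra_simps)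
  have brT: "br (T x) (T y) = K (cross3 x y)" for x y
    unfolding T_def K_def lin brself br(2)[of "u 2" "u 1"] br(2)[of "u 3" "u 2"] br(2)[of "u 1" "u 3"]
    by (simp add: cross3_def algebra_simps)
  have Tl: "linear T" "linear K"
    by (auto intro!: linearI simp: T_def K_def algebra_simps)
  have "bilinear q"
    unfolding bilinear_def q_def
    using linear_compose[OF Tl(2), of "\<lambda>x. B x _"] linear_compose[OF Tl(1), of "B _"] B(1)
    by (auto simp: bilinear_def o_def)
  moreover have "q x y = q y x" for x y
  proof -
    have t: "B (br x (u 1)) (u 1) + B (br x (u 2)) (u 2) + B (br x (u 3)) (u 3) = 0" for x
      using trace_orthonormal[OF B(1) u, of "br x"] br(1) tr[of x] by (simp add: bilinear_def sum_3)
    have "B (br (u 3) (u 1)) (u 1) = B (br (u 2) (u 3)) (u 2)"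
      using t[of "u 3"] br(2)[of "u 3" "u 2"] by (simp add: brself bilinear_lzero[OF B(1)] bilinear_lneg[OF B(1)])
    moreover have "B (br (u 1) (u 2)) (u 1) = B (br (u 2) (u 3)) (u 3)"
      using t[of "u 2"] br(2)[of "u 2" "u 1"] by (simp add: brself bilinear_lzero[OF B(1)] bilinear_lneg[OF B(1)])
    moreover have "B (br (u 1) (u 2)) (u 2) = B (br (u 3) (u 1)) (u 3)"
      using t[of "u 1"] br(2)[of "u 1" "u 3"] by (simp add: brself bilinear_lzero[OF B(1)] bilinear_lneg[OF B(1)])
    ultimately show ?thesis
      unfolding q_def T_def K_def lin by (simp add: algebra_simps)
  qed
  ultimately obtain v :: "3 \<Rightarrow> real^3" where v: "\<And>i j. v i \<bullet> v j = (if i = j then 1 else 0)"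
    "\<And>i j. i \<noteq> j \<Longrightarrow> q (v i) (v j) = 0"
    using orthonormal_diagonalization_3[of q] by blast
  define w where "w i = T (v i)" for i
  have w: "B (w i) (w j) = (if i = j then 1 else 0)" for i j
    by (simp add: w_def BT v(1))
  have Kv: "K (v i) = q (v i) (v i) *\<^sub>R w i" for i
  proof -
    have "K (v i) = (\<Sum>k\<in>UNIV. q (v i) (v k) *\<^sub>R w k)"
      using orthonormal_expansion[OF B(1) w, of "K (v i)"] by (simp add: q_def w_def)
    also have "\<dots> = (\<Sum>k\<in>UNIV. if k = i then q (v i) (v i) *\<^sub>R w i else 0)"
      by (rule sum.cong) (use v(2) in auto)
    finally show ?thesis by simp
  qed
  define s where "s = cross3 (v 1) (v 2) \<bullet> v 3"
  have "bilinear ((\<bullet>) :: real^3 \<Rightarrow> real^3 \<Rightarrow> real)"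
    by (simp add: bilinear_def linear_iff inner_add_left inner_add_right)
  note ex = orthonormal_expansion[OF this v(1), unfolded sum_3]
  have cyc: "cross3 x y \<bullet> z = cross3 y z \<bullet> x" for x y z
    by (rule cross_triple)
  have 1: "cross3 (v 2) (v 3) = s *\<^sub>R v 1"
    using ex[of "cross3 (v 2) (v 3)"] cyc[of "v 1" "v 2" "v 3"]
    by (simp add: s_def dot_cross_self)
  have 2: "cross3 (v 3) (v 1) = s *\<^sub>R v 2"
    using ex[of "cross3 (v 3) (v 1)"] cyc[of "v 1" "v 2" "v 3"] cyc[of "v 2" "v 3" "v 1"]
    by (simp add: s_def dot_cross_self)
  have 3: "cross3 (v 1) (v 2) = s *\<^sub>R v 3"
    using ex[of "cross3 (v 1) (v 2)"] by (simp add: s_def dot_cross_self)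
  show thesis
  proof (rule that[OF w])
    show "br (w 2) (w 3) = (s * q (v 1) (v 1)) *\<^sub>R w 1"
      by (simp add: w_def[of 2] w_def[of 3] brT 1 linear_scale[OF Tl(2)] Kv)
    show "br (w 3) (w 1) = (s * q (v 2) (v 2)) *\<^sub>R w 2"
      by (simp add: w_def[of 3] w_def[of 1] brT 2 linear_scale[OF Tl(2)] Kv)
    show "br (w 1) (w 2) = (s * q (v 3) (v 3)) *\<^sub>R w 3"
      by (simp add: w_def[of 1] w_def[of 2] brT 3 linear_scale[OF Tl(2)] Kv)
  qed
qed


text \<open>These are the equations for the coefficients \<open>a = C 1 1 1\<close>, \<open>b = C 1 2 2\<close>, \<open>c = C 1 3 3\<close> of the
  cubic form, up to sign, of a conjugate symmetric structure in a Milnor frame with structure constants \<open>m2 + m3\<close>,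
  \<open>m1 + m3\<close>, \<open>m1 + m2\<close>. If \<open>b\<close> or \<open>c\<close> is nonzero, the first two equations relate \<open>m2\<close> and \<open>m3\<close> and the
  others determine \<open>m1\<close>. In the three cases the structure constants are \<open>(0, m1, m1)\<close>, \<open>(-2, -2, -6) m3\<close>
  and \<open>(-2, -6, -2) m2\<close>.\<close>

lemma cubic_form_cases:
  fixes a b c m1 m2 m3 :: real
  assumes "(m2 + 3 * m3) * b = 0" "(3 * m2 + m3) * c = 0" "(m2 + m3) * a = 2 * m2 * c + 2 * m3 * b"
    "m1 * (b - c) = m2 * (2 * c - a)" "m3 * (a - 2 * b) = m1 * (b - c)"
    and "a \<noteq> 0 \<or> b \<noteq> 0 \<or> c \<noteq> 0"
  shows "(m2 = 0 \<and> m3 = 0) \<or> (m1 = m2 \<and> m2 = -3 * m3 \<and> m3 \<noteq> 0) \<or> (m1 = m3 \<and> m3 = -3 * m2 \<and> m2 \<noteq> 0)"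
proof -
  consider "b = 0" "c = 0" | "b \<noteq> 0" | "c \<noteq> 0" by blast
  then show ?thesis
  proof cases
    case 1
    then show ?thesis using assms by auto
  next
    case 2
    then have m2: "m2 = -3 * m3" using assms(1) by auto
    show ?thesis
    proof (cases "m3 = 0")
      case False
      have "(3 * m2 + m3) * c = - 8 * (m3 * c)" by (simp add: m2)
      then have c: "c = 0" using assms(2) False by simp
      have "m3 * (2 * (a + b)) = 0" using assms(3) by (simp add: m2 c algebra_simps)
      then have "a = - b" using False by simp
      then have "(m1 - m2) * b = 0" using assms(4) by (simp add: c algebra_simps)
      then show ?thesis using 2 m2 False by simp
    qed (use m2 in simp)
  next
    case 3
    then have m3: "m3 = -3 * m2" using assms(2) by auto
    show ?thesis
    proof (cases "m2 = 0")
      case False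
      have "(m2 + 3 * m3) * b = - 8 * (m2 * b)" by (simp add: m3)
      then have b: "b = 0" using assms(1) False by simp
      have "m2 * (2 * (a + c)) = 0" using assms(3) by (simp add: m3 b algebra_simps)
      then have "a = - c" using False by simp
      then have "(m1 - m3) * c = 0" using assms(5) by (auto simp: b algebra_simps)
      then show ?thesis using 3 m3 False by simp
    qed (use m3 in simp)
  qed
qed

text \<open>\<open>N\<close> and \<open>N'\<close> are the coefficients of the connection and of its dual, and \<open>G\<close>, \<open>G'\<close> are their components
  in a Milnor frame. The part \<open>A\<close> of \<open>G\<close> that is antisymmetric in the last two indices is given by the structure
  constants, by Koszul's formula, with nonzero components \<open>\<plusminus> m1\<close>, \<open>\<plusminus> m2\<close>, \<open>\<plusminus> m3\<close> only; inserted in the equality of the curvatures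
  it leaves the equations of the preceding lemma for the three cyclic permutations of the indices, and
  the vanishing of the products of \<open>C 1 2 3\<close> with the structure constants.\<close>

lemma statistical_lie_algebra_classification:
  fixes B :: "real^3 \<Rightarrow> real^3 \<Rightarrow> real" and br N N' :: "real^3 \<Rightarrow> real^3 \<Rightarrow> real^3"
  assumes B: "bilinear B" "\<And>x y. B x y = B y x" "\<And>x. x \<noteq> 0 \<Longrightarrow> B x x > 0"
    and br: "bilinear br" "\<And>x y. br x y = - br y x"
    and tr: "\<And>x. (\<Sum>b\<in>Basis. br x b \<bullet> b) = 0"
    and N: "bilinear N" "bilinear N'"
    and torsion: "\<And>x y. N x y - N y x = br x y"
    and dual: "\<And>x y z. B (N x y) z + B y (N' x z) = 0"
    and sym: "\<And>x y z. B (N x y) z + B y (N x z) = B (N y x) z + B x (N y z)"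
    and curv: "\<And>x y z. N x (N y z) - N y (N x z) - N (br x y) z = N' x (N' y z) - N' y (N' x z) - N' (br x y) z"
    and nz: "B (N x0 y0) z0 + B y0 (N x0 z0) \<noteq> 0"
  obtains w :: "3 \<Rightarrow> real^3" and l1 l2 l3 where "\<And>i j. B (w i) (w j) = (if i = j then 1 else 0)"
    "br (w 2) (w 3) = l1 *\<^sub>R w 1" "br (w 3) (w 1) = l2 *\<^sub>R w 2" "br (w 1) (w 2) = l3 *\<^sub>R w 3"
    "(l1 * l2 > 0 \<and> l2 * l3 > 0) \<or> (l1 = 0 \<and> l2 = l3) \<or> (l2 = 0 \<and> l3 = l1) \<or> (l3 = 0 \<and> l1 = l2)"
proof -
  obtain w :: "3 \<Rightarrow> real^3" and l1 l2 l3 where w: "\<And>i j. B (w i) (w j) = (if i = j then 1 else 0)"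
    and br_w: "br (w 2) (w 3) = l1 *\<^sub>R w 1" "br (w 3) (w 1) = l2 *\<^sub>R w 2" "br (w 1) (w 2) = l3 *\<^sub>R w 3"
    using milnor_frame[OF B br tr] by blast
  have linB: "linear (\<lambda>x. B x y)" "linear (B y)" for y using B(1) by (auto simp: bilinear_def)
  have linN: "linear (\<lambda>x. N x y)" "linear (N y)" "linear (\<lambda>x. N' x y)" "linear (N' y)" for y
    using N by (auto simp: bilinear_def)
  note expand = orthonormal_expansion[OF B(1) w]
  have along: "f x = (\<Sum>k\<in>UNIV. B x (w k) *\<^sub>R f (w k))" if "linear f" for f :: "real^3 \<Rightarrow> 'b::real_vector" and x
  proof -
    have "f x = f (\<Sum>k\<in>UNIV. B x (w k) *\<^sub>R w k)" using expand[of x] by simp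
    then show ?thesis by (simp add: linear_sum[OF that] linear_scale[OF that])
  qed
  define G where "G i j k = B (N (w i) (w j)) (w k)" for i j k
  define G' where "G' i j k = B (N' (w i) (w j)) (w k)" for i j k
  define c where "c i j k = B (br (w i) (w j)) (w k)" for i j k
  define C where "C i j k = G i j k + G i k j" for i j k
  define A where "A i j k = (G i j k - G i k j) / 2" for i j k
  have tors: "G i j k - G j i k = c i j k" for i j k
    unfolding G_def c_def torsion[symmetric] by (simp add: linear_diff[OF linB(1)])
  have G': "G' i j k = - G i k j" for i j k
    using dual[of "w i" "w k" "w j"] B(2)[of "w k" "N' (w i) (w j)"] by (simp add: G_def G'_def)
  have C_sym: "C i j k = C i k j" "C i j k = C j i k" for i j k
    using sym[of "w i" "w j" "w k"] B(2)[of "w j" "N (w i) (w k)"] B(2)[of "w i" "N (w j) (w k)"]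
    by (simp_all add: C_def G_def)
  have NN: "B (M (w i) (M (w j) (w k))) (w m) = (\<Sum>l\<in>UNIV. B (M (w j) (w k)) (w l) * B (M (w i) (w l)) (w m))"
    if "\<And>y. linear (M y)" for M i j k m
    using along[OF linear_compose[OF that linB(1)], of "w m" "w i" "M (w j) (w k)"] by (simp add: o_def)
  have Nb: "B (M (br (w i) (w j)) (w k)) (w m) = (\<Sum>l\<in>UNIV. c i j l * B (M (w l) (w k)) (w m))"
    if "\<And>y. linear (\<lambda>x. M x y)" for M i j k m
    using along[OF linear_compose[OF that linB(1)], of "w m" "w k" "br (w i) (w j)"] by (simp add: o_def c_def)
  have "(\<Sum>l\<in>UNIV. G j k l * G i l m) - (\<Sum>l\<in>UNIV. G i k l * G j l m) - (\<Sum>l\<in>UNIV. c i j l * G l k m) =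
      (\<Sum>l\<in>UNIV. G' j k l * G' i l m) - (\<Sum>l\<in>UNIV. G' i k l * G' j l m) - (\<Sum>l\<in>UNIV. c i j l * G' l k m)"
    for i j k m
    using arg_cong[OF curv[of "w i" "w j" "w k"], of "\<lambda>x. B x (w m)"]
    unfolding linear_diff[OF linB(1)] NN[of N, OF linN(2)] NN[of N', OF linN(4)] Nb[of N, OF linN(1)] Nb[of N', OF linN(3)]
      G_def[symmetric] G'_def[symmetric] .
  note coef = this
  have quad: "(\<Sum>l\<in>UNIV. (G j k l * G i l m - G' j k l * G' i l m) - (G i k l * G j l m - G' i k l * G' j l m)
      - c i j l * (G l k m - G' l k m)) = 0" for i j k m
    using coef[of j k i m] unfolding sum_subtractf right_diff_distrib by linarith
  \<comment> \<open>\<open>C\<close> is the negative of the cubic form, and the Levi-Civita part \<open>A\<close> satisfies \<open>G = A + C / 2\<close> and \<open>G' = A - C / 2\<close>, so that the difference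
    of the two curvatures is linear in \<open>C\<close>.\<close>
  have lin: "(\<Sum>l\<in>UNIV. (A j k l * C i l m + C j k l * A i l m) - (A i k l * C j l m + C i k l * A j l m)
      - c i j l * C l k m) = 0" for i j k m
  proof -
    have "G j k l * G i l m - G' j k l * G' i l m = A j k l * C i l m + C j k l * A i l m" for i j k l m
      unfolding G' A_def C_def by (simp add: field_simps)
    moreover have "G l k m - G' l k m = C l k m" for l k m
      unfolding G' C_def by simp
    ultimately show ?thesis using quad[of j k i m] by simp
  qed
  have neq: "(1::3) \<noteq> 2" "(1::3) \<noteq> 3" "(2::3) \<noteq> 3" by simp_all
  have A: "A i j k = (c i j k - c j k i + c k i j) / 2" for i j k
    using tors[of i j k] tors[of j k i] tors[of k i j] C_sym[of j i k] C_sym[of k j i] C_sym[of j k i]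
      C_sym[of k i j] unfolding A_def C_def by argo
  have brself: "br x x = 0" for x using br(2)[of x x] by (simp add: vec_eq_iff)
  have br_w': "br (w 3) (w 2) = - (l1 *\<^sub>R w 1)" "br (w 1) (w 3) = - (l2 *\<^sub>R w 2)" "br (w 2) (w 1) = - (l3 *\<^sub>R w 3)"
    using br(2) br_w by metis+
  have c: "c 1 1 k = 0" "c 2 2 k = 0" "c 3 3 k = 0"
    "c 2 3 k = (if k = 1 then l1 else 0)" "c 3 2 k = (if k = 1 then - l1 else 0)"
    "c 3 1 k = (if k = 2 then l2 else 0)" "c 1 3 k = (if k = 2 then - l2 else 0)"
    "c 1 2 k = (if k = 3 then l3 else 0)" "c 2 1 k = (if k = 3 then - l3 else 0)" for k
    unfolding c_def brself br_w br_w'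
    by (auto simp: w bilinear_lmul[OF B(1)] linear_neg[OF linB(1)] linear_0[OF linB(1)])
  define m1 m2 m3 where "m1 = (l2 + l3 - l1) / 2" and "m2 = (l1 + l3 - l2) / 2" and "m3 = (l1 + l2 - l3) / 2"
  have l: "l1 = m2 + m3" "l2 = m1 + m3" "l3 = m1 + m2"
    by (simp_all add: m1_def m2_def m3_def field_simps)
  have norm: "C 2 1 1 = C 1 1 2" "C 1 2 1 = C 1 1 2" "C 3 1 1 = C 1 1 3" "C 1 3 1 = C 1 1 3"
    "C 2 1 2 = C 1 2 2" "C 2 2 1 = C 1 2 2" "C 3 1 3 = C 1 3 3" "C 3 3 1 = C 1 3 3"
    "C 3 2 2 = C 2 2 3" "C 2 3 2 = C 2 2 3" "C 3 2 3 = C 2 3 3" "C 3 3 2 = C 2 3 3"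
    "C 1 3 2 = C 1 2 3" "C 2 1 3 = C 1 2 3" "C 2 3 1 = C 1 2 3" "C 3 1 2 = C 1 2 3" "C 3 2 1 = C 1 2 3"
    by (simp_all only: C_sym(1)[of 1 2 1] C_sym(1)[of 1 3 1] C_sym(1)[of 2 2 1] C_sym(1)[of 3 3 1]
        C_sym(1)[of 2 3 2] C_sym(1)[of 3 3 2] C_sym(1)[of 1 3 2] C_sym(1)[of 2 3 1] C_sym(1)[of 3 2 1]
        C_sym(2)[of 2 1] C_sym(2)[of 3 1] C_sym(2)[of 3 2])
  have Avals: "A 1 1 1 = 0" "A 1 1 2 = 0" "A 1 1 3 = 0" "A 1 2 1 = 0" "A 1 2 2 = 0"
    "A 1 2 3 = m1" "A 1 3 1 = 0" "A 1 3 2 = - m1" "A 1 3 3 = 0" "A 2 1 1 = 0"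
    "A 2 1 2 = 0" "A 2 1 3 = - m2" "A 2 2 1 = 0" "A 2 2 2 = 0" "A 2 2 3 = 0"
    "A 2 3 1 = m2" "A 2 3 2 = 0" "A 2 3 3 = 0" "A 3 1 1 = 0" "A 3 1 2 = m3"
    "A 3 1 3 = 0" "A 3 2 1 = - m3" "A 3 2 2 = 0" "A 3 2 3 = 0" "A 3 3 1 = 0"
    "A 3 3 2 = 0" "A 3 3 3 = 0"
    unfolding A c l using neq by (simp_all add: field_simps)
  note eq = lin[unfolded sum_3]
  note simps = Avals c norm l neq neq[symmetric] algebra_simps
  have g1a: "(m2 + 3 * m3) * C 1 2 2 = 0"
    using eq[of 3 2 2 2] by (simp add: simps)
  have g1b: "(3 * m2 + m3) * C 1 3 3 = 0"
    using eq[of 3 3 2 3] by (simp add: simps)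
  have g1c: "(m2 + m3) * C 1 1 1 = 2 * m2 * C 1 3 3 + 2 * m3 * C 1 2 2"
    using eq[of 3 1 2 1] by (simp add: simps)
  have g1d: "m1 * (C 1 2 2 - C 1 3 3) = m2 * (2 * C 1 3 3 - C 1 1 1)"
    using eq[of 2 1 1 3] by (simp add: simps)
  have g1e: "m3 * (C 1 1 1 - 2 * C 1 2 2) = m1 * (C 1 2 2 - C 1 3 3)"
    using eq[of 1 1 3 2] by (simp add: simps)
  note g1 = g1a g1b g1c g1d g1e
  have g2a: "(m3 + 3 * m1) * C 2 3 3 = 0"
    using eq[of 1 3 3 3] by (simp add: simps)
  have g2b: "(3 * m3 + m1) * C 1 1 2 = 0"
    using eq[of 1 1 3 1] by (simp add: simps)
  have g2c: "(m3 + m1) * C 2 2 2 = 2 * m3 * C 1 1 2 + 2 * m1 * C 2 3 3"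
    using eq[of 1 2 3 2] by (simp add: simps)
  have g2d: "m2 * (C 2 3 3 - C 1 1 2) = m3 * (2 * C 1 1 2 - C 2 2 2)"
    using eq[of 3 1 2 2] by (simp add: simps)
  have g2e: "m1 * (C 2 2 2 - 2 * C 2 3 3) = m2 * (C 2 3 3 - C 1 1 2)"
    using eq[of 2 2 1 3] by (simp add: simps)
  note g2 = g2a g2b g2c g2d g2e
  have g3a: "(m1 + 3 * m2) * C 1 1 3 = 0"
    using eq[of 2 1 1 1] by (simp add: simps)
  have g3b: "(3 * m1 + m2) * C 2 2 3 = 0"
    using eq[of 2 2 1 2] by (simp add: simps)
  have g3c: "(m1 + m2) * C 3 3 3 = 2 * m1 * C 2 2 3 + 2 * m2 * C 1 1 3"
    using eq[of 2 3 1 3] by (simp add: simps)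
  have g3d: "m3 * (C 1 1 3 - C 2 2 3) = m1 * (2 * C 2 2 3 - C 3 3 3)"
    using eq[of 1 2 3 3] by (simp add: simps)
  have g3e: "m2 * (C 3 3 3 - 2 * C 1 1 3) = m3 * (C 1 1 3 - C 2 2 3)"
    using eq[of 3 1 2 3] by (simp add: simps)
  note g3 = g3a g3b g3c g3d g3e
  have "- 2 * ((m1 + m2) * C 1 2 3) = 0"
    by (rule trans[OF _ eq[of 2 1 1 2]]) (simp add: simps)
  then have g0a: "(m1 + m2) * C 1 2 3 = 0" by simp
  have "- 2 * ((m2 + m3) * C 1 2 3) = 0"
    by (rule trans[OF _ eq[of 3 2 2 3]]) (simp add: simps)
  then have g0b: "(m2 + m3) * C 1 2 3 = 0" by simp
  have "- 2 * ((m1 + m3) * C 1 2 3) = 0"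
    by (rule trans[OF _ eq[of 1 1 3 3]]) (simp add: simps)
  then have g0c: "(m1 + m3) * C 1 2 3 = 0" by simp
  note g0 = g0a g0b g0c
  have "\<not> (\<forall>i j k. C i j k = 0)"
  proof
    assume "\<forall>i j k. C i j k = 0"
    then have "B (N (w i) (w j)) (w k) + B (w j) (N (w i) (w k)) = 0" for i j k
      using B(2)[of "w j" "N (w i) (w k)"] by (simp add: C_def G_def)
    note zero = this
    have vanish: "f x = 0" if "linear f" "\<And>k. f (w k) = 0" for f :: "real^3 \<Rightarrow> real" and x
      using along[OF that(1), of x] that(2) by simp
    have 1: "B (N (w i) (w j)) z + B (w j) (N (w i) z) = 0" for i j z
      by (rule vanish[of "\<lambda>z. B (N (w i) (w j)) z + B (w j) (N (w i) z)", OF _ zero]) (intro linear_compose_add linB linear_compose[OF linN(2) linB(2), unfolded o_def])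
    have 2: "B (N (w i) y) z + B y (N (w i) z) = 0" for i y z
      by (rule vanish[of "\<lambda>y. B (N (w i) y) z + B y (N (w i) z)", OF _ 1]) (intro linear_compose_add linB linear_compose[OF linN(2) linB(1), unfolded o_def])
    have "B (N x y) z + B y (N x z) = 0" for x y z
      by (rule vanish[of "\<lambda>x. B (N x y) z + B y (N x z)", OF _ 2]) (intro linear_compose_add linear_compose[OF linN(1) linB(1), unfolded o_def]
          linear_compose[OF linN(1) linB(2), unfolded o_def])
    then show False using nz by blast
  qed
  then consider "C 1 1 1 \<noteq> 0 \<or> C 1 2 2 \<noteq> 0 \<or> C 1 3 3 \<noteq> 0" | "C 2 2 2 \<noteq> 0 \<or> C 2 3 3 \<noteq> 0 \<or> C 1 1 2 \<noteq> 0"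
    | "C 3 3 3 \<noteq> 0 \<or> C 1 1 3 \<noteq> 0 \<or> C 2 2 3 \<noteq> 0" | "C 1 2 3 \<noteq> 0"
    unfolding forall_3 norm by blast
  then have "(l1 * l2 > 0 \<and> l2 * l3 > 0) \<or> (l1 = 0 \<and> l2 = l3) \<or> (l2 = 0 \<and> l3 = l1) \<or> (l3 = 0 \<and> l1 = l2)"
  proof cases
    case 1
    from cubic_form_cases[OF g1 this] show ?thesis by (auto simp: l zero_less_mult_iff)
  next
    case 2
    from cubic_form_cases[OF g2 this] show ?thesis by (auto simp: l zero_less_mult_iff)
  next
    case 3
    from cubic_form_cases[OF g3 this] show ?thesis by (auto simp: l zero_less_mult_iff)
  next
    case 4
    then show ?thesis using g0 by (simp add: l)
  qed
  then show thesis using that[OF w br_w] by blast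
qed

section \<open>Left invariant statistical structures\<close>

context lie_group_chart
begin

lemma VF_const_fn: "X \<in> VF \<Longrightarrow> X (const_fn c) = (\<lambda>p. 0)"
proof
  fix p assume X: "X \<in> VF"
  show "X (const_fn c) p = 0"
    using point_derivation_const[OF VF_point_derivation[OF X], of p c] VF_zero[OF X, of p]
    by (cases "p \<in> carrier L") auto
qed

lemma linv_zero: "linv 0 f p = 0"
  by (rule linear_0[OF linv_linear])

lemma connection_bilinear:
  assumes D: "linear_connection L D" and N: "\<And>v w. D (linv v) (linv w) = linv (N v w)"
  shows "bilinear N"
proof -
  have add: "D (vf_add X Y) Z = vf_add (D X Z) (D Y Z)" "D X (vf_add Y Z) = vf_add (D X Y) (D X Z)"
    if "X \<in> VF" "Y \<in> VF" "Z \<in> VF" for X Y Z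
    using D that unfolding linear_connection_def by blast+
  have mult: "D (vf_mult h X) Y = vf_mult h (D X Y)"
    "D X (vf_mult h Y) = vf_add (vf_mult (X h) Y) (vf_mult h (D X Y))" if "h \<in> SF" "X \<in> VF" "Y \<in> VF" for h X Y
    using D that unfolding linear_connection_def by blast+
  have sc: "linv (c *\<^sub>R v) = vf_mult (const_fn c) (linv v)" for c v
    using linv_scale vf_cmult_eq[OF linv_VF] by simp
  have 1: "N (x + y) z = N x z + N y z" "N z (x + y) = N z x + N z y" for x y z
    by (rule linv_inj; simp add: linv_add N[symmetric] add linv_VF)+
  have 2: "N (c *\<^sub>R x) z = c *\<^sub>R N x z" for c x z
    by (rule linv_inj) (simp add: sc N[symmetric] mult linv_VF SF_const)
  have 3: "N z (c *\<^sub>R x) = c *\<^sub>R N z x" for c x z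
    by (rule linv_inj)
      (simp add: sc N[symmetric] mult linv_VF SF_const VF_const_fn[OF linv_VF], simp add: vf_add_def vf_mult_def)
  show ?thesis unfolding bilinear_def linear_iff using 1 2 3 by blast
qed

text \<open>Two connections agree as soon as they do on the left invariant fields, for the difference of two
  connections is linear over the smooth functions.\<close>

lemma connection_eqI:
  assumes D: "linear_connection L D" and D': "linear_connection L D'"
    and eq: "\<And>v w. D (linv v) (linv w) = D' (linv v) (linv w)"
    and X: "X \<in> VF" and Y: "Y \<in> VF"
  shows "D X Y = D' X Y"
proof -
  have 1: "D X (linv w) = D' X (linv w)" if "X \<in> VF" for X w
    using that
  proof (induction X rule: vector_field_induct)
    case (add X Y)
    then show ?case using D D' linv_VF[of w] unfolding linear_connection_def by metis
  next
    case (mult h X)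
    then show ?case using D D' linv_VF[of w] unfolding linear_connection_def by metis
  qed (rule eq)
  have "\<forall>X\<in>VF. D X Y = D' X Y"
    using Y
  proof (induction Y rule: vector_field_induct)
    case (add Y Z)
    show ?case
    proof
      fix X assume X: "X \<in> VF"
      have "D X (vf_add Y Z) = vf_add (D X Y) (D X Z)" using D X add unfolding linear_connection_def by blast
      also have "\<dots> = vf_add (D' X Y) (D' X Z)" using add X by simp
      also have "\<dots> = D' X (vf_add Y Z)" using D' X add unfolding linear_connection_def by metis
      finally show "D X (vf_add Y Z) = D' X (vf_add Y Z)" .
    qed
  next
    case (mult h Y)
    show ?case
    proof
      fix X assume X: "X \<in> VF"
      have "D X (vf_mult h Y) = vf_add (vf_mult (X h) Y) (vf_mult h (D X Y))"
        using D X mult unfolding linear_connection_def by blast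
      also have "\<dots> = vf_add (vf_mult (X h) Y) (vf_mult h (D' X Y))" using mult X by simp
      also have "\<dots> = D' X (vf_mult h Y)" using D' X mult unfolding linear_connection_def by metis
      finally show "D X (vf_mult h Y) = D' X (vf_mult h Y)" .
    qed
  qed (use 1 in blast)
  then show ?thesis using X by blast
qed

end

locale left_invariant_metric_chart = lie_group_chart L U \<phi>
  for L :: "('a, 'e::euclidean_space) smooth_group" (structure) and U \<phi> +
  fixes g :: "'a metric_field"
  assumes metric: "riemannian_metric L g" and left_inv: "left_invariant_metric L g"
begin

definition B :: "'e \<Rightarrow> 'e \<Rightarrow> real" where "B v w = g (linv v) (linv w) \<one>"

lemma g_SF: "X \<in> VF \<Longrightarrow> Y \<in> VF \<Longrightarrow> g X Y \<in> SF"
  and g_commute: "X \<in> VF \<Longrightarrow> Y \<in> VF \<Longrightarrow> g X Y = g Y X"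
  and g_add: "X \<in> VF \<Longrightarrow> Y \<in> VF \<Longrightarrow> Z \<in> VF \<Longrightarrow> g (vf_add X Y) Z = (\<lambda>p. g X Z p + g Y Z p)"
  and g_mult: "h \<in> SF \<Longrightarrow> X \<in> VF \<Longrightarrow> Y \<in> VF \<Longrightarrow> g (vf_mult h X) Y = (\<lambda>p. h p * g X Y p)"
  and g_pos: "X \<in> VF \<Longrightarrow> p \<in> carrier L \<Longrightarrow> 0 \<le> g X X p"
  and g_def: "X \<in> VF \<Longrightarrow> p \<in> carrier L \<Longrightarrow> g X X p = 0 \<Longrightarrow> X f p = 0"
  using metric unfolding riemannian_metric_def by blast+

lemma g_linv: "g (linv v) (linv w) = const_fn (B v w)"
proof
  fix p show "g (linv v) (linv w) p = const_fn (B v w) p"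
  proof (cases "p \<in> carrier L")
    case True
    have "push L p (linv x) = linv x" for x using linv_LA[of x] True by (simp add: lie_algebra_def)
    then have "translate L p (g (linv v) (linv w)) = g (linv v) (linv w)"
      using left_inv True linv_VF[of v] linv_VF[of w] unfolding left_invariant_metric_def by metis
    from fun_cong[OF this, of \<one>] show ?thesis using True by (simp add: translate_def B_def const_fn_def)
  qed (simp add: const_fn_def SF_zero[OF g_SF[OF linv_VF linv_VF]])
qed

lemma B_bilinear: "bilinear B"
proof -
  have sym: "B x y = B y x" for x y by (simp add: B_def g_commute[OF linv_VF linv_VF])
  have "B (x + y) z = B x z + B y z" for x y z
    by (simp add: B_def linv_add g_add linv_VF)
  moreover have "B (c *\<^sub>R x) z = c * B x z" for c x z
    unfolding B_def linv_scale vf_cmult_eq[OF linv_VF] g_mult[OF SF_const linv_VF linv_VF]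
    by (simp add: const_fn_def)
  ultimately have "linear (\<lambda>x. B x z)" for z by (simp add: linear_iff)
  moreover from this have "linear (B z)" for z using sym[of z] by (metis ext)
  ultimately show ?thesis by (simp add: bilinear_def)
qed

lemma B_commute: "B x y = B y x"
  by (simp add: B_def g_commute[OF linv_VF linv_VF])

lemma B_pos: "x \<noteq> 0 \<Longrightarrow> B x x > 0"
proof (rule ccontr)
  assume x: "x \<noteq> 0" "\<not> B x x > 0"
  then have "g (linv x) (linv x) \<one> = 0"
    using g_pos[OF linv_VF[of x], of \<one>] by (simp add: B_def)
  then have "linv x f \<one> = 0" for f using g_def[OF linv_VF[of x], of \<one> f] by simp
  then have "x = 0" by (intro linv_determined) (simp add: linv_zero)
  then show False using x by simp
qed

text \<open>A field orthogonal to the frame is orthogonal to all fields, in particular to itself.\<close>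

lemma metric_nondegenerate:
  assumes V: "V \<in> VF" and W: "W \<in> VF" and eq: "\<And>y. g (linv y) V = g (linv y) W"
  shows "V = W"
proof -
  have W': "vf_mult (const_fn (-1)) W \<in> VF" by (rule vf_mult_VF[OF SF_const W])
  define Z where "Z = vf_add V (vf_mult (const_fn (-1)) W)"
  have Z: "Z \<in> VF" unfolding Z_def by (rule vf_add_VF[OF V W'])
  have gZ: "g X Z = (\<lambda>p. g X V p + const_fn (-1) p * g X W p)" if "X \<in> VF" for X
    unfolding g_commute[OF that Z] g_commute[OF that V] g_commute[OF that W]
    by (simp add: Z_def g_add[OF V W' that] g_mult[OF SF_const W that])
  have "g X Z = (\<lambda>p. 0)" if "X \<in> VF" for X
    using that
  proof (induction X rule: vector_field_induct)
    case (frame b)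
    show ?case
    proof
      fix p show "g (linv b) Z p = 0"
        using SF_zero[OF g_SF[OF linv_VF W], of p b] unfolding gZ[OF linv_VF] eq by (simp add: const_fn_def)
    qed
  next
    case (add X Y)
    then show ?case by (simp add: g_add[OF add(1,2) Z])
  next
    case (mult h X)
    then show ?case by (simp add: g_mult[OF mult(1,2) Z])
  qed
  then have gZZ: "g Z Z p = 0" for p using Z by simp
  show ?thesis
  proof (rule VF_eqI[OF V W])
    fix f p assume "p \<in> carrier L"
    then have "Z f p = 0" using g_def[OF Z _ gZZ] by blast
    then show "V f p = W f p"
      using \<open>p \<in> carrier L\<close> by (simp add: Z_def vf_add_def vf_mult_def const_fn_def)
  qed
qed

lemma invariant_connection_coefficients:
  assumes D: "linear_connection L D" "left_invariant_connection L D"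
  obtains N where "\<And>v w. D (linv v) (linv w) = linv (N v w)" "bilinear N"
proof -
  have "D (linv v) (linv w) \<in> LA" for v w
  proof -
    have VF: "D (linv v) (linv w) \<in> VF" using D(1) linv_VF unfolding linear_connection_def by blast
    have "push L a (D (linv v) (linv w)) = D (linv v) (linv w)" if a: "a \<in> carrier L" for a
    proof -
      have "push L a (linv x) = linv x" for x using linv_LA[of x] a by (simp add: lie_algebra_def)
      then show ?thesis
        using D(2) a linv_VF[of v] linv_VF[of w] unfolding left_invariant_connection_def by metis
    qed
    then show ?thesis using VF by (simp add: lie_algebra_def)
  qed
  then have "\<forall>v w. \<exists>u. D (linv v) (linv w) = linv u" using LA_eq_linv by metis
  then obtain N where N: "\<And>v w. D (linv v) (linv w) = linv (N v w)" by metis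
  show thesis using that[OF N connection_bilinear[OF D(1) N]] .
qed

text \<open>Koszul's argument on left invariant fields: the difference of two torsion free metric connections
  is symmetric in its first two and antisymmetric in its last two arguments, hence zero.\<close>

lemma metric_connection_unique:
  assumes D: "linear_connection L D" "torsion_free L D" and D': "levi_civita L g D'"
    and N: "\<And>v w. D (linv v) (linv w) = linv (N v w)"
    and parallel: "\<And>x y z. B (N x y) z + B y (N x z) = 0"
    and XY: "X \<in> VF" "Y \<in> VF"
  shows "D X Y = D' X Y"
proof -
  have lc: "linear_connection L D'" "torsion_free L D'"
    "\<And>X Y Z. X \<in> VF \<Longrightarrow> Y \<in> VF \<Longrightarrow> Z \<in> VF \<Longrightarrow> cov_metric D' g X Y Z = (\<lambda>p. 0)"
    using D' unfolding levi_civita_def by auto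
  have VF': "D' X Y \<in> VF" if "X \<in> VF" "Y \<in> VF" for X Y
    using lc(1) that unfolding linear_connection_def by blast
  have tor: "E (linv x) (linv y) = vf_add (E (linv y) (linv x)) (linv (br x y))"
    if "torsion_free L E" for E x y
  proof -
    have "(\<lambda>f p. E (linv x) (linv y) f p - E (linv y) (linv x) f p) = linv (br x y)"
      using that linv_VF[of x] linv_VF[of y] unfolding torsion_free_def linv_br by blast
    from fun_cong[OF fun_cong[OF this]] show ?thesis by (auto simp: vf_add_def fun_eq_iff diff_eq_eq)
  qed
  define d where "d x y z p = g (D' (linv x) (linv y)) (linv z) p - g (linv (N x y)) (linv z) p" for x y z p
  have sym: "d x y z p = d y x z p" for x y z p
    unfolding d_def tor[OF lc(2), of x y] N[symmetric] tor[OF D(2), of x y]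
    unfolding N g_add[OF VF'[OF linv_VF linv_VF] linv_VF linv_VF] g_add[OF linv_VF linv_VF linv_VF] by simp
  have anti: "d x y z p = - d x z y p" for x y z p
  proof -
    have "g (D' (linv x) (linv y)) (linv z) p + g (linv y) (D' (linv x) (linv z)) p = 0"
      using fun_cong[OF lc(3)[OF linv_VF[of x] linv_VF[of y] linv_VF[of z]], of p]
      unfolding cov_metric_def g_linv VF_const_fn[OF linv_VF] by simp
    moreover have "g (linv (N x y)) (linv z) p + g (linv (N x z)) (linv y) p = 0"
      unfolding g_linv using parallel[of x y z] by (simp add: const_fn_def B_commute)
    moreover have "g (linv y) (D' (linv x) (linv z)) = g (D' (linv x) (linv z)) (linv y)"
      by (rule g_commute[OF linv_VF VF'[OF linv_VF linv_VF]])
    ultimately show ?thesis unfolding d_def by simp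
  qed
  have zero: "d x y z p = 0" for x y z p
    using sym[of x y z p] anti[of y x z p] sym[of y z x p] anti[of z y x p] sym[of z x y p] anti[of x z y p]
    by linarith
  have "D (linv x) (linv y) = D' (linv x) (linv y)" for x y
  proof (rule metric_nondegenerate)
    show "g (linv z) (D (linv x) (linv y)) = g (linv z) (D' (linv x) (linv y))" for z
    proof
      fix p show "g (linv z) (D (linv x) (linv y)) p = g (linv z) (D' (linv x) (linv y)) p"
        using zero[of x y z p] unfolding d_def N
          g_commute[OF linv_VF VF'[OF linv_VF linv_VF]] g_commute[OF linv_VF[of z] linv_VF] by simp
    qed
  qed (use N linv_VF VF' in auto)
  then show ?thesis by (rule connection_eqI[OF D(1) lc(1) _ XY])
qed

lemma dual_connection_coefficients:
  assumes dual: "dual_connection L g D D'" and N: "\<And>v w. D (linv v) (linv w) = linv (N v w)"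
    and N': "\<And>x y z. B y (N' x z) = - B (N x y) z"
  shows "D' (linv x) (linv z) = linv (N' x z)"
proof (rule metric_nondegenerate)
  show "D' (linv x) (linv z) \<in> VF"
    using dual linv_VF unfolding dual_connection_def linear_connection_def by blast
  show "linv (N' x z) \<in> VF" by (rule linv_VF)
  fix y
  have "linv x (g (linv y) (linv z)) = (\<lambda>p. g (D (linv x) (linv y)) (linv z) p + g (linv y) (D' (linv x) (linv z)) p)"
    using dual linv_VF[of x] linv_VF[of y] linv_VF[of z] unfolding dual_connection_def by blast
  from fun_cong[OF this] have "g (linv y) (D' (linv x) (linv z)) p = - const_fn (B (N x y) z) p" for p
    unfolding N g_linv VF_const_fn[OF linv_VF] by (simp add: eq_neg_iff_add_eq_0 add.commute)
  then show "g (linv y) (D' (linv x) (linv z)) = g (linv y) (linv (N' x z))"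
    unfolding g_linv N' by (auto simp: const_fn_def)
qed

lemma curvature_coefficients:
  assumes N: "\<And>v w. D (linv v) (linv w) = linv (N v w)"
  shows "curvature D (linv x) (linv y) (linv z) = linv (N x (N y z) - N y (N x z) - N (br x y) z)"
proof (intro ext)
  fix f p
  show "curvature D (linv x) (linv y) (linv z) f p = linv (N x (N y z) - N y (N x z) - N (br x y) z) f p"
    unfolding curvature_def N linv_br[symmetric] linear_diff[OF linv_linear] ..
qed

end

text \<open>The structure on the group becomes the algebraic data \<open>B\<close>, \<open>N\<close>, \<open>N'\<close> on the model space. If the cubic form
  vanished on the left invariant fields, \<open>nabla\<close> would be the Levi-Civita connection.\<close>

lemma conjugate_symmetric_frame:
  fixes G :: "('a, real^3) smooth_group"
  assumes G: "lie_group_chart G U \<phi>"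
    and trace: "\<And>v. (\<Sum>b\<in>Basis. lie_group_chart.br G U \<phi> v b \<bullet> b) = 0"
    and stat: "left_invariant_statistical_structure G g nabla"
    and lc: "levi_civita G g nabla_g"
    and ne: "\<exists>X\<in>vector_fields G. \<exists>Y\<in>vector_fields G. nabla X Y \<noteq> nabla_g X Y"
    and cs: "conjugate_symmetric G g nabla"
  obtains w :: "3 \<Rightarrow> real^3" and B l1 l2 l3 where "bilinear B" "\<And>i j. B (w i) (w j) = (if i = j then 1 else (0::real))"
    "lie_group_chart.br G U \<phi> (w 2) (w 3) = l1 *\<^sub>R w 1"
    "lie_group_chart.br G U \<phi> (w 3) (w 1) = l2 *\<^sub>R w 2"
    "lie_group_chart.br G U \<phi> (w 1) (w 2) = l3 *\<^sub>R w 3"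
    "(l1 * l2 > 0 \<and> l2 * l3 > 0) \<or> (l1 = 0 \<and> l2 = l3) \<or> (l2 = 0 \<and> l3 = l1) \<or> (l3 = 0 \<and> l1 = l2)"
proof -
  interpret lie_group_chart G U \<phi> by (rule G)
  interpret M: left_invariant_metric_chart G U \<phi> g
    using stat by unfold_locales (auto simp: left_invariant_statistical_structure_def)
  have D: "linear_connection G nabla" "left_invariant_connection G nabla" "torsion_free G nabla"
    and codazzi: "\<And>X Y Z. X \<in> VF \<Longrightarrow> Y \<in> VF \<Longrightarrow> Z \<in> VF \<Longrightarrow> cov_metric nabla g X Y Z = cov_metric nabla g Y X Z"
    using stat unfolding left_invariant_statistical_structure_def by auto
  obtain N where N: "\<And>v w. nabla (linv v) (linv w) = linv (N v w)" "bilinear N"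
    using M.invariant_connection_coefficients[OF D(1,2)] by blast
  obtain D' where D': "dual_connection G g nabla D'" and
    R: "\<And>X Y Z. X \<in> VF \<Longrightarrow> Y \<in> VF \<Longrightarrow> Z \<in> VF \<Longrightarrow> curvature nabla X Y Z = curvature D' X Y Z"
    using cs unfolding conjugate_symmetric_def by blast
  obtain u :: "3 \<Rightarrow> real^3" where u: "\<And>i j. M.B (u i) (u j) = (if i = j then 1 else 0)"
    using orthonormal_frame_exists[OF M.B_bilinear M.B_commute M.B_pos] by blast
  \<comment> \<open>The coefficients of the dual connection are forced by \<open>B y (N' x z) = - B (N x y) z\<close>.\<close>
  define N' where "N' x z = (\<Sum>k\<in>UNIV. (- M.B z (N x (u k))) *\<^sub>R u k)" for x z
  have Blin: "linear (\<lambda>x. M.B x y)" "linear (M.B y)" for y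
    using M.B_bilinear by (auto simp: bilinear_def)
  have N': "M.B y (N' x z) = - M.B (N x y) z" for x y z
  proof -
    have Nl: "linear (N x)" using N(2) by (simp add: bilinear_def)
    have "M.B (N x y) z = M.B z (N x (\<Sum>k\<in>UNIV. M.B y (u k) *\<^sub>R u k))"
      using orthonormal_expansion[OF M.B_bilinear u, of y] M.B_commute by metis
    also have "\<dots> = (\<Sum>k\<in>UNIV. M.B y (u k) * M.B z (N x (u k)))"
      by (simp add: linear_sum[OF Nl] linear_scale[OF Nl] linear_sum[OF Blin(2)] linear_scale[OF Blin(2)])
    finally show ?thesis
      unfolding N'_def
      by (simp add: linear_sum[OF Blin(2)] linear_scale[OF Blin(2)] sum_negf linear_neg[OF Blin(2)] mult.commute)
  qed
  note DN' = M.dual_connection_coefficients[OF D' N(1) N']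
  have N'b: "bilinear N'"
    using connection_bilinear[of D' N', OF _ DN'] D' unfolding dual_connection_def by blast
  have torsion: "N x y - N y x = br x y" for x y
  proof (rule linv_determined)
    fix f
    have "(\<lambda>f p. nabla (linv x) (linv y) f p - nabla (linv y) (linv x) f p) = linv (br x y)"
      using D(3) linv_VF[of x] linv_VF[of y] unfolding torsion_free_def linv_br by blast
    from fun_cong[OF fun_cong[OF this, of f], of "\<one>\<^bsub>G\<^esub>"]
    show "linv (N x y - N y x) f \<one>\<^bsub>G\<^esub> = linv (br x y) f \<one>\<^bsub>G\<^esub>"
      unfolding N linear_diff[OF linv_linear] .
  qed
  have cov: "cov_metric nabla g (linv x) (linv y) (linv z) \<one>\<^bsub>G\<^esub> = - (M.B (N x y) z + M.B y (N x z))" for x y z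
    unfolding cov_metric_def N M.g_linv VF_const_fn[OF linv_VF] by (simp add: const_fn_def)
  have sym: "M.B (N x y) z + M.B y (N x z) = M.B (N y x) z + M.B x (N y z)" for x y z
    using cov[of x y z] cov[of y x z] codazzi[OF linv_VF[of x] linv_VF[of y] linv_VF[of z]] by simp
  have curv: "N x (N y z) - N y (N x z) - N (br x y) z = N' x (N' y z) - N' y (N' x z) - N' (br x y) z" for x y z
    using R[OF linv_VF[of x] linv_VF[of y] linv_VF[of z]]
    unfolding M.curvature_coefficients[of nabla N, OF N(1)] M.curvature_coefficients[of D' N', OF DN']
    by (rule linv_inj)
  have "\<exists>x y z. M.B (N x y) z + M.B y (N x z) \<noteq> 0"
    using ne M.metric_connection_unique[OF D(1,3) lc N(1)] by blast
  then obtain x0 y0 z0 where nz: "M.B (N x0 y0) z0 + M.B y0 (N x0 z0) \<noteq> 0" by blast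
  have brb: "bilinear br" using br_linear_left br_linear_right by (simp add: bilinear_def)
  have dual: "M.B (N x y) z + M.B y (N' x z) = 0" for x y z by (simp add: N')
  show thesis
  proof (rule statistical_lie_algebra_classification[OF M.B_bilinear M.B_commute M.B_pos brb br_antisym trace
        N(2) N'b torsion dual sym curv nz])
    fix w :: "3 \<Rightarrow> real^3" and l1 l2 l3
    assume "\<And>i j. M.B (w i) (w j) = (if i = j then 1 else 0)" "br (w 2) (w 3) = l1 *\<^sub>R w 1"
      "br (w 3) (w 1) = l2 *\<^sub>R w 2" "br (w 1) (w 2) = l3 *\<^sub>R w 3"
      "(l1 * l2 > 0 \<and> l2 * l3 > 0) \<or> (l1 = 0 \<and> l2 = l3) \<or> (l2 = 0 \<and> l3 = l1) \<or> (l3 = 0 \<and> l1 = l2)"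
    then show thesis by (rule that[OF M.B_bilinear])
  qed
qed

section \<open>Embedded groups\<close>

lemma second_countable_euclidean: "second_countable (euclidean :: 'a::euclidean_space topology)"
proof -
  obtain B :: "'a set set" where B: "countable B" "topological_basis B"
    using ex_countable_basis by blast
  have "\<exists>V\<in>B. x \<in> V \<and> V \<subseteq> U" if "open U" "x \<in> U" for U :: "'a set" and x
    using topological_basisE[OF B(2) that] by blast
  then show ?thesis
    unfolding second_countable_def using B topological_basis_open[OF B(2)]
    by (intro exI[of _ B]) auto
qed

lemma open_preimage_openin:
  assumes "continuous_on S m" "open S" "m ` S \<subseteq> C" "openin (top_of_set C) W"
  shows "open {x \<in> S. m x \<in> W}"
proof -
  obtain T where T: "open T" "W = C \<inter> T" using assms(4) by (auto simp: openin_open)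
  have "{x \<in> S. m x \<in> W} = S \<inter> m -` T" using T assms(3) by auto
  then show ?thesis using continuous_open_preimage[OF assms(1,2) T(1)] by simp
qed

text \<open>A group in a Euclidean space whose operations are restrictions of smooth maps of the ambient
  space, with one chart at the unit: the linear projection \<open>F\<close>, whose inverse is
  \<open>x \<mapsto> sqrt (1 - \<parallel>\<rho> x\<parallel>\<^sup>2) e + \<Lambda> x\<close>. The multiplication is affine in each argument. This form
  covers the three models at once: the square root is the coordinate that is eliminated on a sphere.\<close>

locale model_group = group H for H :: "'a::euclidean_space monoid" (structure) +
  fixes P :: "'a \<Rightarrow> 'a \<Rightarrow> 'a" and \<alpha> \<beta> iv :: "'a \<Rightarrow> 'a"
    and F :: "'a \<Rightarrow> 'e::euclidean_space" and \<Lambda> :: "'e \<Rightarrow> 'a" and \<rho> :: "'e \<Rightarrow> 'e" and e :: 'a and U :: "'a set"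
  assumes P: "bounded_bilinear P" and \<alpha>: "bounded_linear \<alpha>" and \<beta>: "bounded_linear \<beta>"
    and mult_eq: "\<And>p q. p \<in> carrier H \<Longrightarrow> q \<in> carrier H \<Longrightarrow> p \<otimes> q = P p q + \<alpha> p + \<beta> q"
    and iv: "smooth_on UNIV iv" and inv_eq: "\<And>p. p \<in> carrier H \<Longrightarrow> inv p = iv p"
    and F: "bounded_linear F" and \<Lambda>: "bounded_linear \<Lambda>" and \<rho>: "bounded_linear \<rho>"
    and U: "openin (top_of_set (carrier H)) U" "\<one> \<in> U" and F_one: "F \<one> = 0"
    and section_mem: "\<And>x. \<rho> x \<bullet> \<rho> x < 1 \<Longrightarrow> sqrt (1 - \<rho> x \<bullet> \<rho> x) *\<^sub>R e + \<Lambda> x \<in> U"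
    and F_section: "\<And>x. \<rho> x \<bullet> \<rho> x < 1 \<Longrightarrow> F (sqrt (1 - \<rho> x \<bullet> \<rho> x) *\<^sub>R e + \<Lambda> x) = x"
    and section_F: "\<And>q. q \<in> U \<Longrightarrow> \<rho> (F q) \<bullet> \<rho> (F q) < 1 \<and>
          sqrt (1 - \<rho> (F q) \<bullet> \<rho> (F q)) *\<^sub>R e + \<Lambda> (F q) = q"
begin

definition L :: "('a, 'e) smooth_group" where "L = embedded_group H"

definition mu :: "'a \<Rightarrow> 'a \<Rightarrow> 'a" where "mu p q = P p q + \<alpha> p + \<beta> q"

definition sect :: "'e \<Rightarrow> 'a" where "sect x = sqrt (1 - \<rho> x \<bullet> \<rho> x) *\<^sub>R e + \<Lambda> x"

lemma L_simps: "carrier L = carrier H" "mult L = mult H" "one L = one H"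
  "gtop L = top_of_set (carrier H)"
  by (simp_all add: L_def embedded_group_def)

lemma charts_L: "(V, \<psi>) \<in> charts L \<longleftrightarrow> openin (top_of_set (carrier H)) V \<and> open (\<psi> ` V) \<and> inj_on \<psi> V \<and>
    smooth_on (\<psi> ` V) (inv_into V \<psi>) \<and>
    (\<forall>p\<in>V. \<exists>W F. open W \<and> p \<in> W \<and> smooth_on W F \<and> (\<forall>q\<in>V \<inter> W. F q = \<psi> q))"
  by (simp add: L_def embedded_group_def)

lemma inv_L: "inv\<^bsub>L\<^esub> p = inv p"
  by (simp add: m_inv_def L_simps)

lemma group_L: "group L"
proof (rule groupI)
  show "\<exists>y\<in>carrier L. y \<otimes>\<^bsub>L\<^esub> x = \<one>\<^bsub>L\<^esub>" if "x \<in> carrier L" for x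
    using that l_inv inv_closed unfolding L_simps by blast
qed (auto simp: L_simps m_assoc)

lemma mult_mu: "p \<in> carrier H \<Longrightarrow> q \<in> carrier H \<Longrightarrow> p \<otimes> q = mu p q"
  by (simp add: mu_def mult_eq)

lemma mu_smooth: "smooth_on UNIV (\<lambda>z. mu (fst z) (snd z))"
  unfolding mu_def
  by (intro smooth_on_add bounded_bilinear.smooth_on[OF P] smooth_on_compose_linear[OF \<alpha>]
      smooth_on_compose_linear[OF \<beta>] smooth_on_bounded_linear[OF bounded_linear_fst]
      smooth_on_bounded_linear[OF bounded_linear_snd] open_UNIV)

lemma mu_smooth_compose:
  assumes "open S" "smooth_on S (m :: 'x::real_normed_vector \<Rightarrow> 'a)" "smooth_on S n"
  shows "smooth_on S (\<lambda>x. mu (m x) (n x))"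
  using smooth_on_compose[OF assms(1) open_UNIV subset_UNIV mu_smooth smooth_on_Pair[OF assms]] by simp

lemma chart_L:
  assumes "(V, \<psi>) \<in> charts L"
  shows "V \<subseteq> carrier H" "open (\<psi> ` V)" "smooth_on (\<psi> ` V) (inv_into V \<psi>)"
    "\<And>x. x \<in> \<psi> ` V \<Longrightarrow> inv_into V \<psi> x \<in> V"
  using assms by (auto simp: charts_L inv_into_into dest: openin_imp_subset)

lemma chart_compose_smooth:
  assumes V: "(V, \<psi>) \<in> charts L" and S: "open S" and m: "smooth_on S m" "m ` S \<subseteq> V"
  shows "smooth_on S (\<lambda>x. \<psi> (m x))"
proof (rule smooth_on_local)
  fix x assume x: "x \<in> S"
  then have "m x \<in> V" using m by blast
  then obtain W F where W: "open W" "m x \<in> W" "smooth_on W F" "\<And>q. q \<in> V \<Longrightarrow> q \<in> W \<Longrightarrow> F q = \<psi> q"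
    using V unfolding charts_L by (metis IntI)
  let ?T = "S \<inter> m -` W"
  have o: "open ?T" by (rule continuous_open_preimage[OF smooth_on_continuous_on[OF m(1)] S W(1)])
  have "smooth_on ?T (\<lambda>x. F (m x))"
    by (rule smooth_on_compose[OF o W(1) _ W(3) smooth_on_subset[OF m(1)]]) auto
  then have "smooth_on ?T (\<lambda>x. \<psi> (m x))"
    by (rule smooth_on_cong[OF o, rotated]) (use W(4) m(2) in auto)
  then show "\<exists>T. open T \<and> x \<in> T \<and> smooth_on T (\<lambda>x. \<psi> (m x))" using o W(2) x by blast
qed

lemma chart_continuous:
  assumes V: "(V, \<psi>) \<in> charts L" shows "continuous_on V \<psi>"
  unfolding continuous_on_eq_continuous_within
proof
  fix p assume p: "p \<in> V"
  then obtain W F where W: "open W" "p \<in> W" "smooth_on W F" "\<And>q. q \<in> V \<inter> W \<Longrightarrow> F q = \<psi> q"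
    using V unfolding charts_L by metis
  have "continuous (at p) F"
    using smooth_on_continuous_on[OF W(3)] W(1,2) by (simp add: continuous_on_eq_continuous_at)
  then have "continuous (at p within V) F" by (rule continuous_at_imp_continuous_at_within)
  then show "continuous (at p within V) \<psi>"
    by (rule continuous_transform_within_openin[of _ _ _ "V \<inter> W"]) (use W p in \<open>auto simp: openin_open_Int\<close>)
qed

lemma chart_homeomorphic:
  assumes V: "(V, \<psi>) \<in> charts L"
  shows "homeomorphic_map (subtopology (gtop L) V) (top_of_set (\<psi> ` V)) \<psi>"
proof -
  have "subtopology (gtop L) V = top_of_set V"
    using chart_L(1)[OF V] by (simp add: L_simps subtopology_subtopology Int_absorb1)
  moreover have "homeomorphic_maps (top_of_set V) (top_of_set (\<psi> ` V)) \<psi> (inv_into V \<psi>)"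
    using V chart_continuous[OF V] smooth_on_continuous_on[OF chart_L(3)[OF V]]
    by (auto simp: homeomorphic_maps_def charts_L f_inv_into_f inv_into_into)
  ultimately show ?thesis using homeomorphic_maps_map by metis
qed

lemma sect_simps:
  "\<rho> x \<bullet> \<rho> x < 1 \<Longrightarrow> sect x \<in> U" "\<rho> x \<bullet> \<rho> x < 1 \<Longrightarrow> F (sect x) = x"
  "q \<in> U \<Longrightarrow> \<rho> (F q) \<bullet> \<rho> (F q) < 1" "q \<in> U \<Longrightarrow> sect (F q) = q"
  using section_mem F_section section_F unfolding sect_def by auto

lemma F_image: "F ` U = {x. \<rho> x \<bullet> \<rho> x < 1}"
proof (intro equalityI subsetI)
  fix x assume "x \<in> {x. \<rho> x \<bullet> \<rho> x < 1}"
  then show "x \<in> F ` U" using sect_simps(1,2)[of x] by (metis imageI mem_Collect_eq)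
qed (use sect_simps(3) in auto)

lemma F_inj: "inj_on F U"
  using sect_simps(4) by (rule inj_on_inverseI)

lemma F_image_open: "open (F ` U)"
proof -
  have "continuous_on UNIV (\<lambda>x. \<rho> x \<bullet> \<rho> x)"
    using \<rho> by (intro continuous_on_inner linear_continuous_on)
  from open_Collect_less[OF this continuous_on_const] show ?thesis by (simp add: F_image)
qed

lemma inv_into_F: "x \<in> F ` U \<Longrightarrow> inv_into U F x = sect x"
  using inv_into_f_f[OF F_inj] sect_simps(4) by auto

lemma smooth_sect: "smooth_on (F ` U) sect"
proof -
  have "smooth_on (F ` U) (\<lambda>x. sqrt (1 + (-1) * (\<rho> x \<bullet> \<rho> x)) *\<^sub>R e + \<Lambda> x)"
    by (intro smooth_on_add smooth_on_scaleR smooth_on_compose[OF _ _ _ smooth_on_sqrt] smooth_on_mult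
        smooth_on_inner smooth_on_const smooth_on_bounded_linear \<rho> \<Lambda> F_image_open open_greaterThan)
      (auto simp: F_image)
  then show ?thesis by (simp add: sect_def[abs_def])
qed

lemma unit_chart: "(U, F) \<in> charts L"
proof -
  have "smooth_on (F ` U) (inv_into U F)"
    by (rule smooth_on_cong[OF F_image_open _ smooth_sect]) (simp add: inv_into_F)
  then show ?thesis
    unfolding charts_L using U F_image_open F_inj smooth_on_bounded_linear[OF F, of UNIV] by blast
qed

lemma U_subset: "U \<subseteq> carrier H"
  using U(1) openin_imp_subset by blast

text \<open>Left translates of the chart at the unit cover the group.\<close>

lemma translated_chart:
  assumes a: "a \<in> carrier H"
  defines "V \<equiv> {q \<in> carrier H. mu (iv a) q \<in> U}" and "\<psi> \<equiv> \<lambda>q. F (mu (iv a) q)"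
  shows "(V, \<psi>) \<in> charts L" "a \<in> V"
proof -
  have mu_inv: "mu (iv a) q = inv a \<otimes> q" if "q \<in> carrier H" for q
    using that a by (simp add: mult_mu inv_eq[symmetric])
  have mu_sm: "smooth_on UNIV (\<lambda>q. mu (iv a) q)"
    by (rule mu_smooth_compose[OF open_UNIV smooth_on_const smooth_on_ident])
  have V1: "a \<otimes> u \<in> V" "mu (iv a) (a \<otimes> u) = u" if "u \<in> U" for u
  proof -
    have u: "u \<in> carrier H" using that U_subset by blast
    show *: "mu (iv a) (a \<otimes> u) = u" using a u by (simp add: mu_inv m_assoc[symmetric])
    then show "a \<otimes> u \<in> V" using a u that by (simp add: V_def)
  qed
  have V2: "q = a \<otimes> mu (iv a) q" if "q \<in> V" for q
    using that a by (simp add: V_def mu_inv m_assoc[symmetric])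
  have img: "\<psi> ` V = F ` U"
  proof (intro equalityI subsetI)
    fix x assume "x \<in> F ` U"
    then obtain u where u: "u \<in> U" "x = F u" by blast
    then have "x = \<psi> (a \<otimes> u)" using V1(2)[OF u(1)] by (simp add: \<psi>_def)
    then show "x \<in> \<psi> ` V" using V1(1)[OF u(1)] by blast
  qed (auto simp: \<psi>_def V_def)
  have "openin (top_of_set (carrier H)) (carrier H \<inter> (\<lambda>q. mu (iv a) q) -` U)"
  proof (rule continuous_openin_preimage[OF _ _ U(1)])
    show "continuous_on (carrier H) (mu (iv a))"
      using smooth_on_continuous_on[OF mu_sm] continuous_on_subset by blast
    show "mu (iv a) \<in> carrier H \<rightarrow> carrier H" using a by (auto simp: mu_inv)
  qed
  moreover have "carrier H \<inter> (\<lambda>q. mu (iv a) q) -` U = V" by (auto simp: V_def)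
  ultimately have oV: "openin (top_of_set (carrier H)) V" by simp
  have inj: "inj_on \<psi> V"
  proof (rule inj_onI)
    fix p q assume pq: "p \<in> V" "q \<in> V" "\<psi> p = \<psi> q"
    then have "mu (iv a) p = mu (iv a) q"
      using F_inj by (auto simp: \<psi>_def V_def dest: inj_onD)
    then show "p = q" using V2[OF pq(1)] V2[OF pq(2)] by simp
  qed
  have inv: "mu a (sect x) = inv_into V \<psi> x" if "x \<in> F ` U" for x
  proof -
    from that obtain u where u: "u \<in> U" "x = F u" by blast
    then have "u \<in> carrier H" using U_subset by blast
    then have "mu a (sect x) = a \<otimes> u" using u a by (simp add: sect_simps(4) mult_mu)
    moreover have "inv_into V \<psi> (\<psi> (a \<otimes> u)) = a \<otimes> u" by (rule inv_into_f_f[OF inj V1(1)[OF u(1)]])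
    moreover have "\<psi> (a \<otimes> u) = x" using V1(2)[OF u(1)] u by (simp add: \<psi>_def)
    ultimately show ?thesis by simp
  qed
  have "smooth_on (F ` U) (\<lambda>x. mu a (sect x))"
    by (rule mu_smooth_compose[OF F_image_open smooth_on_const smooth_sect])
  then have "smooth_on (F ` U) (inv_into V \<psi>)"
    by (rule smooth_on_cong[OF F_image_open, rotated]) (rule inv)
  moreover have "smooth_on UNIV \<psi>"
    unfolding \<psi>_def by (rule smooth_on_compose_linear[OF F open_UNIV mu_sm])
  ultimately show "(V, \<psi>) \<in> charts L"
    unfolding charts_L img using oV inj F_image_open by blast
  show "a \<in> V" using V1(1)[OF U(2)] a by simp
qed

lemma lie_group_L: "lie_group L"
proof (intro lie_group.intro group_L lie_group_axioms.intro)
  show "topspace (gtop L) = carrier L" by (simp add: L_simps)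
  show "Hausdorff_space (gtop L)"
    by (simp add: L_simps Hausdorff_space_subtopology)
  show "second_countable (gtop L)"
    by (simp add: L_simps second_countable_subtopology second_countable_euclidean)
  show "openin (gtop L) V \<and> open (\<psi> ` V) \<and> homeomorphic_map (subtopology (gtop L) V) (top_of_set (\<psi> ` V)) \<psi>"
    if "(V, \<psi>) \<in> charts L" for V \<psi>
    using that chart_homeomorphic[OF that] by (simp add: charts_L L_simps(4))
  show "\<Union> (fst ` charts L) = carrier L"
  proof (intro equalityI subsetI)
    fix p assume "p \<in> \<Union> (fst ` charts L)"
    then show "p \<in> carrier L" using chart_L(1) by (fastforce simp: L_simps)
  next
    fix p assume "p \<in> carrier L"
    then have "p \<in> carrier H" by (simp add: L_simps)
    from translated_chart[OF this] show "p \<in> \<Union> (fst ` charts L)" by force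
  qed
  have sm: "smooth_on (\<psi> ` V) (inv_into V \<psi>)" if "(V, \<psi>) \<in> charts L" for V and \<psi> :: "'a \<Rightarrow> 'e"
    by (rule chart_L(3)[OF that])
  show "smooth_on (\<phi> ` (V \<inter> W)) (\<lambda>x. \<psi> (inv_into V \<phi> x))"
    if V: "(V, \<phi>) \<in> charts L" and W: "(W, \<psi>) \<in> charts L" for V \<phi> W \<psi>
  proof -
    have inj: "inj_on \<phi> V" using V by (simp add: charts_L)
    have eq: "\<phi> ` (V \<inter> W) = {x \<in> \<phi> ` V. inv_into V \<phi> x \<in> W}"
      using inv_into_f_f[OF inj] by auto
    have "open (\<phi> ` (V \<inter> W))"
      unfolding eq using W chart_L[OF V]
      by (intro open_preimage_openin[OF smooth_on_continuous_on[OF sm[OF V]] chart_L(2)[OF V], of "carrier H"])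
        (auto simp: charts_L)
    then show ?thesis
      by (rule chart_compose_smooth[OF W _ smooth_on_subset[OF sm[OF V]]]) (auto simp: inv_into_f_f[OF inj])
  qed
  have "continuous_on (carrier H \<times> carrier H) (\<lambda>(p, q). p \<otimes> q)"
  proof (rule continuous_on_eq)
    show "continuous_on (carrier H \<times> carrier H) (\<lambda>z. mu (fst z) (snd z))"
      using smooth_on_continuous_on[OF mu_smooth] continuous_on_subset by blast
  qed (auto simp: mult_mu)
  then show "continuous_map (prod_topology (gtop L) (gtop L)) (gtop L) (\<lambda>(p, q). p \<otimes>\<^bsub>L\<^esub> q)"
    by (auto simp: L_simps subtopology_Times[symmetric] continuous_map_in_subtopology)
  show "smooth_on {(x, y). x \<in> \<phi> ` V \<and> y \<in> \<psi> ` W \<and> inv_into V \<phi> x \<otimes>\<^bsub>L\<^esub> inv_into W \<psi> y \<in> Z}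
      (\<lambda>(x, y). \<theta> (inv_into V \<phi> x \<otimes>\<^bsub>L\<^esub> inv_into W \<psi> y))"
    if V: "(V, \<phi>) \<in> charts L" and W: "(W, \<psi>) \<in> charts L" and Z: "(Z, \<theta>) \<in> charts L" for V \<phi> W \<psi> Z \<theta>
  proof -
    let ?m = "\<lambda>z. mu (inv_into V \<phi> (fst z)) (inv_into W \<psi> (snd z))"
    let ?D = "{z \<in> \<phi> ` V \<times> \<psi> ` W. ?m z \<in> Z}"
    have c1: "inv_into V \<phi> x \<in> carrier H" if "x \<in> \<phi> ` V" for x
      using chart_L(1,4)[OF V] that by blast
    have c2: "inv_into W \<psi> y \<in> carrier H" if "y \<in> \<psi> ` W" for y
      using chart_L(1,4)[OF W] that by blast
    note c = c1 c2
    have oVW: "open (\<phi> ` V \<times> \<psi> ` W)" by (intro open_Times chart_L(2) V W)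
    have m: "smooth_on (\<phi> ` V \<times> \<psi> ` W) ?m"
      by (intro mu_smooth_compose oVW smooth_on_compose[OF oVW chart_L(2)[OF V] _ sm[OF V]]
          smooth_on_compose[OF oVW chart_L(2)[OF W] _ sm[OF W]]
          smooth_on_bounded_linear bounded_linear_fst bounded_linear_snd) auto
    have mc: "?m ` (\<phi> ` V \<times> \<psi> ` W) \<subseteq> carrier H"
    proof (rule image_subsetI)
      fix z assume "z \<in> \<phi> ` V \<times> \<psi> ` W"
      then show "?m z \<in> carrier H"
        using c1[of "fst z"] c2[of "snd z"] by (simp add: mem_Times_iff mult_mu[symmetric])
    qed
    have oD: "open ?D"
      using Z by (intro open_preimage_openin[OF smooth_on_continuous_on[OF m] oVW mc]) (simp add: charts_L)
    have s: "smooth_on ?D (\<lambda>z. \<theta> (?m z))"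
      by (rule chart_compose_smooth[OF Z oD smooth_on_subset[OF m]]) auto
    have D: "{(x, y). x \<in> \<phi> ` V \<and> y \<in> \<psi> ` W \<and> inv_into V \<phi> x \<otimes>\<^bsub>L\<^esub> inv_into W \<psi> y \<in> Z} = ?D"
    proof (rule Set.set_eqI)
      fix z
      show "z \<in> {(x, y). x \<in> \<phi> ` V \<and> y \<in> \<psi> ` W \<and> inv_into V \<phi> x \<otimes>\<^bsub>L\<^esub> inv_into W \<psi> y \<in> Z} \<longleftrightarrow> z \<in> ?D"
        using c1[of "fst z"] c2[of "snd z"] by (cases z) (auto simp: L_simps mult_mu)
    qed
    show ?thesis
      unfolding D by (rule smooth_on_cong[OF oD _ s]) (use c in \<open>simp add: L_simps mult_mu mem_Times_iff case_prod_beta\<close>)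
  qed
  have "continuous_on (carrier H) (\<lambda>p. inv p)"
  proof (rule continuous_on_eq)
    show "continuous_on (carrier H) iv"
      using smooth_on_continuous_on[OF iv] continuous_on_subset by blast
  qed (simp add: inv_eq)
  then show "continuous_map (gtop L) (gtop L) (\<lambda>p. inv\<^bsub>L\<^esub> p)"
    by (auto simp: L_simps inv_L continuous_map_in_subtopology)
  show "smooth_on {x \<in> \<phi> ` V. inv\<^bsub>L\<^esub> (inv_into V \<phi> x) \<in> Z} (\<lambda>x. \<theta> (inv\<^bsub>L\<^esub> (inv_into V \<phi> x)))"
    if V: "(V, \<phi>) \<in> charts L" and Z: "(Z, \<theta>) \<in> charts L" for V \<phi> Z \<theta>
  proof -
    let ?m = "\<lambda>x. iv (inv_into V \<phi> x)"
    let ?D = "{x \<in> \<phi> ` V. ?m x \<in> Z}"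
    have c: "inv_into V \<phi> x \<in> carrier H" if "x \<in> \<phi> ` V" for x
      using chart_L(1,4)[OF V] that by blast
    have m: "smooth_on (\<phi> ` V) ?m"
      by (rule smooth_on_compose[OF chart_L(2)[OF V] open_UNIV subset_UNIV iv sm[OF V]])
    have mc: "?m ` (\<phi> ` V) \<subseteq> carrier H"
    proof (rule image_subsetI)
      fix x assume "x \<in> \<phi> ` V"
      then show "?m x \<in> carrier H" using c[of x] by (simp add: inv_eq[symmetric])
    qed
    have oD: "open ?D"
      using Z by (intro open_preimage_openin[OF smooth_on_continuous_on[OF m] chart_L(2)[OF V] mc]) (simp add: charts_L)
    have s: "smooth_on ?D (\<lambda>z. \<theta> (?m z))"
      by (rule chart_compose_smooth[OF Z oD smooth_on_subset[OF m]]) auto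
    have D: "{x \<in> \<phi> ` V. inv\<^bsub>L\<^esub> (inv_into V \<phi> x) \<in> Z} = ?D"
      using c by (simp add: inv_L inv_eq cong: conj_cong)
    show ?thesis
      unfolding D by (rule smooth_on_cong[OF oD _ s]) (use c in \<open>simp add: inv_L inv_eq\<close>)
  qed
qed

end

sublocale model_group \<subseteq> G: lie_group_chart L U F
  by (intro lie_group_chart.intro lie_group_L lie_group_chart_axioms.intro unit_chart)
    (simp add: L_simps U)

context model_group
begin

text \<open>The square root differs from \<open>1\<close> by terms of second order.\<close>

lemma sect_has_derivative: "(inv_into U F has_derivative \<Lambda>) (at 0)"
proof -
  have 0: "0 \<in> F ` U" using U(2) F_one by force
  have \<rho>0: "\<rho> 0 = 0" using \<rho> linear_0 bounded_linear.linear by blast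
  have \<rho>': "(\<rho> has_derivative \<rho>) (at 0)" "(\<Lambda> has_derivative \<Lambda>) (at 0)"
    using \<rho> \<Lambda> bounded_linear_imp_has_derivative by auto
  have "((\<lambda>x. \<rho> x \<bullet> \<rho> x) has_derivative (\<lambda>v. \<rho> 0 \<bullet> \<rho> v + \<rho> v \<bullet> \<rho> 0)) (at 0)"
    by (rule has_derivative_inner[OF \<rho>'(1) \<rho>'(1)])
  from has_derivative_diff[OF has_derivative_const this]
  have "((\<lambda>x. 1 - \<rho> x \<bullet> \<rho> x) has_derivative (\<lambda>v. 0)) (at 0)"
    by (simp add: \<rho>0)
  moreover have "(sqrt has_derivative (\<lambda>v. v * (inverse (sqrt (1 - \<rho> 0 \<bullet> \<rho> 0)) / 2))) (at (1 - \<rho> 0 \<bullet> \<rho> 0))"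
    by (rule has_derivative_eq_rhs[OF DERIV_real_sqrt[unfolded has_field_derivative_def]])
      (auto simp: \<rho>0)
  ultimately have "((\<lambda>x. sqrt (1 - \<rho> x \<bullet> \<rho> x)) has_derivative
      (\<lambda>v. 0 * (inverse (sqrt (1 - \<rho> 0 \<bullet> \<rho> 0)) / 2))) (at 0)"
    by (rule has_derivative_compose)
  from has_derivative_add[OF has_derivative_scaleR_left[OF this, of e] \<rho>'(2)]
  have "(sect has_derivative \<Lambda>) (at 0)" by (simp add: sect_def[abs_def])
  then show ?thesis
    by (rule has_derivative_transform_within_open[OF _ F_image_open 0]) (simp add: inv_into_F)
qed

text \<open>The restriction of an affine function of the ambient space; the left invariant fields preserve
  these functions.\<close>

definition amb :: "('a \<Rightarrow> real) \<Rightarrow> real \<Rightarrow> 'a \<Rightarrow> real" where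
  "amb l c p = (if p \<in> carrier H then l p + c else 0)"

lemma amb_SF: "bounded_linear l \<Longrightarrow> amb l c \<in> smooth_functions L"
proof (rule G.SF_I)
  fix V \<psi> assume l: "bounded_linear l" and V: "(V, \<psi>) \<in> charts L"
  have "smooth_on (\<psi> ` V) (\<lambda>x. l (inv_into V \<psi> x) + c)"
    by (intro smooth_on_add chart_L(2)[OF V] smooth_on_compose_linear[OF l] chart_L(3)[OF V] smooth_on_const)
  then show "smooth_on (\<psi> ` V) (\<lambda>x. amb l c (inv_into V \<psi> x))"
    by (rule smooth_on_cong[OF chart_L(2)[OF V], rotated]) (use chart_L(1,4)[OF V] in \<open>auto simp: amb_def\<close>)
qed (simp add: amb_def L_simps)

lemma linv_amb:
  assumes l: "bounded_linear l"
  shows "G.linv v (amb l c) = amb (\<lambda>p. l (P p (\<Lambda> v))) (l (\<beta> (\<Lambda> v)))"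
proof
  fix p show "G.linv v (amb l c) p = amb (\<lambda>p. l (P p (\<Lambda> v))) (l (\<beta> (\<Lambda> v))) p"
  proof (cases "p \<in> carrier H")
    case False
    then show ?thesis using G.VF_zero[OF G.linv_VF] by (simp add: amb_def L_simps)
  next
    case True
    have 0: "0 \<in> F ` U" using U(2) F_one by force
    have c: "inv_into U F x \<in> carrier H" if "x \<in> F ` U" for x
      using chart_L(1,4)[OF unit_chart] that by blast
    have "((\<lambda>x. l (mu p (inv_into U F x)) + c) has_derivative (\<lambda>v. l (P p (\<Lambda> v) + \<beta> (\<Lambda> v)))) (at 0)"
    proof -
      have "((\<lambda>x. P p (inv_into U F x)) has_derivative (\<lambda>v. P p (\<Lambda> v))) (at 0)"
        using bounded_linear.has_derivative[OF bounded_bilinear.bounded_linear_right[OF P] sect_has_derivative] .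
      moreover have "((\<lambda>x. \<beta> (inv_into U F x)) has_derivative (\<lambda>v. \<beta> (\<Lambda> v))) (at 0)"
        using bounded_linear.has_derivative[OF \<beta> sect_has_derivative] .
      ultimately have "((\<lambda>x. mu p (inv_into U F x)) has_derivative (\<lambda>v. P p (\<Lambda> v) + \<beta> (\<Lambda> v))) (at 0)"
        unfolding mu_def by (auto intro!: derivative_eq_intros)
      from bounded_linear.has_derivative[OF l this] show ?thesis
        by (auto intro!: derivative_eq_intros)
    qed
    then have "((\<lambda>x. amb l c (p \<otimes>\<^bsub>L\<^esub> inv_into U F x)) has_derivative (\<lambda>v. l (P p (\<Lambda> v) + \<beta> (\<Lambda> v)))) (at 0)"
      by (rule has_derivative_transform_within_open[OF _ F_image_open 0])
        (use True c in \<open>simp add: amb_def L_simps mult_mu[symmetric]\<close>)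
    from frechet_derivative_at[OF this, symmetric]
    have "G.linv v (amb l c) p = l (P p (\<Lambda> v) + \<beta> (\<Lambda> v))"
      using True by (subst G.linv_eq[OF amb_SF[OF l]]) (simp_all add: L_simps F_one)
    then show ?thesis
      using True l by (simp add: amb_def bounded_linear.linear linear_add)
  qed
qed

lemma amb_one: "bounded_linear l \<Longrightarrow> amb (\<lambda>p. l (P p (\<Lambda> v))) (l (\<beta> (\<Lambda> v))) \<one> = l (\<Lambda> v)"
proof -
  assume l: "bounded_linear l"
  have 0: "0 \<in> F ` U" using U(2) F_one by force
  have "((\<lambda>x. l (inv_into U F x) + 0) has_derivative (\<lambda>v. l (\<Lambda> v))) (at 0)"
    using bounded_linear.has_derivative[OF l sect_has_derivative] by simp
  then have "((\<lambda>x. amb l 0 (inv_into U F x)) has_derivative (\<lambda>v. l (\<Lambda> v))) (at 0)"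
    by (rule has_derivative_transform_within_open[OF _ F_image_open 0])
      (use chart_L(1,4)[OF unit_chart] in \<open>auto simp: amb_def\<close>)
  from frechet_derivative_at[OF this, symmetric] have "G.linv v (amb l 0) \<one>\<^bsub>L\<^esub> = l (\<Lambda> v)"
    by (subst G.linv_one(1)[OF amb_SF[OF l]]) (simp add: L_simps F_one)
  then show ?thesis by (simp add: linv_amb[OF l] L_simps)
qed

text \<open>On a linear function of the ambient space a left invariant field is easily computed, and the
  linear functions separate the tangent vectors: the bracket is the commutator of \<open>P\<close>.\<close>

lemma bracket_eq: "G.br u v = F (P (\<Lambda> u) (\<Lambda> v) - P (\<Lambda> v) (\<Lambda> u))"
proof -
  have F\<Lambda>: "F (\<Lambda> x) = x" for x
  proof -
    have 0: "0 \<in> F ` U" using U(2) F_one by force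
    have "((\<lambda>x. F (inv_into U F x)) has_derivative (\<lambda>v. F (\<Lambda> v))) (at 0)"
      by (rule bounded_linear.has_derivative[OF F sect_has_derivative])
    moreover have "((\<lambda>x. F (inv_into U F x)) has_derivative (\<lambda>v. v)) (at 0)"
      by (rule has_derivative_transform_within_open[OF has_derivative_ident F_image_open 0])
        (simp add: f_inv_into_f)
    ultimately have "(\<lambda>v. F (\<Lambda> v)) = (\<lambda>v. v)" by (rule has_derivative_unique)
    then show ?thesis by metis
  qed
  have "\<Lambda> (G.br u v) = P (\<Lambda> u) (\<Lambda> v) - P (\<Lambda> v) (\<Lambda> u)"
  proof (rule euclidean_eqI)
    fix b :: 'a
    define l where "l = (\<lambda>p::'a. p \<bullet> b)"
    have l: "bounded_linear l" unfolding l_def by (rule bounded_linear_inner_left)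
    have one: "\<one>\<^bsub>L\<^esub> = \<one>" by (simp add: L_simps)
    have lP: "bounded_linear (\<lambda>p. l (P p z))" for z
      using bounded_linear_compose[OF l bounded_bilinear.bounded_linear_left[OF P]] .
    have tw: "G.linv x (G.linv y (amb l 0)) \<one> = l (P (\<Lambda> x) (\<Lambda> y))" for x y
      unfolding linv_amb[OF l] linv_amb[OF lP] by (rule amb_one[OF lP])
    have "l (\<Lambda> (G.br u v)) = G.linv (G.br u v) (amb l 0) \<one>"
      unfolding linv_amb[OF l] amb_one[OF l] ..
    also have "\<dots> = l (P (\<Lambda> u) (\<Lambda> v)) - l (P (\<Lambda> v) (\<Lambda> u))"
      by (simp add: G.linv_br lie_bracket_def tw)
    finally show "\<Lambda> (G.br u v) \<bullet> b = (P (\<Lambda> u) (\<Lambda> v) - P (\<Lambda> v) (\<Lambda> u)) \<bullet> b"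
      by (simp add: l_def inner_diff_left)
  qed
  then show ?thesis using F\<Lambda> by metis
qed

end

subsection \<open>The three models\<close>

text \<open>The chart is the identity: the square root in its inverse is multiplied by \<open>0\<close>.\<close>

lemma R3_chart:
  obtains U :: "(real^3) set" and F :: "real^3 \<Rightarrow> real^3" where "lie_group_chart R3 U F"
    "\<And>u v. lie_group_chart.br R3 U F u v = 0"
proof -
  let ?H = "\<lparr>carrier = UNIV, mult = (+), one = 0\<rparr> :: (real^3) monoid"
  have grp: "group ?H"
    by (rule groupI) (auto intro: exI[of _ "- _"] left_minus)
  have inv: "m_inv ?H p = - p" for p
    by (rule group.inv_equality[OF grp]) auto
  have minus: "smooth_on UNIV (uminus :: real^3 \<Rightarrow> real^3)"
    using smooth_on_bounded_linear[OF bounded_linear_minus[OF bounded_linear_ident], of UNIV] by simp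
  interpret M: model_group ?H "\<lambda>_ _. 0" "\<lambda>p. p" "\<lambda>p. p" uminus "\<lambda>p. p :: real^3" "\<lambda>p. p" "\<lambda>_. 0" 0 UNIV
    by (intro model_group.intro grp model_group_axioms.intro)
      (auto simp: inv bounded_bilinear_def intro: minus bounded_linear_ident bounded_linear_zero exI[of _ 0])
  have "M.L = R3" by (simp add: M.L_def R3_def)
  then show thesis
    using that[of UNIV "\<lambda>p. p"] M.G.lie_group_chart_axioms M.bracket_eq by simp
qed

lemma matrix_2_eq:
  fixes A B :: "'a^2^2"
  shows "A = B \<longleftrightarrow> A$1$1 = B$1$1 \<and> A$1$2 = B$1$2 \<and> A$2$1 = B$2$1 \<and> A$2$2 = B$2$2"
  by (auto simp: vec_eq_iff forall_2)

lemma mult_2: "(A ** B) $ i $ j = A$i$1 * B$1$j + A$i$2 * B$2$j" for A :: "'a::semiring_1^2^2"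
  by (simp add: matrix_matrix_mult_def sum_2)

lemma mat_2: "(mat 1 :: 'a::semiring_1^2^2) $ 1 $ 1 = 1" "(mat 1 :: 'a^2^2) $ 1 $ 2 = 0"
  "(mat 1 :: 'a^2^2) $ 2 $ 1 = 0" "(mat 1 :: 'a^2^2) $ 2 $ 2 = 1"
  by (simp_all add: mat_def)

text \<open>For an orthogonal matrix of determinant \<open>1\<close> the transpose is the adjugate matrix; this gives the
  entries in the second column.\<close>

lemma rotation_2:
  fixes A :: "real^2^2"
  shows "orthogonal_matrix A \<and> det A = 1 \<longleftrightarrow> A$2$2 = A$1$1 \<and> A$1$2 = - A$2$1 \<and> (A$1$1)\<^sup>2 + (A$2$1)\<^sup>2 = 1"
proof
  assume a: "orthogonal_matrix A \<and> det A = 1"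
  define p q r s where "p = A$1$1" and "q = A$1$2" and "r = A$2$1" and "s = A$2$2"
  have e: "p * p + r * r = 1" "q * q + s * s = 1" "p * q + r * s = 0" "p * s - q * r = 1"
    using a by (auto simp: orthogonal_matrix matrix_2_eq mult_2 mat_2 transpose_def det_2 p_def q_def r_def s_def)
  have "s = (p * p + r * r) * s" using e by simp
  also have "\<dots> = p * (p * s - q * r) + r * (p * q + r * s)" by (simp add: algebra_simps)
  finally have s: "s = p" using e by simp
  have "q = (p * p + r * r) * q" using e by simp
  also have "\<dots> = p * (p * q + r * s) - r * (p * s - q * r)" by (simp add: algebra_simps)
  finally have "q = - r" using e by simp
  then show "A$2$2 = A$1$1 \<and> A$1$2 = - A$2$1 \<and> (A$1$1)\<^sup>2 + (A$2$1)\<^sup>2 = 1"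
    using s e(1) by (simp add: p_def q_def r_def s_def power2_eq_square)
qed (auto simp: orthogonal_matrix matrix_2_eq mult_2 mat_2 transpose_def det_2 power2_eq_square algebra_simps)

text \<open>The coordinates are the sine of the angle and the translation vector; the cosine is the square root
  in the inverse chart.\<close>

lemma E2_chart:
  obtains U :: "((real^2^2) \<times> (real^2)) set" and F :: "(real^2^2) \<times> (real^2) \<Rightarrow> real^3"
  where "lie_group_chart E2 U F"
    "\<And>u v. lie_group_chart.br E2 U F u v = vector [0, cross3 u v $ 2, cross3 u v $ 3]"
proof -
  let ?C = "{(A, v). orthogonal_matrix A \<and> det A = 1} :: ((real^2^2) \<times> (real^2)) set"
  let ?H = "\<lparr>carrier = ?C, mult = (\<lambda>(A, v) (B, w). (A ** B, v + A *v w)), one = (mat 1, 0)\<rparr>"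
  let ?P = "\<lambda>(p :: (real^2^2) \<times> (real^2)) q. (fst p ** fst q, fst p *v snd q)"
  let ?\<alpha> = "\<lambda>p :: (real^2^2) \<times> (real^2). (0, snd p) :: (real^2^2) \<times> (real^2)"
  let ?iv = "\<lambda>p :: (real^2^2) \<times> (real^2). (transpose (fst p), - (transpose (fst p) *v snd p))"
  let ?F = "\<lambda>p :: (real^2^2) \<times> (real^2). vector [fst p $ 2 $ 1, snd p $ 1, snd p $ 2] :: real^3"
  let ?\<Lambda> = "\<lambda>x :: real^3. (vector [vector [0, - x$1], vector [x$1, 0]], vector [x$2, x$3]) :: (real^2^2) \<times> (real^2)"
  let ?\<rho> = "\<lambda>x :: real^3. vector [x$1, 0, 0] :: real^3"
  let ?e = "(mat 1, 0) :: (real^2^2) \<times> (real^2)"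
  let ?U = "{p \<in> ?C. fst p $ 1 $ 1 > 0}"
  have C: "p \<in> ?C \<longleftrightarrow> fst p $2$2 = fst p $1$1 \<and> fst p $1$2 = - fst p $2$1 \<and> (fst p $1$1)\<^sup>2 + (fst p $2$1)\<^sup>2 = 1"
    for p using rotation_2[of "fst p"] by (cases p) simp
  have oc: "orthogonal_matrix A \<Longrightarrow> transpose A ** A = mat 1" for A :: "real^2^2"
    by (simp add: orthogonal_matrix)
  have one: "(mat 1, 0) \<in> ?C" by (simp add: orthogonal_matrix_id)
  have tr: "?iv p \<in> ?C" if "p \<in> ?C" for p
    using that by (cases p) (auto simp: orthogonal_matrix_transpose det_transpose)
  have left: "?iv p \<otimes>\<^bsub>?H\<^esub> p = (mat 1, 0)" if "p \<in> ?C" for p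
    using that oc by (cases p) auto
  have grp: "group ?H"
  proof (rule groupI)
    show "x \<otimes>\<^bsub>?H\<^esub> y \<in> carrier ?H" if "x \<in> carrier ?H" "y \<in> carrier ?H" for x y
      using that by (cases x; cases y) (auto simp: orthogonal_matrix_mul det_mul)
    show "\<exists>y\<in>carrier ?H. y \<otimes>\<^bsub>?H\<^esub> x = \<one>\<^bsub>?H\<^esub>" if "x \<in> carrier ?H" for x
      using tr[of x] left[of x] that by (intro bexI[of _ "?iv x"]) auto
  qed (use one in \<open>auto simp: matrix_mul_assoc matrix_vector_mul_assoc matrix_vector_right_distrib add.assoc\<close>)
  have inv: "m_inv ?H p = ?iv p" if "p \<in> ?C" for p
    by (rule group.inv_equality[OF grp]) (use that left tr in auto)
  have Pbl: "bounded_bilinear ?P"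
    unfolding bilinear_conv_bounded_bilinear[symmetric] bilinear_def linear_iff
    by (auto simp: vec_eq_iff matrix_matrix_mult_def matrix_vector_mult_def sum_2 algebra_simps)
  have lin: "bounded_linear ?\<alpha>" "bounded_linear ?F" "bounded_linear ?\<Lambda>" "bounded_linear ?\<rho>"
    unfolding linear_conv_bounded_linear[symmetric] linear_iff
    by (auto simp: vec_eq_iff forall_3 forall_2 vector_3 vector_2 transpose_def algebra_simps)
  have Tp: "bounded_linear (\<lambda>p :: (real^2^2) \<times> (real^2). (transpose (fst p), snd p))"
    unfolding linear_conv_bounded_linear[symmetric] linear_iff
    by (auto simp: vec_eq_iff transpose_def)
  have ivs: "smooth_on UNIV ?iv"
  proof -
    \<comment> \<open>The inverse is the bilinear map \<open>P\<close>, applied to two affine images of \<open>p\<close>.\<close>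
    have "smooth_on UNIV (\<lambda>p. ?P (transpose (fst p), snd p) (mat 1, - snd p))"
      by (intro bounded_bilinear.smooth_on[OF Pbl] smooth_on_Pair smooth_on_bounded_linear[OF Tp(1)]
          smooth_on_const smooth_on_bounded_linear open_UNIV bounded_linear_minus bounded_linear_snd)
    then show ?thesis by (simp add: linear_neg[OF matrix_vector_mul_linear])
  qed
  interpret M: model_group ?H ?P ?\<alpha> "\<lambda>_. 0" ?iv ?F ?\<Lambda> ?\<rho> ?e ?U
  proof (intro model_group.intro grp model_group_axioms.intro Pbl lin ivs bounded_linear_zero)
    show "p \<otimes>\<^bsub>?H\<^esub> q = ?P p q + ?\<alpha> p + 0" for p q by (cases p; cases q) simp
    show "inv\<^bsub>?H\<^esub> p = ?iv p" if "p \<in> carrier ?H" for p using inv that by simp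
    have "open {p :: (real^2^2) \<times> (real^2). 0 < fst p $ 1 $ 1}"
      by (intro open_Collect_less continuous_intros)
    then have "openin (top_of_set ?C) (?C \<inter> {p. 0 < fst p $ 1 $ 1})" by (rule openin_open_Int)
    moreover have "?C \<inter> {p. 0 < fst p $ 1 $ 1} = ?U" by blast
    ultimately show "openin (top_of_set (carrier ?H)) ?U" by simp
    show "\<one>\<^bsub>?H\<^esub> \<in> ?U" using one by (simp add: mat_2)
    show "?F \<one>\<^bsub>?H\<^esub> = 0" by (simp add: vec_eq_iff forall_3 vector_3 mat_2)
    have \<rho>: "?\<rho> x \<bullet> ?\<rho> x = (x$1)\<^sup>2" for x
      by (simp add: inner_vec_def sum_3 vector_3 power2_eq_square)
    show "sqrt (1 - ?\<rho> x \<bullet> ?\<rho> x) *\<^sub>R ?e + ?\<Lambda> x \<in> ?U" if "?\<rho> x \<bullet> ?\<rho> x < 1" for x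
      using that unfolding \<rho> by (simp add: C mat_2 vector_2 del: mem_Collect_eq) (simp add: C[unfolded mem_Collect_eq] mat_2 vector_2)
    show "?F (sqrt (1 - ?\<rho> x \<bullet> ?\<rho> x) *\<^sub>R ?e + ?\<Lambda> x) = x" if "?\<rho> x \<bullet> ?\<rho> x < 1" for x
      by (simp add: vec_eq_iff forall_3 vector_3 vector_2 mat_2)
    show "?\<rho> (?F q) \<bullet> ?\<rho> (?F q) < 1 \<and> sqrt (1 - ?\<rho> (?F q) \<bullet> ?\<rho> (?F q)) *\<^sub>R ?e + ?\<Lambda> (?F q) = q"
      if "q \<in> ?U" for q
    proof -
      have q: "q \<in> ?C" "fst q $1$1 > 0" using that by auto
      then have *: "(fst q $ 1 $ 1)\<^sup>2 = 1 - (fst q $ 2 $ 1)\<^sup>2" unfolding C by simp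
      then have "sqrt (1 - (fst q $ 2 $ 1)\<^sup>2) = fst q $ 1 $ 1"
        using q(2) real_sqrt_unique by (metis less_imp_le)
      moreover have "(fst q $ 2 $ 1)\<^sup>2 < 1" using * q(2) zero_less_power[OF q(2), of 2] by linarith
      ultimately show ?thesis
        using q(1) unfolding C \<rho>
        by (cases q) (simp add: vec_eq_iff forall_2 vector_3 vector_2 mat_2)
    qed
  qed
  have "M.L = E2" by (simp add: M.L_def E2_def)
  moreover have "M.G.br u v = vector [0, cross3 u v $ 2, cross3 u v $ 3]" for u v
    unfolding M.bracket_eq
    by (simp add: vec_eq_iff forall_3 vector_3 vector_2 mult_2 cross3_def matrix_vector_mult_def sum_2)
  ultimately show thesis
    using that[of ?U ?F] M.G.lie_group_chart_axioms by simp
qed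

text \<open>The group is the unit sphere of the quaternions, and the coordinates are the imaginary parts.\<close>

lemma SU2_chart:
  obtains U :: "(complex^2^2) set" and F :: "complex^2^2 \<Rightarrow> real^3"
  where "lie_group_chart SU2 U F" "\<And>u v. lie_group_chart.br SU2 U F u v = (-2) *\<^sub>R cross3 u v"
proof -
  let ?adj = "\<lambda>A :: complex^2^2. (\<chi> i j. cnj (A $ j $ i)) :: complex^2^2"
  let ?C = "{A. A ** (\<chi> i j. cnj (A $ j $ i)) = mat 1 \<and> det A = 1} :: (complex^2^2) set"
  let ?H = "\<lparr>carrier = ?C, mult = (**), one = mat 1\<rparr>"
  let ?F = "\<lambda>A :: complex^2^2. vector [Im (A$1$1), Re (A$2$1), Im (A$2$1)] :: real^3"
  let ?\<Lambda> = "\<lambda>x :: real^3. vector [vector [Complex 0 (x$1), Complex (- (x$2)) (x$3)],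
      vector [Complex (x$2) (x$3), Complex 0 (- (x$1))]] :: complex^2^2"
  let ?U = "{A \<in> ?C. Re (A $ 1 $ 1) > 0}"
  have C: "A \<in> ?C \<longleftrightarrow> A$2$2 = cnj (A$1$1) \<and> A$1$2 = - cnj (A$2$1) \<and>
      (Re (A$1$1))\<^sup>2 + (Im (A$1$1))\<^sup>2 + (Re (A$2$1))\<^sup>2 + (Im (A$2$1))\<^sup>2 = 1" (is "_ \<longleftrightarrow> ?R A") for A
  proof
    assume a: "A \<in> ?C"
    define p q r s where "p = A$1$1" and "q = A$1$2" and "r = A$2$1" and "s = A$2$2"
    have e: "p * cnj p + q * cnj q = 1" "p * cnj r + q * cnj s = 0" "r * cnj p + s * cnj q = 0"
      "r * cnj r + s * cnj s = 1" "p * s - q * r = 1"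
      using a by (auto simp: matrix_2_eq mult_2 mat_2 det_2 p_def q_def r_def s_def)
    have "cnj p = cnj p * (p * s - q * r)" using e by simp
    also have "\<dots> = s * (p * cnj p + q * cnj q) - q * (r * cnj p + s * cnj q)" by (simp add: algebra_simps)
    finally have s: "cnj p = s" using e by simp
    have "cnj r = cnj r * (p * s - q * r)" using e by simp
    also have "\<dots> = s * (p * cnj r + q * cnj s) - q * (r * cnj r + s * cnj s)" by (simp add: algebra_simps)
    finally have q: "cnj r = - q" using e by simp
    have q': "q = - cnj r" using q by simp
    have "p * cnj p + r * cnj r = 1"
      using e(5) unfolding s[symmetric] q' by (simp add: mult.commute)
    then have "Re (p * cnj p + r * cnj r) = 1" by simp
    then have "(Re p)\<^sup>2 + (Im p)\<^sup>2 + (Re r)\<^sup>2 + (Im r)\<^sup>2 = 1"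
      by (simp add: power2_eq_square)
    then show "?R A"
      using s q' by (simp add: p_def q_def r_def s_def)
  next
    assume "?R A"
    then show "A \<in> ?C"
      by (simp add: matrix_2_eq mult_2 mat_2 det_2 complex_eq_iff power2_eq_square algebra_simps)
  qed
  have adj_mult: "?adj (A ** B) = ?adj B ** ?adj A" for A B
    by (simp add: matrix_2_eq mult_2 mult.commute)
  have adj_C: "?adj A \<in> ?C" if "A \<in> ?C" for A
    using that by (simp only: C) (simp add: algebra_simps)
  have left: "?adj A ** A = mat 1" if "A \<in> ?C" for A
    using that matrix_left_right_inverse by blast
  have one: "mat 1 \<in> ?C" by (simp only: C) (simp add: mat_2)
  have mul: "A ** B \<in> ?C" if "A \<in> ?C" "B \<in> ?C" for A B
  proof -
    have "(A ** B) ** ?adj (A ** B) = A ** (B ** ?adj B) ** ?adj A"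
      unfolding adj_mult by (simp only: matrix_mul_assoc)
    also have "\<dots> = mat 1" using that by simp
    finally show ?thesis using that by (simp add: det_mul)
  qed
  have grp: "group ?H"
  proof (rule groupI)
    show "x \<otimes>\<^bsub>?H\<^esub> y \<in> carrier ?H" if "x \<in> carrier ?H" "y \<in> carrier ?H" for x y
      using mul that by simp
    show "\<exists>y\<in>carrier ?H. y \<otimes>\<^bsub>?H\<^esub> x = \<one>\<^bsub>?H\<^esub>" if "x \<in> carrier ?H" for x
      using adj_C[of x] left[of x] that by (intro bexI[of _ "?adj x"]) auto
  qed (use one in \<open>auto simp: matrix_mul_assoc\<close>)
  have inv: "m_inv ?H A = ?adj A" if "A \<in> ?C" for A
    by (rule group.inv_equality[OF grp]) (use that left adj_C in auto)
  have Pbl: "bounded_bilinear ((**) :: complex^2^2 \<Rightarrow> complex^2^2 \<Rightarrow> complex^2^2)"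
    unfolding bilinear_conv_bounded_bilinear[symmetric] bilinear_def linear_iff
    by (auto simp: matrix_2_eq mult_2 algebra_simps)
  have lin: "bounded_linear ?F" "bounded_linear ?\<Lambda>" "bounded_linear ?adj"
    unfolding linear_conv_bounded_linear[symmetric] linear_iff
    by (auto simp: vec_eq_iff forall_3 forall_2 vector_3 vector_2 complex_eq_iff)
  interpret M: model_group ?H "(**)" "\<lambda>_. 0" "\<lambda>_. 0" ?adj ?F ?\<Lambda> "\<lambda>x. x" "mat 1" ?U
  proof (intro model_group.intro grp model_group_axioms.intro Pbl lin bounded_linear_zero bounded_linear_ident
      smooth_on_bounded_linear)
    show "p \<otimes>\<^bsub>?H\<^esub> q = p ** q + 0 + 0" for p q by simp
    show "inv\<^bsub>?H\<^esub> p = ?adj p" if "p \<in> carrier ?H" for p using inv that by simp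
    have "open {A :: complex^2^2. 0 < Re (A $ 1 $ 1)}"
      by (intro open_Collect_less continuous_intros)
    then have "openin (top_of_set ?C) (?C \<inter> {A. 0 < Re (A $ 1 $ 1)})" by (rule openin_open_Int)
    moreover have "?C \<inter> {A. 0 < Re (A $ 1 $ 1)} = ?U" by blast
    ultimately show "openin (top_of_set (carrier ?H)) ?U" by simp
    show "\<one>\<^bsub>?H\<^esub> \<in> ?U" using one by (simp add: mat_2)
    show "?F \<one>\<^bsub>?H\<^esub> = 0" by (simp add: vec_eq_iff forall_3 vector_3 mat_2)
    have xx: "x \<bullet> x = (x$1)\<^sup>2 + (x$2)\<^sup>2 + (x$3)\<^sup>2" for x :: "real^3"
      by (simp add: inner_vec_def sum_3 power2_eq_square)
    show "sqrt (1 - x \<bullet> x) *\<^sub>R mat 1 + ?\<Lambda> x \<in> ?U" if "x \<bullet> x < 1" for x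
    proof -
      have "sqrt (1 - x \<bullet> x) *\<^sub>R mat 1 + ?\<Lambda> x \<in> ?C"
        using that unfolding C by (simp add: mat_2 vector_2 complex_eq_iff xx)
      moreover have "0 < Re ((sqrt (1 - x \<bullet> x) *\<^sub>R mat 1 + ?\<Lambda> x) $ 1 $ 1)"
        using that by (simp add: mat_2 vector_2)
      ultimately show ?thesis by blast
    qed
    show "?F (sqrt (1 - x \<bullet> x) *\<^sub>R mat 1 + ?\<Lambda> x) = x" if "x \<bullet> x < 1" for x
      by (simp add: vec_eq_iff forall_3 vector_3 vector_2 mat_2)
    show "?F q \<bullet> ?F q < 1 \<and> sqrt (1 - ?F q \<bullet> ?F q) *\<^sub>R mat 1 + ?\<Lambda> (?F q) = q"
      if "q \<in> ?U" for q
    proof -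
      have q: "q \<in> ?C" "Re (q$1$1) > 0" using that by auto
      have *: "1 - ?F q \<bullet> ?F q = (Re (q$1$1))\<^sup>2"
        using q(1) unfolding C xx by (simp add: vector_3)
      then have "sqrt (1 - ?F q \<bullet> ?F q) = Re (q$1$1)" using q(2) by simp
      moreover have "?F q \<bullet> ?F q < 1" using * zero_less_power[OF q(2), of 2] by linarith
      ultimately show ?thesis
        using q(1) unfolding C by (simp add: matrix_2_eq vector_3 vector_2 mat_2 complex_eq_iff)
    qed
  qed
  have "M.L = SU2" by (simp add: M.L_def SU2_def)
  moreover have "M.G.br u v = (-2) *\<^sub>R cross3 u v" for u v
    unfolding M.bracket_eq
    by (simp add: vec_eq_iff forall_3 vector_3 vector_2 mult_2 cross3_def)
  ultimately show thesis
    using that[of ?U ?F] M.G.lie_group_chart_axioms by simp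
qed

section \<open>Local isomorphisms\<close>

lemma locally_isomorphicI:
  fixes T :: "'e::euclidean_space \<Rightarrow> 'd::euclidean_space"
  assumes L: "lie_group_chart (L :: ('a, 'd) smooth_group) U \<phi>" and M: "lie_group_chart (M :: ('b, 'e) smooth_group) V \<psi>"
    and T: "linear T" "bij T"
    and hom: "\<And>a b. T (lie_group_chart.br M V \<psi> a b) = lie_group_chart.br L U \<phi> (T a) (T b)"
  shows "locally_isomorphic L M"
proof -
  interpret A: lie_group_chart L U \<phi> by (rule L)
  interpret C: lie_group_chart M V \<psi> by (rule M)
  define S where "S = inv_into UNIV T"
  have ST: "S (T x) = x" "T (S y) = y" for x y
    using T(2) by (simp_all add: S_def bij_is_inj bij_is_surj surj_f_inv_f)
  have injT: "x = y" if "T x = T y" for x y using arg_cong[OF that, of S] by (simp only: ST)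
  have S_hom: "S (x + y) = S x + S y" "S (c *\<^sub>R x) = c *\<^sub>R S x" "S (A.br x y) = C.br (S x) (S y)" for x y c
    by (rule injT; simp add: ST linear_add[OF T(1)] linear_scale[OF T(1)] hom)+
  define \<Phi> where "\<Phi> X = C.linv (S (inv_into UNIV A.linv X))" for X
  have "inj A.linv" using A.linv_inj by (rule injI)
  then have \<Phi>: "\<Phi> (A.linv v) = C.linv (S v)" for v by (simp add: \<Phi>_def)
  have "bij_betw \<Phi> (range A.linv) (range C.linv)"
    unfolding bij_betw_def
  proof (intro conjI inj_onI equalityI subsetI)
    fix X Y assume "X \<in> range A.linv" "Y \<in> range A.linv" "\<Phi> X = \<Phi> Y"
    then obtain v w where vw: "X = A.linv v" "Y = A.linv w" by blast
    then have "S v = S w" using \<open>\<Phi> X = \<Phi> Y\<close> C.linv_inj by (simp add: \<Phi>)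
    then have "T (S v) = T (S w)" by simp
    then show "X = Y" by (simp add: vw ST)
  next
    fix Y assume "Y \<in> range C.linv"
    then obtain w where "Y = C.linv w" by blast
    then have "Y = \<Phi> (A.linv (T w))" by (simp add: \<Phi> ST)
    then show "Y \<in> \<Phi> ` range A.linv" by blast
  qed (auto simp: \<Phi>)
  moreover have "\<Phi> (vf_add (A.linv v) (A.linv w)) = vf_add (\<Phi> (A.linv v)) (\<Phi> (A.linv w))"
    "\<Phi> (lie_bracket (A.linv v) (A.linv w)) = lie_bracket (\<Phi> (A.linv v)) (\<Phi> (A.linv w))"
    "\<Phi> (vf_mult (\<lambda>_. c) (A.linv v)) = vf_mult (\<lambda>_. c) (\<Phi> (A.linv v))" for v w c
    by (simp_all add: A.linv_add[symmetric] A.linv_br[symmetric] A.linv_scale[symmetric] \<Phi>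
        C.linv_add[symmetric] C.linv_br[symmetric] C.linv_scale[symmetric] S_hom)
  ultimately show ?thesis
    unfolding locally_isomorphic_def A.LA_range C.LA_range by (intro exI[of _ \<Phi>]) auto
qed

text \<open>The linear map from the standard basis of the model space of \<open>M\<close> to the frame \<open>x1\<close>, \<open>x2\<close>, \<open>x3\<close> is an
  isomorphism of Lie algebras, since a bracket in three dimensions is a linear function of the vector
  product.\<close>

lemma locally_isomorphic_frames:
  fixes L :: "('a, real^3) smooth_group" and M :: "('b, real^3) smooth_group" and x1 x2 x3 :: "real^3"
  assumes L: "lie_group_chart L U \<phi>" and M: "lie_group_chart M V \<psi>"
    and indep: "\<And>a b c. a *\<^sub>R x1 + b *\<^sub>R x2 + c *\<^sub>R x3 = 0 \<Longrightarrow> a = 0 \<and> b = 0 \<and> c = 0"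
    and brL: "lie_group_chart.br L U \<phi> x2 x3 = d1 *\<^sub>R x1" "lie_group_chart.br L U \<phi> x3 x1 = d2 *\<^sub>R x2"
      "lie_group_chart.br L U \<phi> x1 x2 = d3 *\<^sub>R x3"
    and brM: "\<And>u v. lie_group_chart.br M V \<psi> u v =
      vector [d1 * cross3 u v $ 1, d2 * cross3 u v $ 2, d3 * cross3 u v $ 3]"
  shows "locally_isomorphic L M"
proof -
  interpret A: lie_group_chart L U \<phi> by (rule L)
  define T where "T c = c $ 1 *\<^sub>R x1 + c $ 2 *\<^sub>R x2 + c $ 3 *\<^sub>R x3" for c :: "real^3"
  have lin: "linear T" by (rule linearI) (simp_all add: T_def algebra_simps)
  have "inj T"
    unfolding linear_injective_0[OF lin]
  proof (intro allI impI)
    fix c assume "T c = 0"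
    then show "c = 0" using indep[of "c $ 1" "c $ 2" "c $ 3"] by (simp add: T_def vec_eq_iff forall_3)
  qed
  then have bij: "bij T" using linear_injective_imp_surjective[OF lin] by (simp add: bij_def)
  have bil: "bilinear A.br" using A.br_linear_left A.br_linear_right by (simp add: bilinear_def)
  note brs = bilinear_ladd[OF bil] bilinear_radd[OF bil] bilinear_lmul[OF bil] bilinear_rmul[OF bil]
  have self: "A.br x x = 0" for x using A.br_antisym[of x x] by (simp add: vec_eq_iff)
  have "T (lie_group_chart.br M V \<psi> u v) = A.br (T u) (T v)" for u v
    unfolding T_def brM brs self A.br_antisym[of x2 x1] A.br_antisym[of x3 x2] A.br_antisym[of x1 x3] brL
    by (simp add: vector_3 cross3_def algebra_simps)
  then show ?thesis by (rule locally_isomorphicI[OF L M lin bij])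
qed

lemma orthonormal_independent:
  fixes B :: "real^3 \<Rightarrow> real^3 \<Rightarrow> real"
  assumes B: "bilinear B" and x: "B x1 x1 = 1" "B x2 x2 = 1" "B x3 x3 = 1"
    "B x1 x2 = 0" "B x1 x3 = 0" "B x2 x1 = 0" "B x2 x3 = 0" "B x3 x1 = 0" "B x3 x2 = 0"
    and zero: "a *\<^sub>R x1 + b *\<^sub>R x2 + c *\<^sub>R x3 = 0"
  shows "a = 0 \<and> b = 0 \<and> c = 0"
proof -
  have "B (a *\<^sub>R x1 + b *\<^sub>R x2 + c *\<^sub>R x3) y = a * B x1 y + b * B x2 y + c * B x3 y" for y
    by (simp add: bilinear_ladd[OF B] bilinear_lmul[OF B])
  then have "a * B x1 y + b * B x2 y + c * B x3 y = 0" for y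
    by (simp add: zero bilinear_lzero[OF B])
  from this[of x1] this[of x2] this[of x3] show ?thesis by (simp add: x)
qed

text \<open>If \<open>d \<noteq> 0\<close>, then \<open>x1 / d\<close> acts on the plane of \<open>x2\<close> and \<open>x3\<close> as the infinitesimal rotation.\<close>

lemma locally_isomorphic_flat:
  fixes L :: "('a, real^3) smooth_group" and x1 x2 x3 :: "real^3"
  assumes L: "lie_group_chart L U \<phi>"
    and E: "lie_group_chart (E :: ('b, real^3) smooth_group) V \<psi>"
      "\<And>u v. lie_group_chart.br E V \<psi> u v = vector [0, cross3 u v $ 2, cross3 u v $ 3]"
    and R: "lie_group_chart (R :: ('c, real^3) smooth_group) W \<theta>" "\<And>u v. lie_group_chart.br R W \<theta> u v = 0"
    and indep: "\<And>a b c. a *\<^sub>R x1 + b *\<^sub>R x2 + c *\<^sub>R x3 = 0 \<Longrightarrow> a = 0 \<and> b = 0 \<and> c = 0"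
    and br: "lie_group_chart.br L U \<phi> x2 x3 = 0" "lie_group_chart.br L U \<phi> x3 x1 = d *\<^sub>R x2"
      "lie_group_chart.br L U \<phi> x1 x2 = d *\<^sub>R x3"
  shows "locally_isomorphic L E \<or> locally_isomorphic L R"
proof -
  interpret A: lie_group_chart L U \<phi> by (rule L)
  show ?thesis
  proof (cases "d = 0")
    case True
    have "locally_isomorphic L R"
      by (rule locally_isomorphic_frames[where ?x1.0=x1 and ?x2.0=x2 and ?x3.0=x3
            and ?d1.0=0 and ?d2.0=0 and ?d3.0=0, OF L R(1) indep])
        (use br True in \<open>auto simp: R(2) vec_eq_iff forall_3 vector_3\<close>)
    then show ?thesis ..
  next
    case False
    have indep': "a = 0 \<and> b = 0 \<and> c = 0" if "a *\<^sub>R ((1 / d) *\<^sub>R x1) + b *\<^sub>R x2 + c *\<^sub>R x3 = 0" for a b c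
      using indep[of "a / d" b c] that False by simp
    have "locally_isomorphic L E"
      by (rule locally_isomorphic_frames[where ?x1.0="(1 / d) *\<^sub>R x1" and ?x2.0=x2 and ?x3.0=x3
            and ?d1.0=0 and ?d2.0=1 and ?d3.0=1, OF L E(1) indep'])
        (use br False in \<open>auto simp: E(2) linear_scale[OF A.br_linear_left] linear_scale[OF A.br_linear_right]\<close>)
    then show ?thesis ..
  qed
qed

text \<open>Structure constants of equal sign can be normalised by rescaling the frame.\<close>

lemma locally_isomorphic_definite:
  fixes L :: "('a, real^3) smooth_group" and x1 x2 x3 :: "real^3"
  assumes L: "lie_group_chart L U \<phi>"
    and S: "lie_group_chart (S :: ('b, real^3) smooth_group) V \<psi>"
      "\<And>u v. lie_group_chart.br S V \<psi> u v = (-2) *\<^sub>R cross3 u v"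
    and indep: "\<And>a b c. a *\<^sub>R x1 + b *\<^sub>R x2 + c *\<^sub>R x3 = 0 \<Longrightarrow> a = 0 \<and> b = 0 \<and> c = 0"
    and br: "lie_group_chart.br L U \<phi> x2 x3 = l1 *\<^sub>R x1" "lie_group_chart.br L U \<phi> x3 x1 = l2 *\<^sub>R x2"
      "lie_group_chart.br L U \<phi> x1 x2 = l3 *\<^sub>R x3"
    and sign: "l1 * l2 > 0" "l2 * l3 > 0"
  shows "locally_isomorphic L S"
proof -
  interpret A: lie_group_chart L U \<phi> by (rule L)
  define r1 r2 r3 where "r1 = sqrt \<bar>l1\<bar>" and "r2 = sqrt \<bar>l2\<bar>" and "r3 = sqrt \<bar>l3\<bar>"
  have r: "r1 > 0" "r2 > 0" "r3 > 0" using sign by (auto simp: r1_def r2_def r3_def)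
  obtain s where s: "s * s = 1" "l1 = s * (r1 * r1)" "l2 = s * (r2 * r2)" "l3 = s * (r3 * r3)"
  proof (cases "l2 > 0")
    case True
    then show thesis
      using sign by (intro that[of 1]) (auto simp: r1_def r2_def r3_def zero_less_mult_iff)
  next
    case False
    then show thesis
      using sign by (intro that[of "-1"]) (auto simp: r1_def r2_def r3_def zero_less_mult_iff)
  qed
  \<comment> \<open>The factors \<open>a1\<close>, \<open>a2\<close>, \<open>a3\<close> solve \<open>a2 a3 l1 = -2 a1\<close> and its cyclic permutations.\<close>
  define a1 a2 a3 where "a1 = - 2 * s / (r2 * r3)" and "a2 = - 2 * s / (r1 * r3)" and "a3 = - 2 * s / (r1 * r2)"
  have s0: "s \<noteq> 0" using s(1) by auto
  have a0: "a1 \<noteq> 0" "a2 \<noteq> 0" "a3 \<noteq> 0" using r s0 by (auto simp: a1_def a2_def a3_def)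
  have ss: "s * (s * (s * z)) = s * z" for z using s(1) by (simp add: mult.assoc[symmetric])
  have a: "a3 * (a2 * l1) = - 2 * a1" "a1 * (a3 * l2) = - 2 * a2" "a2 * (a1 * l3) = - 2 * a3"
    unfolding s(2-4) a1_def a2_def a3_def using r by (simp_all add: field_simps ss)
  have indep': "a = 0 \<and> b = 0 \<and> c = 0" if "a *\<^sub>R (a1 *\<^sub>R x1) + b *\<^sub>R (a2 *\<^sub>R x2) + c *\<^sub>R (a3 *\<^sub>R x3) = 0" for a b c
    using indep[of "a * a1" "b * a2" "c * a3"] that a0 by simp
  show ?thesis
  proof (rule locally_isomorphic_frames[where ?x1.0="a1 *\<^sub>R x1" and ?x2.0="a2 *\<^sub>R x2" and ?x3.0="a3 *\<^sub>R x3"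
          and ?d1.0="-2" and ?d2.0="-2" and ?d3.0="-2", OF L S(1) indep'])
    show "A.br (a2 *\<^sub>R x2) (a3 *\<^sub>R x3) = (-2) *\<^sub>R (a1 *\<^sub>R x1)"
      using a(1) by (simp add: linear_scale[OF A.br_linear_left] linear_scale[OF A.br_linear_right] br mult.assoc)
    show "A.br (a3 *\<^sub>R x3) (a1 *\<^sub>R x1) = (-2) *\<^sub>R (a2 *\<^sub>R x2)"
      using a(2) by (simp add: linear_scale[OF A.br_linear_left] linear_scale[OF A.br_linear_right] br mult.assoc)
    show "A.br (a1 *\<^sub>R x1) (a2 *\<^sub>R x2) = (-2) *\<^sub>R (a3 *\<^sub>R x3)"
      using a(3) by (simp add: linear_scale[OF A.br_linear_left] linear_scale[OF A.br_linear_right] br mult.assoc)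
  qed (auto simp: S(2) vec_eq_iff forall_3 vector_3)
qed

section \<open>Conjugate symmetric statistical structures on unimodular groups\<close>

theorem theorem7p2:
  fixes G :: "('a, real^3) smooth_group"
    and g :: "'a metric_field"
    and nabla nabla_g :: "'a connection"
  assumes "lie_group G"
    and "unimodular G"
    and "left_invariant_statistical_structure G g nabla"
    and "levi_civita G g nabla_g"
    and "\<exists>X\<in>vector_fields G. \<exists>Y\<in>vector_fields G. nabla X Y \<noteq> nabla_g X Y"
    and "conjugate_symmetric G g nabla"
  shows "locally_isomorphic G SU2 \<or> locally_isomorphic G E2 \<or> locally_isomorphic G R3"
proof -
  interpret G: lie_group G by (rule assms(1))
  obtain U \<phi> where U: "(U, \<phi>) \<in> charts G" "\<one>\<^bsub>G\<^esub> \<in> U"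
    using G.chart_exists[OF G.one_closed] .
  have chart: "lie_group_chart G U \<phi>"
    using U by (intro lie_group_chart.intro assms(1) lie_group_chart_axioms.intro)
  obtain \<mu> where \<mu>: "left_haar_measure G \<mu>"
    "\<forall>a\<in>carrier G. \<forall>A\<in>sets \<mu>. emeasure \<mu> ((\<lambda>p. p \<otimes>\<^bsub>G\<^esub> a) ` A) = emeasure \<mu> A"
    using assms(2) unfolding unimodular_def by blast
  have "unimodular_chart G U \<phi> \<mu>"
    using \<mu> by (intro unimodular_chart.intro chart unimodular_chart_axioms.intro) auto
  note trace = unimodular_chart.trace_bracket_zero[OF this]
  let ?br = "lie_group_chart.br G U \<phi>"
  obtain w :: "3 \<Rightarrow> real^3" and B l1 l2 l3 where B: "bilinear B" and
    w: "\<And>i j. B (w i) (w j) = (if i = j then 1 else (0::real))" and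
    br: "?br (w 2) (w 3) = l1 *\<^sub>R w 1" "?br (w 3) (w 1) = l2 *\<^sub>R w 2" "?br (w 1) (w 2) = l3 *\<^sub>R w 3" and
    cases: "(l1 * l2 > 0 \<and> l2 * l3 > 0) \<or> (l1 = 0 \<and> l2 = l3) \<or> (l2 = 0 \<and> l3 = l1) \<or> (l3 = 0 \<and> l1 = l2)"
    by (rule conjugate_symmetric_frame[OF chart trace assms(3-6)]) (rule that; assumption)
  have indep: "a = 0 \<and> b = 0 \<and> c = 0"
    if "a *\<^sub>R w i + b *\<^sub>R w j + c *\<^sub>R w k = 0" "i \<noteq> j" "j \<noteq> k" "i \<noteq> k" for a b c i j k
    by (rule orthonormal_independent[OF B _ _ _ _ _ _ _ _ _ that(1)]) (use that w in auto)
  obtain U1 and F1 :: "complex^2^2 \<Rightarrow> real^3" where SU2: "lie_group_chart SU2 U1 F1"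
    "\<And>u v. lie_group_chart.br SU2 U1 F1 u v = (-2) *\<^sub>R cross3 u v"
    by (rule SU2_chart) (rule that; assumption)
  obtain U2 and F2 :: "(real^2^2) \<times> (real^2) \<Rightarrow> real^3" where E2: "lie_group_chart E2 U2 F2"
    "\<And>u v. lie_group_chart.br E2 U2 F2 u v = vector [0, cross3 u v $ 2, cross3 u v $ 3]"
    by (rule E2_chart) (rule that; assumption)
  obtain U3 and F3 :: "real^3 \<Rightarrow> real^3" where R3: "lie_group_chart R3 U3 F3"
    "\<And>u v. lie_group_chart.br R3 U3 F3 u v = 0"
    by (rule R3_chart) (rule that; assumption)
  note flat = locally_isomorphic_flat[OF chart E2 R3]
  from cases show ?thesis
  proof (elim disjE conjE)
    assume "l1 * l2 > 0" "l2 * l3 > 0"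
    then have "locally_isomorphic G SU2"
      by (intro locally_isomorphic_definite[OF chart SU2 _ br]) (use indep[of _ 1 _ 2 _ 3] in auto)
    then show ?thesis ..
  next
    assume "l1 = 0" "l2 = l3"
    then have "locally_isomorphic G E2 \<or> locally_isomorphic G R3"
      using br indep[of _ 1 _ 2 _ 3] by (intro flat[of "w 1" "w 2" "w 3" l2]) auto
    then show ?thesis ..
  next
    assume "l2 = 0" "l3 = l1"
    then have "locally_isomorphic G E2 \<or> locally_isomorphic G R3"
      using br indep[of _ 2 _ 3 _ 1] by (intro flat[of "w 2" "w 3" "w 1" l3]) auto
    then show ?thesis ..
  next
    assume "l3 = 0" "l1 = l2"
    then have "locally_isomorphic G E2 \<or> locally_isomorphic G R3"
      using br indep[of _ 3 _ 1 _ 2] by (intro flat[of "w 3" "w 1" "w 2" l1]) auto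
    then show ?thesis ..
  qed
qed

end
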